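(* Let $\Lambda$ be a lattice spanning the finite-dimensional real vector space $V$, and let $J\subset\mathbb C[\Lambda]$ be an ideal such that $S:=\mathbb C[\Lambda]/J$ defines (set theoretically) the single point $e^\phi$. Under the logarithm isomorphism, $\mathbb C[\Lambda]/J$ becomes isomorphic to a ring $S[V]/I$ defining the point $\phi$. In particular one gets a canonical isomorphism of the space of solutions of the difference equations given by $J$ with the space of solutions of the differential equations given by $I$. Explicitly, given $f\in S^*=(S[V]/I)^*$, the corresponding function on $\Lambda$ is $$f(a):=\langle f\mid e^a\rangle=e^{\langle a\mid\phi\rangle}\langle f\mid\exp(\tilde a)\rangle,$$ where $\langle f\mid\exp(\tilde a)\rangle$ is a polynomial in $a$.
   Context: $\mathbb C[\Lambda]$ is the group algebra with basis $e^a$, $a\in\Lambda$, the coordinate ring of the torus $T=\mathrm{Hom}(\Lambda,\mathbb C^* )$; $\phi\in U_{\mathbb C}=\mathrm{Hom}_{\mathbb R}(V,\mathbb C)$ defines the point $e^\phi\in T$ where $e^a$ has value $e^{\langle a\mid\phi\rangle}$. $S[V]$ denotes the symmetric algebra of $V\otimes\mathbb C$ (polynomial functions on $U_{\mathbb C}$). Functions $f:\Lambda\to\mathbb C$ are identified with elements of $\mathbb C[\Lambda]^*$ by $\langle f\mid e^a\rangle:=f(a)$. Multiplication by $1-e^{-a}$ is dual to the difference operator $\nabla_af(u)=f(u)-f(u-a)$; the space of solutions of the difference equations given by $J$ is the space of functions vanishing on $J$, i.e. $(\mathbb C[\Lambda]/J)^*$. Similarly $S[V]$ is identified with differential operators with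 constant coefficients on $V$ ($v\in V$ acting as the directional derivative $D_v$); for $I$ of finite codimension the space of ($C^\infty$) solutions on $V$ of the differential equations given by $I$ is identified with $(S[V]/I)^*$, an element $f$ corresponding to the function $x\mapsto\sum_k\langle f\mid x^k\rangle/k!$ on $V$. Logarithm: in $S=\mathbb C[\Lambda]/J$ the class of $e^{-\langle a\mid\phi\rangle}e^a-1$ is nilpotent for each $a\in\Lambda$; set $\tilde a:=\log\big(1+(e^{-\langle a\mid\phi\rangle}e^a-1)\big)\in S$ and $\underline a:=\tilde a+\langle a\mid\phi\rangle$. The map $a\mapsto\underline a$ is additive and extends to a surjective algebra homomorphism $S[V]\to S$; $I$ is its kernel, and the induced isomorphism $S[V]/I\cong S$ is the logarithm isomorphism. *)

theory Defs
  imports "HOL-Analysis.Analysis" "HOL-Algebra.QuotRing" "HOL-Library.Poly_Mapping"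
begin

text \<open>
  The space \<open>V\<close> is a type of class \<open>real_normed_vector\<close>; that it is finite-dimensional follows
  from being spanned by a lattice, and the norm plays no role beyond fixing the usual topology.
  (The class \<open>euclidean_space\<close> would exclude \<open>V = 0\<close>.)
  The space \<open>U\<^sub>C = Hom\<^sub>R(V, C)\<close> is the type \<open>'v \<Rightarrow>\<^sub>L complex\<close>, all linear maps on a finite-dimensional
  space being bounded.

  Functions defined only on \<open>\<Lambda>\<close> (or on the carrier of an algebra) are represented by
  functions that are zero elsewhere, so that spaces of such functions are closed under the
  pointwise operations.
\<close>

definition is_lattice :: "'v::real_vector set \<Rightarrow> bool" where
  "is_lattice \<Lambda> \<longleftrightarrow> (\<exists>B. finite B \<and> independent B \<and>
     \<Lambda> = range (\<lambda>k :: 'v \<Rightarrow> int. \<Sum>b\<in>B. of_int (k b) *\<^sub>R b))"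


section \<open>Complex function spaces\<close>

definition fun_subspace :: "('x \<Rightarrow> complex) set \<Rightarrow> bool" where
  "fun_subspace A \<longleftrightarrow> (\<lambda>_. 0) \<in> A \<and>
     (\<forall>f\<in>A. \<forall>g\<in>A. (\<lambda>x. f x + g x) \<in> A) \<and> (\<forall>c. \<forall>f\<in>A. (\<lambda>x. c * f x) \<in> A)"

definition linear_iso ::
  "(('x \<Rightarrow> complex) \<Rightarrow> ('y \<Rightarrow> complex)) \<Rightarrow> ('x \<Rightarrow> complex) set \<Rightarrow> ('y \<Rightarrow> complex) set \<Rightarrow> bool" where
  "linear_iso F A B \<longleftrightarrow> fun_subspace A \<and> fun_subspace B \<and> bij_betw F A B \<and>
     (\<forall>f\<in>A. \<forall>g\<in>A. F (\<lambda>x. f x + g x) = (\<lambda>y. F f y + F g y)) \<and>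
     (\<forall>c. \<forall>f\<in>A. F (\<lambda>x. c * f x) = (\<lambda>y. c * F f y))"


section \<open>Complex algebras\<close>

text \<open>A complex algebra is a ring \<open>A\<close> together with its structure map \<open>\<kappa>\<close> from the complex numbers.\<close>

definition algebra_hom ::
  "('a, 'm) ring_scheme \<Rightarrow> (complex \<Rightarrow> 'a) \<Rightarrow> ('b, 'n) ring_scheme \<Rightarrow> (complex \<Rightarrow> 'b) \<Rightarrow> ('a \<Rightarrow> 'b) set" where
  "algebra_hom A \<kappa> B \<kappa>' = {h \<in> ring_hom A B. \<forall>c. h (\<kappa> c) = \<kappa>' c}"

definition algebra_dual :: "('a, 'm) ring_scheme \<Rightarrow> (complex \<Rightarrow> 'a) \<Rightarrow> ('a \<Rightarrow> complex) set" where
  "algebra_dual A \<kappa> = {f.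
     (\<forall>x. x \<notin> carrier A \<longrightarrow> f x = 0) \<and>
     (\<forall>x\<in>carrier A. \<forall>y\<in>carrier A. f (x \<oplus>\<^bsub>A\<^esub> y) = f x + f y) \<and>
     (\<forall>c. \<forall>x\<in>carrier A. f (\<kappa> c \<otimes>\<^bsub>A\<^esub> x) = c * f x)}"

definition is_nilpotent :: "('a, 'm) ring_scheme \<Rightarrow> 'a \<Rightarrow> bool" where
  "is_nilpotent A x \<longleftrightarrow> (\<exists>n::nat. x [^]\<^bsub>A\<^esub> n = \<zero>\<^bsub>A\<^esub>)"

text \<open>
  The series \<open>\<Sum>\<^sub>k x\<^sup>k / k!\<close> and \<open>log (1 + x) = \<Sum>\<^sub>k\<^sub>\<ge>\<^sub>1 (-1)\<^sup>k\<^sup>+\<^sup>1 x\<^sup>k / k\<close> at a nilpotent \<open>x\<close>, summed over their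
  finitely many nonzero terms. They are meaningless if \<open>x\<close> is not nilpotent.
\<close>

definition nil_exp :: "('a, 'm) ring_scheme \<Rightarrow> (complex \<Rightarrow> 'a) \<Rightarrow> 'a \<Rightarrow> 'a" where
  "nil_exp A \<kappa> x =
     (\<Oplus>\<^bsub>A\<^esub>k\<in>{k::nat. x [^]\<^bsub>A\<^esub> k \<noteq> \<zero>\<^bsub>A\<^esub>}. \<kappa> (1 / fact k) \<otimes>\<^bsub>A\<^esub> x [^]\<^bsub>A\<^esub> k)"

definition nil_log1p :: "('a, 'm) ring_scheme \<Rightarrow> (complex \<Rightarrow> 'a) \<Rightarrow> 'a \<Rightarrow> 'a" where
  "nil_log1p A \<kappa> x =
     (\<Oplus>\<^bsub>A\<^esub>k\<in>{k::nat. 1 \<le> k \<and> x [^]\<^bsub>A\<^esub> k \<noteq> \<zero>\<^bsub>A\<^esub>}. \<kappa> ((-1) ^ (k + 1) / of_nat k) \<otimes>\<^bsub>A\<^esub> x [^]\<^bsub>A\<^esub> k)"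


section \<open>The group algebra, the torus and difference equations\<close>

text \<open>The basis element \<open>e\<^sup>a\<close> is \<open>Poly_Mapping.single a 1\<close>; multiplication is convolution.\<close>

definition group_algebra :: "'v::real_vector set \<Rightarrow> ('v \<Rightarrow>\<^sub>0 complex) ring" where
  "group_algebra \<Lambda> = \<lparr>carrier = {p. Poly_Mapping.keys p \<subseteq> \<Lambda>}, mult = (*), one = 1, zero = 0, add = (+)\<rparr>"

text \<open>
  The pairing with \<open>\<langle>f | e\<^sup>a\<rangle> = f a\<close>; for a point \<open>f\<close> of the torus this is evaluation at \<open>f\<close>.
\<close>

definition pairing :: "('v \<Rightarrow> complex) \<Rightarrow> ('v::real_vector \<Rightarrow>\<^sub>0 complex) \<Rightarrow> complex" where
  "pairing f p = (\<Sum>a\<in>Poly_Mapping.keys p. Poly_Mapping.lookup p a * f a)"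

definition torus :: "'v::real_vector set \<Rightarrow> ('v \<Rightarrow> complex) set" where
  "torus \<Lambda> = {t. (\<forall>a\<in>\<Lambda>. t a \<noteq> 0) \<and> (\<forall>a\<in>\<Lambda>. \<forall>b\<in>\<Lambda>. t (a + b) = t a * t b) \<and> (\<forall>a. a \<notin> \<Lambda> \<longrightarrow> t a = 0)}"

definition torus_zeros :: "'v::real_vector set \<Rightarrow> ('v \<Rightarrow>\<^sub>0 complex) set \<Rightarrow> ('v \<Rightarrow> complex) set" where
  "torus_zeros \<Lambda> J = {t \<in> torus \<Lambda>. \<forall>p\<in>J. pairing t p = 0}"

definition exp_point :: "'v::real_normed_vector set \<Rightarrow> ('v \<Rightarrow>\<^sub>L complex) \<Rightarrow> ('v \<Rightarrow> complex)" where
  "exp_point \<Lambda> \<phi> = (\<lambda>a. if a \<in> \<Lambda> then exp (blinfun_apply \<phi> a) else 0)"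

definition difference_solutions :: "'v::real_vector set \<Rightarrow> ('v \<Rightarrow>\<^sub>0 complex) set \<Rightarrow> ('v \<Rightarrow> complex) set" where
  "difference_solutions \<Lambda> J = {f. (\<forall>a. a \<notin> \<Lambda> \<longrightarrow> f a = 0) \<and> (\<forall>p\<in>J. pairing f p = 0)}"

lemma pairing_mult_one_minus:
  "pairing f ((1 - Poly_Mapping.single (- a) 1) * Poly_Mapping.single u 1) = f u - f (u - a)"
proof (cases "a = 0")
  case True
  then show ?thesis by (simp add: pairing_def)
next
  case False
  let ?p = "Poly_Mapping.single u 1 - Poly_Mapping.single (u - a) 1 :: 'a \<Rightarrow>\<^sub>0 complex"
  have "(1 - Poly_Mapping.single (- a) 1) * Poly_Mapping.single u 1 = ?p"
    by (simp add: left_diff_distrib mult_single)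
  moreover have "pairing f ?p = (\<Sum>x\<in>{u, u - a}. Poly_Mapping.lookup ?p x * f x)"
    unfolding pairing_def
    by (rule sum.mono_neutral_left) (auto simp: in_keys_iff lookup_minus lookup_single when_def split: if_splits)
  ultimately show ?thesis
    using False by (simp add: lookup_minus lookup_single when_def)
qed


section \<open>The symmetric algebra and differential equations\<close>

text \<open>
  \<open>S[V]\<close> as the algebra of polynomial functions on \<open>U\<^sub>C\<close>, where \<open>v \<in> V\<close> is the function \<open>\<psi> \<mapsto> \<langle>v | \<psi>\<rangle>\<close>.
\<close>

definition sym_vec :: "'v::real_normed_vector \<Rightarrow> ('v \<Rightarrow>\<^sub>L complex) \<Rightarrow> complex" where
  "sym_vec v = (\<lambda>\<psi>. blinfun_apply \<psi> v)"

definition sym_const :: "complex \<Rightarrow> ('v::real_normed_vector \<Rightarrow>\<^sub>L complex) \<Rightarrow> complex" where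
  "sym_const c = (\<lambda>\<psi>. c)"

inductive_set sym_carrier :: "(('v::real_normed_vector \<Rightarrow>\<^sub>L complex) \<Rightarrow> complex) set" where
  const: "sym_const c \<in> sym_carrier"
| vec: "sym_vec v \<in> sym_carrier"
| add: "p \<in> sym_carrier \<Longrightarrow> q \<in> sym_carrier \<Longrightarrow> (\<lambda>\<psi>. p \<psi> + q \<psi>) \<in> sym_carrier"
| mult: "p \<in> sym_carrier \<Longrightarrow> q \<in> sym_carrier \<Longrightarrow> (\<lambda>\<psi>. p \<psi> * q \<psi>) \<in> sym_carrier"

definition sym_algebra :: "(('v::real_normed_vector \<Rightarrow>\<^sub>L complex) \<Rightarrow> complex) ring" where
  "sym_algebra = \<lparr>carrier = sym_carrier, mult = (\<lambda>p q \<psi>. p \<psi> * q \<psi>), one = sym_const 1,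
     zero = sym_const 0, add = (\<lambda>p q \<psi>. p \<psi> + q \<psi>)\<rparr>"

definition sym_zeros ::
  "(('v::real_normed_vector \<Rightarrow>\<^sub>L complex) \<Rightarrow> complex) set \<Rightarrow> ('v \<Rightarrow>\<^sub>L complex) set" where
  "sym_zeros I = {\<psi>. \<forall>p\<in>I. p \<psi> = 0}"

definition dir_deriv :: "'v::real_normed_vector \<Rightarrow> ('v \<Rightarrow> complex) \<Rightarrow> ('v \<Rightarrow> complex)" where
  "dir_deriv v f = (\<lambda>x. frechet_derivative f (at x) v)"

primrec times_cont_diff :: "nat \<Rightarrow> ('v::real_normed_vector \<Rightarrow> complex) \<Rightarrow> bool" where
  "times_cont_diff 0 f \<longleftrightarrow> continuous_on UNIV f"
| "times_cont_diff (Suc k) f \<longleftrightarrow>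
     (\<forall>x. f differentiable (at x)) \<and> (\<forall>v. times_cont_diff k (dir_deriv v f))"

definition smooth :: "('v::real_normed_vector \<Rightarrow> complex) \<Rightarrow> bool" where
  "smooth f \<longleftrightarrow> (\<forall>k. times_cont_diff k f)"

text \<open>
  \<open>diff_op p P\<close> says that \<open>P\<close> is obtained from some way of writing \<open>p\<close> in terms of constants and
  vectors, by replacing each vector \<open>v\<close> by \<open>D\<^sub>v\<close> and products by composition. All operators \<open>P\<close>
  belonging to the same \<open>p\<close> agree on smooth functions, since directional derivatives
  commute there and are linear in \<open>v\<close>.
\<close>

inductive diff_op ::
  "(('v::real_normed_vector \<Rightarrow>\<^sub>L complex) \<Rightarrow> complex) \<Rightarrow> (('v \<Rightarrow> complex) \<Rightarrow> ('v \<Rightarrow> complex)) \<Rightarrow> bool" where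
  const: "diff_op (sym_const c) (\<lambda>f x. c * f x)"
| vec: "diff_op (sym_vec v) (dir_deriv v)"
| add: "diff_op p P \<Longrightarrow> diff_op q Q \<Longrightarrow> diff_op (\<lambda>\<psi>. p \<psi> + q \<psi>) (\<lambda>f x. P f x + Q f x)"
| mult: "diff_op p P \<Longrightarrow> diff_op q Q \<Longrightarrow> diff_op (\<lambda>\<psi>. p \<psi> * q \<psi>) (\<lambda>f. P (Q f))"

lemma sym_carrier_iff_diff_op: "p \<in> sym_carrier \<longleftrightarrow> (\<exists>P. diff_op p P)"
proof
  show "\<exists>P. diff_op p P" if "p \<in> sym_carrier"
    using that by induction (blast intro: diff_op.intros)+
next
  assume "\<exists>P. diff_op p P"
  then obtain P where "diff_op p P" by blast
  then show "p \<in> sym_carrier"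
    by induction (auto intro: sym_carrier.intros)
qed

definition differential_solutions ::
  "(('v::real_normed_vector \<Rightarrow>\<^sub>L complex) \<Rightarrow> complex) set \<Rightarrow> ('v \<Rightarrow> complex) set" where
  "differential_solutions I = {f. smooth f \<and> (\<forall>p\<in>I. \<forall>P. diff_op p P \<longrightarrow> P f = (\<lambda>x. 0))}"


section \<open>Quotient algebras and the logarithm\<close>

definition ga_class :: "'v::real_vector set \<Rightarrow> ('v \<Rightarrow>\<^sub>0 complex) set \<Rightarrow> ('v \<Rightarrow>\<^sub>0 complex) \<Rightarrow> ('v \<Rightarrow>\<^sub>0 complex) set" where
  "ga_class \<Lambda> J p = J +>\<^bsub>group_algebra \<Lambda>\<^esub> p"

abbreviation ga_quot :: "'v::real_vector set \<Rightarrow> ('v \<Rightarrow>\<^sub>0 complex) set \<Rightarrow> ('v \<Rightarrow>\<^sub>0 complex) set ring" where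
  "ga_quot \<Lambda> J \<equiv> group_algebra \<Lambda> Quot J"

definition ga_scalar :: "'v::real_vector set \<Rightarrow> ('v \<Rightarrow>\<^sub>0 complex) set \<Rightarrow> complex \<Rightarrow> ('v \<Rightarrow>\<^sub>0 complex) set" where
  "ga_scalar \<Lambda> J c = ga_class \<Lambda> J (Poly_Mapping.single 0 c)"

definition sym_class ::
  "(('v::real_normed_vector \<Rightarrow>\<^sub>L complex) \<Rightarrow> complex) set \<Rightarrow> (('v \<Rightarrow>\<^sub>L complex) \<Rightarrow> complex) \<Rightarrow>
   (('v \<Rightarrow>\<^sub>L complex) \<Rightarrow> complex) set" where
  "sym_class I p = I +>\<^bsub>sym_algebra\<^esub> p"

abbreviation sym_quot ::
  "(('v::real_normed_vector \<Rightarrow>\<^sub>L complex) \<Rightarrow> complex) set \<Rightarrow> (('v \<Rightarrow>\<^sub>L complex) \<Rightarrow> complex) set ring" where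
  "sym_quot I \<equiv> sym_algebra Quot I"

definition sym_scalar ::
  "(('v::real_normed_vector \<Rightarrow>\<^sub>L complex) \<Rightarrow> complex) set \<Rightarrow> complex \<Rightarrow> (('v \<Rightarrow>\<^sub>L complex) \<Rightarrow> complex) set" where
  "sym_scalar I c = sym_class I (sym_const c)"

text \<open>The class in \<open>C[\<Lambda>]/J\<close> of \<open>e\<^bsup>-\<langle>a|\<phi>\<rangle>\<^esup> e\<^sup>a - 1\<close>, then \<open>\<tilde>a\<close> and \<open>\<underline>a\<close>.\<close>

definition unip_class ::
  "'v::real_normed_vector set \<Rightarrow> ('v \<Rightarrow>\<^sub>0 complex) set \<Rightarrow> ('v \<Rightarrow>\<^sub>L complex) \<Rightarrow> 'v \<Rightarrow> ('v \<Rightarrow>\<^sub>0 complex) set" where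
  "unip_class \<Lambda> J \<phi> a = ga_class \<Lambda> J (Poly_Mapping.single a (exp (- blinfun_apply \<phi> a)) - 1)"

definition log_tilde ::
  "'v::real_normed_vector set \<Rightarrow> ('v \<Rightarrow>\<^sub>0 complex) set \<Rightarrow> ('v \<Rightarrow>\<^sub>L complex) \<Rightarrow> 'v \<Rightarrow> ('v \<Rightarrow>\<^sub>0 complex) set" where
  "log_tilde \<Lambda> J \<phi> a = nil_log1p (ga_quot \<Lambda> J) (ga_scalar \<Lambda> J) (unip_class \<Lambda> J \<phi> a)"

definition log_underline ::
  "'v::real_normed_vector set \<Rightarrow> ('v \<Rightarrow>\<^sub>0 complex) set \<Rightarrow> ('v \<Rightarrow>\<^sub>L complex) \<Rightarrow> 'v \<Rightarrow> ('v \<Rightarrow>\<^sub>0 complex) set" where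
  "log_underline \<Lambda> J \<phi> a =
     log_tilde \<Lambda> J \<phi> a \<oplus>\<^bsub>ga_quot \<Lambda> J\<^esub> ga_scalar \<Lambda> J (blinfun_apply \<phi> a)"

definition is_log_hom ::
  "'v::real_normed_vector set \<Rightarrow> ('v \<Rightarrow>\<^sub>0 complex) set \<Rightarrow> ('v \<Rightarrow>\<^sub>L complex) \<Rightarrow>
   ((('v \<Rightarrow>\<^sub>L complex) \<Rightarrow> complex) \<Rightarrow> ('v \<Rightarrow>\<^sub>0 complex) set) \<Rightarrow> bool" where
  "is_log_hom \<Lambda> J \<phi> h \<longleftrightarrow>
     h \<in> algebra_hom sym_algebra sym_const (ga_quot \<Lambda> J) (ga_scalar \<Lambda> J) \<and>
     (\<forall>a\<in>\<Lambda>. h (sym_vec a) = log_underline \<Lambda> J \<phi> a)"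

definition log_kernel ::
  "'v::real_normed_vector set \<Rightarrow> ('v \<Rightarrow>\<^sub>0 complex) set \<Rightarrow>
   ((('v \<Rightarrow>\<^sub>L complex) \<Rightarrow> complex) \<Rightarrow> ('v \<Rightarrow>\<^sub>0 complex) set) \<Rightarrow> (('v \<Rightarrow>\<^sub>L complex) \<Rightarrow> complex) set" where
  "log_kernel \<Lambda> J h = a_kernel sym_algebra (ga_quot \<Lambda> J) h"

text \<open>The map \<open>S[V]/I \<rightarrow> C[\<Lambda>]/J\<close> induced by \<open>h\<close>, where \<open>I\<close> is the kernel of \<open>h\<close>.\<close>

definition log_iso :: "((('v::real_normed_vector \<Rightarrow>\<^sub>L complex) \<Rightarrow> complex) \<Rightarrow> ('v \<Rightarrow>\<^sub>0 complex) set) \<Rightarrow>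
   (('v \<Rightarrow>\<^sub>L complex) \<Rightarrow> complex) set \<Rightarrow> ('v \<Rightarrow>\<^sub>0 complex) set" where
  "log_iso h X = the_elem (h ` X)"


section \<open>Linear functionals as solutions\<close>

definition difference_fun ::
  "'v::real_vector set \<Rightarrow> ('v \<Rightarrow>\<^sub>0 complex) set \<Rightarrow> (('v \<Rightarrow>\<^sub>0 complex) set \<Rightarrow> complex) \<Rightarrow> ('v \<Rightarrow> complex)" where
  "difference_fun \<Lambda> J f = (\<lambda>a. if a \<in> \<Lambda> then f (ga_class \<Lambda> J (Poly_Mapping.single a 1)) else 0)"

definition differential_term ::
  "(('v::real_normed_vector \<Rightarrow>\<^sub>L complex) \<Rightarrow> complex) set \<Rightarrow> ((('v \<Rightarrow>\<^sub>L complex) \<Rightarrow> complex) set \<Rightarrow> complex) \<Rightarrow>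
   'v \<Rightarrow> nat \<Rightarrow> complex" where
  "differential_term I g x k = g (sym_class I (sym_vec x [^]\<^bsub>sym_algebra\<^esub> k)) / fact k"

definition differential_fun ::
  "(('v::real_normed_vector \<Rightarrow>\<^sub>L complex) \<Rightarrow> complex) set \<Rightarrow> ((('v \<Rightarrow>\<^sub>L complex) \<Rightarrow> complex) set \<Rightarrow> complex) \<Rightarrow>
   ('v \<Rightarrow> complex)" where
  "differential_fun I g = (\<lambda>x. suminf (differential_term I g x))"

text \<open>The identification \<open>S\<^sup>* = (S[V]/I)\<^sup>*\<close> given by composition with the logarithm isomorphism.\<close>

definition dual_log_iso ::
  "'v::real_normed_vector set \<Rightarrow> ('v \<Rightarrow>\<^sub>0 complex) set \<Rightarrow>
   ((('v \<Rightarrow>\<^sub>L complex) \<Rightarrow> complex) \<Rightarrow> ('v \<Rightarrow>\<^sub>0 complex) set) \<Rightarrow>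
   (('v \<Rightarrow>\<^sub>0 complex) set \<Rightarrow> complex) \<Rightarrow> ((('v \<Rightarrow>\<^sub>L complex) \<Rightarrow> complex) set \<Rightarrow> complex)" where
  "dual_log_iso \<Lambda> J h f =
     (\<lambda>X. if X \<in> carrier (sym_quot (log_kernel \<Lambda> J h)) then f (log_iso h X) else 0)"

end

theory Submission
  imports Defs "HOL-Computational_Algebra.Fundamental_Theorem_Algebra"
begin

text \<open>
  By the Nullstellensatz, proved here from the uncountability of the complex numbers, all the
  \<open>unip a = e\<^bsup>-\<langle>a|\<phi>\<rangle>\<^esup> e\<^sup>a - 1\<close> are nilpotent modulo \<open>J\<close>; hence their logarithms are defined, additive in
  \<open>a\<close> by \<open>exp (u + v) = exp u exp v\<close>, and invert the exponential. An additive map on a lattice extends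
  to the symmetric algebra, and \<open>e\<^sup>a\<close> is the exponential of \<open>log_e a + \<langle>a|\<phi>\<rangle>\<close>, so the extension is onto.

  A functional \<open>G\<close> on the quotient corresponds to the function \<open>x \<mapsto> e\<^bsup>\<langle>x|\<phi>\<rangle>\<^esup> \<Sum>\<^sub>j G(T(x)\<^sup>j) / j!\<close> on \<open>V\<close>, where
  \<open>T\<close> is the linear extension of the logarithm. The operator \<open>p(D)\<close> turns it into the function of
  \<open>y \<mapsto> G(p y)\<close>, so it is a solution; conversely a solution \<open>f\<close> comes from \<open>p \<mapsto> (p(D) f)(0)\<close>, by Taylor
  expansion along lines through the origin.
\<close>

section \<open>Subalgebras and congruences\<close>

text \<open>Algebra is done with representatives: a subset \<open>A\<close> of a commutative ring
  type, taken modulo an ideal \<open>J\<close>. This keeps the binomial theorem, polynomials and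
  formal power series at hand; cosets enter only when the statements about the quotients are read
  off. Series at nilpotent elements become truncated sums, and modulo \<open>J\<close> the
  truncation order is immaterial once it is large enough.

  Uncountability of the scalars is effective because the lattice is countable, so that the group
  algebra has countable dimension. Elements of the symmetric algebra are functions on the complex
  dual space rather than formal polynomials; substituting ring elements for vectors is therefore
  well defined only because an expression vanishing at all complex points vanishes formally.

  On the differential side the decisive bound is uniform: finitely many nilpotent logarithms of
  basis vectors give one exponent \<open>nil_bound\<close> that kills \<open>T v\<close> modulo
  \<open>J\<close> for every vector \<open>v\<close>. It makes the cofactor of the exponential a
  polynomial on the whole space and stops the Taylor expansion of an arbitrary solution.\<close>

locale complex_subalgebra =
  fixes A :: "'r::comm_ring_1 set" and \<kappa> :: "complex \<Rightarrow> 'r"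
  assumes A_add: "x \<in> A \<Longrightarrow> y \<in> A \<Longrightarrow> x + y \<in> A"
    and A_mult: "x \<in> A \<Longrightarrow> y \<in> A \<Longrightarrow> x * y \<in> A"
    and scalar_A: "\<kappa> c \<in> A"
    and scalar_add: "\<kappa> (c + d) = \<kappa> c + \<kappa> d"
    and scalar_mult: "\<kappa> (c * d) = \<kappa> c * \<kappa> d"
    and scalar_1: "\<kappa> 1 = 1"
begin

lemma scalar_0: "\<kappa> 0 = 0"
  using scalar_add[of 0 0] by simp

lemma scalar_minus: "\<kappa> (- c) = - \<kappa> c"
  using scalar_add[of c "- c"] by (simp add: scalar_0 add_eq_0_iff)

lemma scalar_diff: "\<kappa> (c - d) = \<kappa> c - \<kappa> d"
  using scalar_add[of c "- d"] by (simp add: scalar_minus)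

lemma scalar_sum: "\<kappa> (sum f S) = (\<Sum>i\<in>S. \<kappa> (f i))"
  by (induction S rule: infinite_finite_induct) (simp_all add: scalar_0 scalar_add)

lemma scalar_of_nat: "\<kappa> (of_nat n) = of_nat n"
  by (induction n) (simp_all add: scalar_0 scalar_1 scalar_add)

lemma scalar_power: "\<kappa> (c ^ n) = \<kappa> c ^ n"
  by (induction n) (simp_all add: scalar_1 scalar_mult)

lemma scalar_unit: "c \<noteq> 0 \<Longrightarrow> \<kappa> (inverse c) * \<kappa> c = 1"
  by (simp add: scalar_1 flip: scalar_mult)

lemma A_0: "0 \<in> A" and A_1: "1 \<in> A"
  using scalar_A[of 0] scalar_A[of 1] by (simp_all add: scalar_0 scalar_1)

lemma A_minus: "x \<in> A \<Longrightarrow> - x \<in> A"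
  using A_mult[OF scalar_A[of "-1"], of x] by (simp add: scalar_minus scalar_1)

lemma A_diff: "x \<in> A \<Longrightarrow> y \<in> A \<Longrightarrow> x - y \<in> A"
  using A_add[of x "- y"] by (simp add: A_minus)

lemma A_power: "x \<in> A \<Longrightarrow> x ^ n \<in> A"
  by (induction n) (simp_all add: A_1 A_mult)

lemma A_sum: "(\<And>i. i \<in> S \<Longrightarrow> f i \<in> A) \<Longrightarrow> sum f S \<in> A"
  by (induction S rule: infinite_finite_induct) (simp_all add: A_0 A_add)

lemma A_prod: "(\<And>i. i \<in> S \<Longrightarrow> f i \<in> A) \<Longrightarrow> prod f S \<in> A"
  by (induction S rule: infinite_finite_induct) (simp_all add: A_1 A_mult)

lemma A_of_nat: "of_nat n \<in> A"
  using scalar_A[of "of_nat n"] by (simp add: scalar_of_nat)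

lemmas A_intros = A_add A_mult scalar_A A_0 A_1 A_minus A_diff A_power A_sum A_prod A_of_nat

definition is_idl :: "'r set \<Rightarrow> bool" where
  "is_idl J \<longleftrightarrow> J \<subseteq> A \<and> 0 \<in> J \<and> (\<forall>x\<in>J. \<forall>y\<in>J. x + y \<in> J) \<and> (\<forall>x\<in>A. \<forall>y\<in>J. x * y \<in> J)"

definition adjoin :: "'r set \<Rightarrow> 'r \<Rightarrow> 'r set" where
  "adjoin J y = {j + y * z |j z. j \<in> J \<and> z \<in> A}"

lemma is_idl_adjoin:
  assumes J: "is_idl J" and y: "y \<in> A"
  shows "is_idl (adjoin J y)" and "J \<subseteq> adjoin J y" and "y \<in> adjoin J y"
proof -
  show "J \<subseteq> adjoin J y"
    unfolding adjoin_def using A_0 by force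
  show "y \<in> adjoin J y"
    unfolding adjoin_def using A_1 J by (force simp: is_idl_def)
  show "is_idl (adjoin J y)"
    unfolding is_idl_def
  proof (intro conjI ballI)
    show "adjoin J y \<subseteq> A"
      using J y by (auto simp: adjoin_def is_idl_def intro!: A_intros)
    show "0 \<in> adjoin J y"
      using \<open>J \<subseteq> adjoin J y\<close> J by (auto simp: is_idl_def)
  next
    fix u v assume "u \<in> adjoin J y" "v \<in> adjoin J y"
    then obtain j z j' z' where "u = j + y * z" "v = j' + y * z'" "j \<in> J" "j' \<in> J" "z \<in> A" "z' \<in> A"
      by (auto simp: adjoin_def)
    moreover from this have "u + v = (j + j') + y * (z + z')"
      by (simp add: algebra_simps)
    ultimately show "u + v \<in> adjoin J y"
      using J unfolding adjoin_def is_idl_def by (blast intro: A_add)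
  next
    fix a v assume "a \<in> A" "v \<in> adjoin J y"
    then obtain j z where "v = j + y * z" "j \<in> J" "z \<in> A"
      by (auto simp: adjoin_def)
    moreover from this have "a * v = a * j + y * (a * z)"
      by (simp add: algebra_simps)
    ultimately show "a * v \<in> adjoin J y"
      using J \<open>a \<in> A\<close> unfolding adjoin_def is_idl_def by (blast intro: A_mult)
  qed
qed

end

locale subalgebra_ideal = complex_subalgebra A \<kappa>
  for A :: "'r::comm_ring_1 set" and \<kappa> +
  fixes J :: "'r set"
  assumes idl: "is_idl J"
begin

lemma J_A: "x \<in> J \<Longrightarrow> x \<in> A"
  and J_0: "0 \<in> J"
  and J_add: "x \<in> J \<Longrightarrow> y \<in> J \<Longrightarrow> x + y \<in> J"
  and J_mult: "x \<in> A \<Longrightarrow> y \<in> J \<Longrightarrow> x * y \<in> J"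
  using idl by (auto simp: is_idl_def)

lemma J_mult': "x \<in> J \<Longrightarrow> y \<in> A \<Longrightarrow> x * y \<in> J"
  using J_mult[of y x] by (simp add: mult.commute)

lemma J_minus: "x \<in> J \<Longrightarrow> - x \<in> J"
  using J_mult[OF scalar_A[of "-1"], of x] by (simp add: scalar_minus scalar_1)

lemma J_diff: "x \<in> J \<Longrightarrow> y \<in> J \<Longrightarrow> x - y \<in> J"
  using J_add[of x "- y"] by (simp add: J_minus)

lemma J_sum: "(\<And>i. i \<in> S \<Longrightarrow> f i \<in> J) \<Longrightarrow> sum f S \<in> J"
  by (induction S rule: infinite_finite_induct) (simp_all add: J_0 J_add)

lemma J_power_le: "x ^ m \<in> J \<Longrightarrow> x \<in> A \<Longrightarrow> m \<le> n \<Longrightarrow> x ^ n \<in> J"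
  using J_mult[of "x ^ (n - m)" "x ^ m"] by (simp add: A_power flip: power_add)

section \<open>Congruence modulo the ideal\<close>

definition cong :: "'r \<Rightarrow> 'r \<Rightarrow> bool" (infix \<open>\<asymp>\<close> 50) where
  "x \<asymp> y \<longleftrightarrow> x - y \<in> J"

lemma cong_refl [simp]: "x \<asymp> x"
  by (simp add: cong_def J_0)

lemma cong_sym: "x \<asymp> y \<Longrightarrow> y \<asymp> x"
  unfolding cong_def using J_minus by fastforce

lemma cong_trans [trans]: "x \<asymp> y \<Longrightarrow> y \<asymp> z \<Longrightarrow> x \<asymp> z"
  unfolding cong_def using J_add[of "x - y" "y - z"] by simp

lemma cong_add: "x \<asymp> y \<Longrightarrow> u \<asymp> v \<Longrightarrow> x + u \<asymp> y + v"
  unfolding cong_def using J_add[of "x - y" "u - v"] by (simp add: algebra_simps)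

lemma cong_diff: "x \<asymp> y \<Longrightarrow> u \<asymp> v \<Longrightarrow> x - u \<asymp> y - v"
  unfolding cong_def using J_diff[of "x - y" "u - v"] by (simp add: algebra_simps)

lemma cong_sum: "(\<And>i. i \<in> S \<Longrightarrow> f i \<asymp> g i) \<Longrightarrow> sum f S \<asymp> sum g S"
  unfolding cong_def using J_sum[of S "\<lambda>i. f i - g i"] by (simp add: sum_subtractf)

lemma cong_mult:
  assumes "x \<asymp> y" "u \<asymp> v" "x \<in> A" "v \<in> A"
  shows "x * u \<asymp> y * v"
proof -
  have "x * u - y * v = x * (u - v) + (x - y) * v"
    by (simp add: algebra_simps)
  then show ?thesis
    using assms by (simp add: cong_def J_add J_mult J_mult')
qed

lemma cong_scalar: "x \<asymp> y \<Longrightarrow> \<kappa> c * x \<asymp> \<kappa> c * y"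
  unfolding cong_def using J_mult[OF scalar_A] by (metis right_diff_distrib)

lemma cong_power:
  assumes "x \<asymp> y" "x \<in> A" "y \<in> A"
  shows "x ^ n \<asymp> y ^ n"
  by (induction n) (use assms in \<open>auto intro!: cong_mult A_power\<close>)

lemma cong_J: "x \<asymp> y \<Longrightarrow> x \<in> J \<longleftrightarrow> y \<in> J"
  unfolding cong_def by (metis J_add J_diff diff_add_cancel diff_diff_eq2 add_diff_cancel_left')

lemma J_cong_0: "x \<in> J \<longleftrightarrow> x \<asymp> 0"
  by (simp add: cong_def)

text \<open>In every binomial term of degree \<open>m + n\<close> either the exponent of
  \<open>u\<close> reaches \<open>m\<close> or that of \<open>v\<close> exceeds
  \<open>n\<close>.\<close>

lemma nilpotent_add:
  assumes "u ^ m \<in> J" "v ^ n \<in> J" "u \<in> A" "v \<in> A"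
  shows "(u + v) ^ (m + n) \<in> J"
  unfolding binomial_ring
proof (rule J_sum)
  fix k assume "k \<in> {..m + n}"
  show "of_nat (m + n choose k) * u ^ k * v ^ (m + n - k) \<in> J"
  proof (cases "m \<le> k")
    case True
    then have "u ^ k \<in> J"
      using J_power_le assms by blast
    then show ?thesis
      using assms by (intro J_mult' J_mult A_intros)
  next
    case False
    then have "v ^ (m + n - k) \<in> J"
      using J_power_le[of v n "m + n - k"] assms by simp
    then show ?thesis
      using assms by (intro J_mult A_intros)
  qed
qed

section \<open>Power series at nilpotent elements\<close>

text \<open>The square of indices exceeds the triangle \<open>i + j < M\<close> only by terms in
  \<open>J\<close>. This turns a product of two truncated series into a truncated Cauchy product,
  for one argument in \<open>fps_at_mult\<close> and for two in \<open>exp_at_add\<close>.\<close>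

lemma double_sum_cong:
  fixes M :: nat
  assumes "\<And>i j. i < M \<Longrightarrow> j < M \<Longrightarrow> M \<le> i + j \<Longrightarrow> f i j \<in> J"
  shows "(\<Sum>i<M. \<Sum>j<M. f i j) \<asymp> (\<Sum>n<M. \<Sum>i\<le>n. f i (n - i))"
proof -
  let ?T = "{(i, j). i + j < M}"
  have "(\<Sum>i<M. \<Sum>j<M. f i j) = sum (\<lambda>(i, j). f i j) ({..<M} \<times> {..<M})"
    by (simp add: sum.cartesian_product)
  also have "\<dots> = sum (\<lambda>(i, j). f i j) ?T + sum (\<lambda>(i, j). f i j) ({..<M} \<times> {..<M} - ?T)"
    by (subst add.commute, intro sum.subset_diff) auto
  finally have "(\<Sum>i<M. \<Sum>j<M. f i j) - sum (\<lambda>(i, j). f i j) ?T =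
      sum (\<lambda>(i, j). f i j) ({..<M} \<times> {..<M} - ?T)"
    by simp
  moreover have "sum (\<lambda>(i, j). f i j) ({..<M} \<times> {..<M} - ?T) \<in> J"
    using assms by (intro J_sum) auto
  ultimately show ?thesis
    unfolding cong_def by (simp add: sum.triangle_reindex)
qed

text \<open>Taking the coefficients from a formal power series lets identities between series,
  composition included, carry over to nilpotent elements modulo \<open>J\<close>.\<close>

definition fps_at :: "nat \<Rightarrow> complex fps \<Rightarrow> 'r \<Rightarrow> 'r" where
  "fps_at M F x = (\<Sum>k<M. \<kappa> (fps_nth F k) * x ^ k)"

lemma fps_at_A: "x \<in> A \<Longrightarrow> fps_at M F x \<in> A"
  unfolding fps_at_def by (intro A_intros)

lemma fps_at_mono:
  assumes "x ^ n \<in> J" "x \<in> A" "n \<le> M" "n \<le> M'"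
  shows "fps_at M F x \<asymp> fps_at M' F x"
proof -
  have *: "fps_at m F x \<asymp> fps_at n F x" if "n \<le> m" for m
  proof -
    have "{..<m} = {..<n} \<union> {n..<m}" using that by auto
    then have "fps_at m F x = fps_at n F x + (\<Sum>k\<in>{n..<m}. \<kappa> (fps_nth F k) * x ^ k)"
      unfolding fps_at_def by (simp add: sum.union_disjoint ivl_disj_int)
    moreover have "(\<Sum>k\<in>{n..<m}. \<kappa> (fps_nth F k) * x ^ k) \<in> J"
      using assms by (auto intro!: J_sum J_mult[OF scalar_A] intro: J_power_le[of x n])
    ultimately show ?thesis by (simp add: cong_def)
  qed
  show ?thesis
    using *[of M] *[of M'] assms by (blast intro: cong_trans cong_sym)
qed

lemma fps_at_cong: "x \<asymp> y \<Longrightarrow> x \<in> A \<Longrightarrow> y \<in> A \<Longrightarrow> fps_at M F x \<asymp> fps_at M F y"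
  unfolding fps_at_def by (intro cong_sum cong_mult cong_power A_intros) auto

lemma fps_at_mult:
  assumes x: "x ^ M \<in> J" "x \<in> A"
  shows "fps_at M F x * fps_at M G x \<asymp> fps_at M (F * G) x"
proof -
  have "fps_at M F x * fps_at M G x =
      (\<Sum>i<M. \<Sum>j<M. \<kappa> (fps_nth F i * fps_nth G j) * x ^ (i + j))"
    unfolding fps_at_def by (simp add: sum_product scalar_mult power_add mult_ac)
  also have "\<dots> \<asymp> (\<Sum>n<M. \<Sum>i\<le>n. \<kappa> (fps_nth F i * fps_nth G (n - i)) * x ^ (i + (n - i)))"
  proof (rule double_sum_cong)
    fix i j assume "M \<le> i + j"
    then have "x ^ (i + j) \<in> J"
      by (rule J_power_le[OF x])
    then show "\<kappa> (fps_nth F i * fps_nth G j) * x ^ (i + j) \<in> J"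
      by (rule J_mult[OF scalar_A])
  qed
  also have "\<dots> = fps_at M (F * G) x"
    unfolding fps_at_def
    by (simp add: fps_mult_nth scalar_sum sum_distrib_right atLeast0AtMost)
  finally show ?thesis .
qed

lemma fps_at_1: "0 < M \<Longrightarrow> fps_at M 1 x = 1"
proof -
  assume "0 < M"
  have "fps_at M 1 x = (\<Sum>k<M. if k = 0 then 1 else 0)"
    unfolding fps_at_def by (intro sum.cong) (auto simp: scalar_0 scalar_1)
  with \<open>0 < M\<close> show ?thesis by simp
qed

lemma fps_at_power:
  assumes x: "x ^ M \<in> J" "x \<in> A" and M: "0 < M"
  shows "fps_at M F x ^ n \<asymp> fps_at M (F ^ n) x"
proof (induction n)
  case 0
  show ?case using M by (simp add: fps_at_1)
next
  case (Suc n)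
  have "fps_at M F x * fps_at M F x ^ n \<asymp> fps_at M F x * fps_at M (F ^ n) x"
    by (rule cong_mult[OF cong_refl Suc fps_at_A fps_at_A]) (use x in auto)
  also have "\<dots> \<asymp> fps_at M (F * F ^ n) x"
    using x by (rule fps_at_mult)
  finally show ?case by simp
qed

lemma fps_at_compose:
  assumes x: "x ^ M \<in> J" "x \<in> A" and M: "0 < M" and G: "fps_nth G 0 = 0"
  shows "fps_at M F (fps_at M G x) \<asymp> fps_at M (F oo G) x"
proof -
  \<comment> \<open>Since \<open>G\<close> has no constant term, \<open>G ^ i\<close> starts in
    degree \<open>i\<close>; summands with \<open>i > k\<close> vanish, so one range
    \<open>i < M\<close> serves all coefficients below \<open>M\<close>.\<close>
  have nth: "fps_nth (F oo G) k = (\<Sum>i<M. fps_nth F i * fps_nth (G ^ i) k)" if "k < M" for k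
    unfolding fps_compose_nth
    using that by (intro sum.mono_neutral_left) (auto simp: startsby_zero_power_prefix[OF G])
  have "fps_at M F (fps_at M G x) \<asymp> (\<Sum>i<M. \<kappa> (fps_nth F i) * fps_at M (G ^ i) x)"
    unfolding fps_at_def[of M F]
    by (rule cong_sum, rule cong_scalar, rule fps_at_power[OF x M])
  also have "\<dots> = (\<Sum>k<M. \<Sum>i<M. \<kappa> (fps_nth F i * fps_nth (G ^ i) k) * x ^ k)"
    unfolding fps_at_def sum_distrib_left
    by (subst sum.swap) (simp add: scalar_mult mult_ac)
  also have "\<dots> = fps_at M (F oo G) x"
    unfolding fps_at_def by (intro sum.cong) (simp_all add: nth scalar_sum sum_distrib_right)
  finally show ?thesis .
qed

lemma fps_at_X: "1 < M \<Longrightarrow> fps_at M fps_X x = x"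
proof -
  assume "1 < M"
  have "fps_at M fps_X x = (\<Sum>k<M. if k = 1 then x else 0)"
    unfolding fps_at_def by (intro sum.cong) (auto simp: fps_X_def scalar_0 scalar_1)
  with \<open>1 < M\<close> show ?thesis by simp
qed

lemma fps_at_add: "fps_at M (F + G) x = fps_at M F x + fps_at M G x"
  by (simp add: fps_at_def scalar_add distrib_right sum.distrib)

section \<open>Exponential and logarithm of nilpotent elements\<close>

abbreviation exp_at :: "nat \<Rightarrow> 'r \<Rightarrow> 'r" where
  "exp_at M \<equiv> fps_at M (fps_exp 1)"

abbreviation ln_at :: "nat \<Rightarrow> 'r \<Rightarrow> 'r" where
  "ln_at M \<equiv> fps_at M (fps_ln 1)"

text \<open>A factor \<open>x\<close> survives from each term, so the value of such a series
  inherits from \<open>x\<close> the very same nilpotency exponent.\<close>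

lemma fps_at_divisible:
  assumes "fps_nth F 0 = 0" "x \<in> A"
  obtains w where "w \<in> A" "fps_at M F x = x * w"
proof
  let ?w = "\<Sum>k\<in>{1..<M}. \<kappa> (fps_nth F k) * x ^ (k - 1)"
  show "?w \<in> A" using assms by (intro A_intros)
  have "fps_at M F x = (\<Sum>k\<in>{1..<M}. \<kappa> (fps_nth F k) * x ^ k)"
    unfolding fps_at_def
    by (intro sum.mono_neutral_right) (auto simp: assms scalar_0 not_le Suc_le_eq)
  also have "\<dots> = x * ?w"
    unfolding sum_distrib_left by (intro sum.cong) (auto simp: power_eq_if mult_ac)
  finally show "fps_at M F x = x * ?w" .
qed

lemma fps_at_nilpotent:
  assumes "fps_nth F 0 = 0" "x \<in> A" "x ^ n \<in> J"
  shows "fps_at M F x ^ n \<in> J"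
proof -
  obtain w where "w \<in> A" "fps_at M F x = x * w"
    using fps_at_divisible assms by blast
  then show ?thesis
    using assms by (simp add: power_mult_distrib J_mult' A_power)
qed

text \<open>\<open>fps_ln 1\<close> is the series of log (1 + X), the compositional inverse of exp -
  1.\<close>

lemma exp_ln_1: "fps_exp (1::complex) oo fps_ln 1 = 1 + fps_X"
proof -
  have "(fps_exp (1::complex) - 1) oo fps_ln 1 = fps_X"
    by (simp only: fps_ln_fps_exp_inv[OF one_neq_zero] fps_inv_fps_exp_compose(2)[OF one_neq_zero])
  then have "(fps_exp (1::complex) oo fps_ln 1) - 1 = fps_X"
    by (simp add: fps_compose_sub_distrib)
  then show ?thesis by (simp add: algebra_simps)
qed

lemma ln_exp_1: "fps_ln (1::complex) oo (fps_exp 1 - 1) = fps_X"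
  by (simp only: fps_ln_fps_exp_inv[OF one_neq_zero] fps_inv_fps_exp_compose(1)[OF one_neq_zero])

lemma exp_ln_at:
  assumes "x ^ M \<in> J" "x \<in> A" "1 < M"
  shows "exp_at M (ln_at M x) \<asymp> 1 + x"
  using fps_at_compose[of x M "fps_ln 1" "fps_exp 1"] assms
  by (simp add: exp_ln_1 fps_at_add fps_at_X fps_at_1)

lemma ln_exp_at:
  assumes "x ^ M \<in> J" "x \<in> A" "1 < M"
  shows "ln_at M (exp_at M x - 1) \<asymp> x"
proof -
  have "exp_at M x - 1 = fps_at M (fps_exp 1 - 1) x"
    using fps_at_add[of M "fps_exp 1 - 1" 1 x] assms by (simp add: fps_at_1)
  then show ?thesis
    using fps_at_compose[of x M "fps_exp 1 - 1" "fps_ln 1"] assms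
    by (simp add: ln_exp_1 fps_at_X)
qed

text \<open>The truncation order is doubled because \<open>i + j\<close> at least
  \<open>2 * N\<close> forces one of the two exponents up to \<open>N\<close>. Inside the triangle,
  terms of equal degree combine by the binomial theorem.\<close>

lemma exp_at_add:
  assumes "u ^ N \<in> J" "v ^ N \<in> J" "u \<in> A" "v \<in> A"
  shows "exp_at (2 * N) (u + v) \<asymp> exp_at (2 * N) u * exp_at (2 * N) v"
proof -
  let ?M = "2 * N"
  have binom: "(\<Sum>i\<le>n. \<kappa> (1 / fact i * (1 / fact (n - i))) * (u ^ i * v ^ (n - i))) =
      \<kappa> (1 / fact n) * (u + v) ^ n" for n
  proof -
    have "\<kappa> (1 / fact i * (1 / fact (n - i))) * (u ^ i * v ^ (n - i)) =
        \<kappa> (1 / fact n) * (of_nat (n choose i) * u ^ i * v ^ (n - i))" if "i \<le> n" for i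
    proof -
      have "1 / fact i * (1 / fact (n - i)) = 1 / fact n * (of_nat (n choose i) :: complex)"
        using that by (simp add: binomial_fact)
      then have "\<kappa> (1 / fact i * (1 / fact (n - i))) = \<kappa> (1 / fact n) * of_nat (n choose i)"
        by (simp only: scalar_mult scalar_of_nat)
      then show ?thesis
        by (simp only: mult_ac)
    qed
    then show ?thesis
      unfolding binomial_ring sum_distrib_left by simp
  qed
  have "exp_at ?M u * exp_at ?M v =
      (\<Sum>i<?M. \<Sum>j<?M. \<kappa> (1 / fact i * (1 / fact j)) * (u ^ i * v ^ j))"
    unfolding fps_at_def sum_product scalar_mult by (simp add: mult_ac)
  also have "\<dots> \<asymp> (\<Sum>n<?M. \<Sum>i\<le>n. \<kappa> (1 / fact i * (1 / fact (n - i))) * (u ^ i * v ^ (n - i)))"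
  proof (rule double_sum_cong)
    fix i j assume "?M \<le> i + j"
    then consider "N \<le> i" | "N \<le> j" by linarith
    then have "u ^ i * v ^ j \<in> J"
    proof cases
      case 1
      then show ?thesis using J_power_le[OF assms(1,3)] assms by (intro J_mult' A_power)
    next
      case 2
      then show ?thesis using J_power_le[OF assms(2,4)] assms by (intro J_mult A_power)
    qed
    then show "\<kappa> (1 / fact i * (1 / fact j)) * (u ^ i * v ^ j) \<in> J"
      by (rule J_mult[OF scalar_A])
  qed
  also have "\<dots> = exp_at ?M (u + v)"
    unfolding binom by (simp add: fps_at_def)
  finally show ?thesis by (rule cong_sym)
qed

text \<open>Exponentiating, the claim becomes \<open>exp (u + v) = exp u exp v\<close>.\<close>

lemma ln_at_add:
  assumes x: "x ^ N \<in> J" "x \<in> A" and y: "y ^ N \<in> J" "y \<in> A" and N: "1 < N"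
  shows "ln_at (2 * N) (x + y + x * y) \<asymp> ln_at (2 * N) x + ln_at (2 * N) y"
proof -
  let ?M = "2 * N" let ?u = "ln_at ?M x" let ?v = "ln_at ?M y"
  have uv: "?u \<in> A" "?v \<in> A" "?u ^ N \<in> J" "?v ^ N \<in> J"
    using x y by (auto intro: fps_at_A fps_at_nilpotent)
  have "x ^ ?M \<in> J" "y ^ ?M \<in> J"
    using x y J_power_le[of x N ?M] J_power_le[of y N ?M] by auto
  then have "exp_at ?M ?u \<asymp> 1 + x" "exp_at ?M ?v \<asymp> 1 + y"
    using x y N by (auto intro: exp_ln_at)
  then have "exp_at ?M ?u * exp_at ?M ?v \<asymp> (1 + x) * (1 + y)"
    using x y uv by (intro cong_mult fps_at_A A_intros)
  with exp_at_add[OF uv(3,4,1,2)] have "exp_at ?M (?u + ?v) \<asymp> (1 + x) * (1 + y)"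
    by (rule cong_trans)
  then have "exp_at ?M (?u + ?v) - 1 \<asymp> (1 + x) * (1 + y) - 1"
    by (intro cong_diff) auto
  also have "(1 + x) * (1 + y) - 1 = x + y + x * y"
    by (simp add: algebra_simps)
  finally have *: "ln_at ?M (exp_at ?M (?u + ?v) - 1) \<asymp> ln_at ?M (x + y + x * y)"
    using x y uv by (intro fps_at_cong fps_at_A A_intros) auto
  \<comment> \<open>The sum of the logarithms is killed by the exponent \<open>N + N\<close>,
    exactly the truncation order at which \<open>ln_exp_at\<close> is applied.\<close>
  have "(?u + ?v) ^ ?M \<in> J"
    using nilpotent_add[OF uv(3,4,1,2)] by (simp add: mult_2)
  then have "ln_at ?M (exp_at ?M (?u + ?v) - 1) \<asymp> ?u + ?v"
    using uv N by (intro ln_exp_at A_add) auto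
  with * show ?thesis
    by (blast intro: cong_trans cong_sym)
qed

end

section \<open>A Nullstellensatz for algebras of countable dimension\<close>

text \<open>Through \<open>\<kappa>\<close> the whole ring type is a complex vector space; this
  supplies \<open>span\<close> and \<open>dependent\<close> for the dimension count.\<close>

sublocale complex_subalgebra \<subseteq> scal: vector_space "\<lambda>c x. \<kappa> c * x"
  by unfold_locales (simp_all add: scalar_add scalar_mult scalar_1 algebra_simps)

context complex_subalgebra
begin

definition poly_at :: "complex poly \<Rightarrow> 'r \<Rightarrow> 'r" where
  "poly_at q y = poly (map_poly \<kappa> q) y"

lemma poly_at_0: "poly_at 0 y = 0"
  by (simp add: poly_at_def)

lemma poly_at_pCons: "poly_at (pCons c q) y = \<kappa> c + y * poly_at q y"
  by (simp add: poly_at_def map_poly_pCons scalar_0)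

lemma poly_at_A: "y \<in> A \<Longrightarrow> poly_at q y \<in> A"
  by (induction q) (simp_all add: poly_at_0 poly_at_pCons A_intros)

lemma poly_at_add: "poly_at (p + q) y = poly_at p y + poly_at q y"
  by (induction p q rule: poly_induct2) (simp_all add: poly_at_0 poly_at_pCons scalar_add algebra_simps)

lemma poly_at_smult: "poly_at (smult c q) y = \<kappa> c * poly_at q y"
  by (induction q) (simp_all add: poly_at_0 poly_at_pCons scalar_mult algebra_simps)

lemma poly_at_mult: "poly_at (p * q) y = poly_at p y * poly_at q y"
  by (induction p) (simp_all add: poly_at_0 poly_at_pCons poly_at_add poly_at_smult scalar_0 algebra_simps)

lemma poly_at_1: "poly_at 1 y = 1"
  by (simp add: one_pCons poly_at_pCons poly_at_0 scalar_1)

lemma poly_at_sum: "poly_at (sum f S) y = (\<Sum>i\<in>S. poly_at (f i) y)"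
  by (induction S rule: infinite_finite_induct) (simp_all add: poly_at_0 poly_at_add)

lemma poly_at_prod: "poly_at (prod f S) y = (\<Prod>i\<in>S. poly_at (f i) y)"
  by (induction S rule: infinite_finite_induct) (simp_all add: poly_at_1 poly_at_mult)

lemma poly_at_linear: "poly_at [:- c, 1:] y = y - \<kappa> c"
  by (simp add: poly_at_pCons poly_at_0 scalar_minus scalar_1)

text \<open>Each linear factor \<open>y - \<kappa> c\<close> of \<open>q\<close> can be traded for a
  power of \<open>x\<close>: some \<open>x ^ k\<close> equals a multiple of that factor modulo
  \<open>J\<close>, and multiplying \<open>x ^ n * q' (y)\<close> by it rebuilds
  \<open>x ^ n * q (y)\<close>. The degree drops until a nonzero constant remains, which is a
  unit.\<close>

lemma power_mem_if_annihilated: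
  assumes J: "is_idl J" and A: "x \<in> A" "y \<in> A"
    and ev: "\<And>c. \<exists>n. x ^ n \<in> adjoin J (y - \<kappa> c)"
    and q: "q \<noteq> 0" "x ^ n * poly_at q y \<in> J"
  shows "\<exists>m. x ^ m \<in> J"
  using q
proof (induction "degree q" arbitrary: q n)
  interpret subalgebra_ideal A \<kappa> J
    by unfold_locales (rule J)
  {
    case 0
    then obtain c where c: "q = [:c:]" "c \<noteq> 0"
      by (metis degree_eq_zeroE pCons_0_0)
    then have "x ^ n * \<kappa> c \<in> J"
      using 0 by (simp add: poly_at_pCons poly_at_0)
    then have "\<kappa> (inverse c) * (x ^ n * \<kappa> c) \<in> J"
      by (rule J_mult[OF scalar_A])
    moreover have "\<kappa> (inverse c) * (x ^ n * \<kappa> c) = x ^ n * (\<kappa> (inverse c) * \<kappa> c)"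
      by (simp only: mult_ac)
    ultimately show ?case
      using c by (auto simp: scalar_unit)
  next
    case (Suc d)
    then have "\<not> constant (poly q)"
      by (simp add: constant_degree)
    then obtain c where "poly q c = 0"
      using fundamental_theorem_of_algebra by blast
    then obtain q' where q': "q = [:- c, 1:] * q'"
      unfolding poly_eq_0_iff_dvd by (elim dvdE)
    with Suc.prems(1) have "q' \<noteq> 0" by auto
    have "degree q = Suc (degree q')"
      unfolding q' using \<open>q' \<noteq> 0\<close> by (subst degree_mult_eq) auto
    with Suc.hyps(2) have d: "d = degree q'" by simp
    obtain k j z where k: "x ^ k = j + (y - \<kappa> c) * z" "j \<in> J" "z \<in> A"
      using ev[of c] by (auto simp: adjoin_def)
    have "x ^ (n + k) * poly_at q' y = (x ^ n * poly_at q' y) * j + (x ^ n * poly_at q y) * z"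
      unfolding q' poly_at_mult poly_at_linear power_add k(1) by (simp add: algebra_simps)
    also have "\<dots> \<in> J"
      using A by (intro J_add[OF J_mult[OF _ k(2)] J_mult'[OF Suc.prems(2) k(3)]] A_mult A_power poly_at_A)
    finally show ?case
      using Suc.hyps(1)[OF d \<open>q' \<noteq> 0\<close>] by blast
  }
qed

text \<open>
  If \<open>y - c\<close> divided a power of \<open>x\<close> modulo \<open>J\<close> for every \<open>c\<close>, uncountably many of the quotients would
  lie in a common finite-dimensional space. A linear relation between them gives a nonzero
  polynomial in \<open>y\<close> that annihilates a power of \<open>x\<close>.
\<close>

lemma scalar_value_avoiding_powers:
  assumes J: "is_idl J" and A: "x \<in> A" "y \<in> A"
    and E: "countable E" "\<And>z. z \<in> A \<Longrightarrow> \<exists>F. finite F \<and> F \<subseteq> E \<and> z \<in> scal.span F"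
    and x: "\<And>n. x ^ n \<notin> J"
  shows "\<exists>c. \<forall>n. x ^ n \<notin> adjoin J (y - \<kappa> c)"
proof (rule ccontr)
  interpret subalgebra_ideal A \<kappa> J
    by unfold_locales (rule J)
  assume "\<not> ?thesis"
  then have ev: "\<exists>n. x ^ n \<in> adjoin J (y - \<kappa> c)" for c by blast
  have "\<exists>n z. z \<in> A \<and> x ^ n - (y - \<kappa> c) * z \<in> J" for c
  proof -
    obtain n j z where "x ^ n = j + (y - \<kappa> c) * z" "j \<in> J" "z \<in> A"
      using ev[of c] by (auto simp: adjoin_def)
    then show ?thesis
      by (intro exI[of _ n] exI[of _ z]) simp
  qed
  then obtain n z where z: "\<And>c. z c \<in> A" "\<And>c. x ^ n c - (y - \<kappa> c) * z c \<in> J"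
    by metis
  from E(2)[OF z(1)] obtain F where F: "\<And>c. finite (F c)" "\<And>c. F c \<subseteq> E" "\<And>c. z c \<in> scal.span (F c)"
    by metis
  \<comment> \<open>Pigeonhole: there are only countably many pairs of an exponent and a finite
    subset of \<open>E\<close>, and countably many finite fibres cannot cover the complex
    numbers.\<close>
  have "\<exists>N G. infinite {c. n c = N \<and> F c = G}"
  proof (rule ccontr)
    assume "\<not> ?thesis"
    then have fin: "finite {c. n c = N \<and> F c = G}" for N G by blast
    have "countable (\<Union>(N, G) \<in> UNIV \<times> {G. finite G \<and> G \<subseteq> E}. {c. n c = N \<and> F c = G})"
      using E(1) fin
      by (intro countable_UN countable_SIGMA countable_Collect_finite_subset)
        (auto intro: countable_finite)
    moreover have "(\<Union>(N, G) \<in> UNIV \<times> {G. finite G \<and> G \<subseteq> E}. {c. n c = N \<and> F c = G}) = UNIV"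
      using F by auto
    ultimately show False
      using uncountable_UNIV_complex by simp
  qed
  then obtain N G where inf: "infinite {c. n c = N \<and> F c = G}" by blast
  \<comment> \<open>One scalar more than \<open>card G\<close>: the quotients \<open>z c\<close> all
    lie in the span of \<open>G\<close>, so they must be linearly dependent once they are known to
    be distinct.\<close>
  then obtain T where T: "T \<subseteq> {c. n c = N \<and> F c = G}" "finite T" "card T = Suc (card G)"
    by (meson infinite_arbitrarily_large)
  have zT: "x ^ N - (y - \<kappa> c) * z c \<in> J" "z c \<in> scal.span G" if "c \<in> T" for c
    using that T(1) z(2)[of c] F(3)[of c] by auto
  have "finite G"
    using T F(1) by (cases "T = {}") auto
  \<comment> \<open>If \<open>z c = z d\<close>, subtracting the two congruences puts
    \<open>\<kappa> (d - c) * z c\<close> into \<open>J\<close>. As \<open>d - c\<close> is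
    invertible, \<open>z c\<close> and then \<open>x ^ N\<close> would lie in
    \<open>J\<close>.\<close>
  have inj: "inj_on z T"
  proof (rule inj_onI, rule ccontr)
    fix c d assume cd: "c \<in> T" "d \<in> T" "z c = z d" "c \<noteq> d"
    have "(x ^ N - (y - \<kappa> d) * z d) - (x ^ N - (y - \<kappa> c) * z c) \<in> J"
      by (rule J_diff[OF zT(1)[OF cd(2)] zT(1)[OF cd(1)]])
    also have "(x ^ N - (y - \<kappa> d) * z d) - (x ^ N - (y - \<kappa> c) * z c) = \<kappa> (d - c) * z c"
      unfolding cd(3) scalar_diff by (simp add: algebra_simps)
    finally have "\<kappa> (inverse (d - c)) * (\<kappa> (d - c) * z c) \<in> J"
      by (rule J_mult[OF scalar_A])
    moreover have "\<kappa> (inverse (d - c)) * (\<kappa> (d - c) * z c) = z c"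
      using cd by (simp add: scalar_unit flip: mult.assoc)
    ultimately have "(x ^ N - (y - \<kappa> c) * z c) + (y - \<kappa> c) * z c \<in> J"
      using A by (intro J_add[OF zT(1)[OF cd(1)] J_mult] A_diff scalar_A) auto
    with x[of N] show False by simp
  qed
  have "scal.dependent (z ` T)"
    using scal.independent_span_bound[OF \<open>finite G\<close>, of "z ` T"] zT(2) T(3) card_image[OF inj]
    by auto
  then obtain u where u: "\<exists>v\<in>z ` T. u v \<noteq> 0" "(\<Sum>v\<in>z ` T. \<kappa> (u v) * v) = 0"
    using T(2) scal.dependent_finite[of "z ` T"] by auto
  define \<alpha> where "\<alpha> c = u (z c)" for c
  have rel: "(\<Sum>c\<in>T. \<kappa> (\<alpha> c) * z c) = 0"
    using u(2) by (simp add: sum.reindex[OF inj] \<alpha>_def)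
  obtain c0 where c0: "c0 \<in> T" "\<alpha> c0 \<noteq> 0"
    using u(1) by (auto simp: \<alpha>_def)
  \<comment> \<open>Multiply \<open>rel\<close> by the product of all \<open>y - \<kappa> d\<close>
    and replace each \<open>(y - \<kappa> c) * z c\<close> by \<open>x ^ N\<close>: what stands next
    to \<open>x ^ N\<close> is this polynomial in \<open>y\<close>. It is nonzero because at
    \<open>c0\<close> every other summand contains a vanishing factor.\<close>
  define q where "q = (\<Sum>c\<in>T. smult (\<alpha> c) (\<Prod>d\<in>T - {c}. [:- d, 1:]))"
  have "poly q c0 = (\<Sum>c\<in>T. if c = c0 then \<alpha> c0 * (\<Prod>d\<in>T - {c0}. c0 - d) else 0)"
    unfolding q_def poly_sum
  proof (rule sum.cong)
    fix c assume "c \<in> T"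
    have "(\<Prod>d\<in>T - {c}. c0 - d) = 0" if "c \<noteq> c0"
      using that c0(1) T(2) by (intro prod_zero) auto
    then show "poly (smult (\<alpha> c) (\<Prod>d\<in>T - {c}. [:- d, 1:])) c0 =
        (if c = c0 then \<alpha> c0 * (\<Prod>d\<in>T - {c0}. c0 - d) else 0)"
      by (auto simp: poly_prod)
  qed simp
  also have "\<dots> \<noteq> 0"
    using c0 T(2) by simp
  finally have "q \<noteq> 0" by auto
  have "x ^ N * poly_at q y = (\<Sum>c\<in>T. \<kappa> (\<alpha> c) * (\<Prod>d\<in>T - {c}. y - \<kappa> d) * x ^ N)"
    unfolding q_def by (simp add: poly_at_sum poly_at_smult poly_at_prod poly_at_linear
        sum_distrib_left mult_ac)
  also have "\<dots> \<asymp> (\<Sum>c\<in>T. \<kappa> (\<alpha> c) * (\<Prod>d\<in>T - {c}. y - \<kappa> d) * ((y - \<kappa> c) * z c))"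
    using zT(1) A z(1) by (intro cong_sum cong_mult A_intros) (auto simp: cong_def)
  also have "\<dots> = (\<Sum>c\<in>T. \<kappa> (\<alpha> c) * z c * (\<Prod>d\<in>T. y - \<kappa> d))"
    using T(2) by (intro sum.cong refl) (subst prod.remove[where x = x for x], auto simp: mult_ac)
  also have "\<dots> = 0"
    by (simp add: rel flip: sum_distrib_right)
  finally have "x ^ N * poly_at q y \<in> J"
    by (simp add: J_cong_0)
  then show False
    using power_mem_if_annihilated[OF J A ev \<open>q \<noteq> 0\<close>] x by blast
qed

text \<open>The elements \<open>y b\<close> are made scalar one after the other; relations already
  adjoined persist in the larger ideal. Applied to the generators of the group algebra, the scalars
  are the coordinates of a torus point.\<close>

lemma scalar_values_avoiding_powers:
  assumes B: "finite B" and J: "is_idl J" and x: "x \<in> A" "\<And>n. x ^ n \<notin> J"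
    and y: "\<And>b. b \<in> B \<Longrightarrow> y b \<in> A"
    and E: "countable E" "\<And>z. z \<in> A \<Longrightarrow> \<exists>F. finite F \<and> F \<subseteq> E \<and> z \<in> scal.span F"
  shows "\<exists>J' c. is_idl J' \<and> J \<subseteq> J' \<and> (\<forall>n. x ^ n \<notin> J') \<and> (\<forall>b\<in>B. y b - \<kappa> (c b) \<in> J')"
  using B y
proof (induction B)
  case empty
  then show ?case using J x by blast
next
  case (insert b B)
  then obtain J' c where J': "is_idl J'" "J \<subseteq> J'" "\<forall>n. x ^ n \<notin> J'" "\<forall>b\<in>B. y b - \<kappa> (c b) \<in> J'"
    by auto
  obtain d where d: "\<And>n. x ^ n \<notin> adjoin J' (y b - \<kappa> d)"
    using scalar_value_avoiding_powers[OF J'(1) x(1) _ E J'(3)[rule_format], of "y b"] insert.prems by auto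
  have yb: "y b - \<kappa> d \<in> A"
    using insert.prems by (auto intro: A_intros)
  note adj = is_idl_adjoin[OF J'(1) yb]
  have "y b' - \<kappa> ((c(b := d)) b') \<in> adjoin J' (y b - \<kappa> d)" if "b' \<in> insert b B" for b'
    using that adj J'(4) insert.hyps by auto
  with adj J'(2) d show ?case
    by (intro exI[of _ "adjoin J' (y b - \<kappa> d)"] exI[of _ "c(b := d)"]) auto
qed

end

section \<open>Coordinates on a finite-dimensional normed space\<close>

text \<open>The source of continuity for all coordinate functionals. The essential point of the
  induction is that a new basis vector keeps a positive distance from the span of the old
  ones.\<close>

lemma coefficients_bounded_by_norm:
  fixes B :: "'v::real_normed_vector set"
  assumes "finite B" "independent B"
  shows "\<exists>C. \<forall>u. \<forall>b\<in>B. \<bar>u b\<bar> \<le> C * norm (\<Sum>b\<in>B. u b *\<^sub>R b)"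
  using assms
proof (induction B)
  case empty
  then show ?case by simp
next
  case (insert b B)
  have "independent B" "b \<notin> span B"
    using insert by (auto simp: independent_insert)
  then obtain C where C: "\<And>u c. c \<in> B \<Longrightarrow> \<bar>u c\<bar> \<le> C * norm (\<Sum>c\<in>B. u c *\<^sub>R c)"
    using insert.IH by blast
  \<comment> \<open>Otherwise combinations of \<open>B\<close> converge to \<open>b\<close>. By the
    induction hypothesis their coefficients are Cauchy, hence convergent, and the limit exhibits
    \<open>b\<close> as an element of \<open>span B\<close>.\<close>
  have "\<exists>d>0. \<forall>u. d \<le> norm (b - (\<Sum>c\<in>B. u c *\<^sub>R c))"
  proof (rule ccontr)
    assume "\<not> ?thesis"
    then have "\<forall>n. \<exists>u. norm (b - (\<Sum>c\<in>B. u c *\<^sub>R c)) < 1 / Suc n"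
      by (metis not_less of_nat_0_less_iff zero_less_Suc zero_less_divide_1_iff)
    then obtain u where u: "\<And>n. norm (b - (\<Sum>c\<in>B. u n c *\<^sub>R c)) < 1 / Suc n" by metis
    define w where "w n = (\<Sum>c\<in>B. u n c *\<^sub>R c)" for n
    have "(\<lambda>n. b - w n) \<longlonglongrightarrow> 0"
      using u unfolding w_def
      by (intro Lim_null_comparison[OF always_eventually LIMSEQ_inverse_real_of_nat])
        (auto simp: inverse_eq_divide less_imp_le)
    then have w: "w \<longlonglongrightarrow> b"
      using tendsto_diff[OF tendsto_const, of "\<lambda>n. b - w n" 0 sequentially b] by simp
    have "\<exists>l. (\<lambda>n. u n c) \<longlonglongrightarrow> l" if "c \<in> B" for c
    proof -
      have bd: "\<bar>u m c - u n c\<bar> \<le> C * norm (w m - w n)" for m n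
        using C[OF that, of "\<lambda>c. u m c - u n c"]
        by (simp add: w_def scaleR_left_diff_distrib sum_subtractf)
      have "Cauchy (\<lambda>n. u n c)"
      proof (rule CauchyI)
        fix e :: real assume "0 < e"
        then have "0 < e / (\<bar>C\<bar> + 1)" by simp
        then obtain M where M: "\<And>m n. m \<ge> M \<Longrightarrow> n \<ge> M \<Longrightarrow> norm (w m - w n) < e / (\<bar>C\<bar> + 1)"
          using CauchyD[OF LIMSEQ_imp_Cauchy[OF w]] by blast
        have "norm (u m c - u n c) < e" if "m \<ge> M" "n \<ge> M" for m n
        proof -
          have "C * norm (w m - w n) \<le> (\<bar>C\<bar> + 1) * norm (w m - w n)"
            by (intro mult_right_mono) auto
          with bd[of m n] have "norm (u m c - u n c) \<le> (\<bar>C\<bar> + 1) * norm (w m - w n)" by simp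
          also have "\<dots> < e"
            using M[OF that] by (simp add: field_simps)
          finally show ?thesis .
        qed
        then show "\<exists>M. \<forall>m\<ge>M. \<forall>n\<ge>M. norm (u m c - u n c) < e" by blast
      qed
      then show ?thesis
        by (simp add: Cauchy_convergent_iff convergent_def)
    qed
    then obtain l where l: "\<And>c. c \<in> B \<Longrightarrow> (\<lambda>n. u n c) \<longlonglongrightarrow> l c" by metis
    then have "w \<longlonglongrightarrow> (\<Sum>c\<in>B. l c *\<^sub>R c)"
      unfolding w_def by (intro tendsto_sum tendsto_scaleR) auto
    with w have "b = (\<Sum>c\<in>B. l c *\<^sub>R c)"
      by (rule LIMSEQ_unique)
    moreover have "(\<Sum>c\<in>B. l c *\<^sub>R c) \<in> span B"
      by (intro span_sum span_scale span_base)
    ultimately have "b \<in> span B"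
      by (rule ssubst)
    with \<open>b \<notin> span B\<close> show False ..
  qed
  then obtain d where d: "d > 0" "\<And>u. d \<le> norm (b - (\<Sum>c\<in>B. u c *\<^sub>R c))" by blast
  \<comment> \<open>\<open>1 / d\<close> controls the coefficient of \<open>b\<close>. For the
    others, removing \<open>u b *\<^sub>R b\<close> enlarges the norm by at most the factor
    \<open>1 + norm b / d\<close>, and \<open>\<bar>C\<bar>\<close> comes from the induction
    hypothesis.\<close>
  define K where "K = max (1 / d) (\<bar>C\<bar> * (1 + norm b / d))"
  have "\<bar>u c\<bar> \<le> K * norm (\<Sum>c\<in>insert b B. u c *\<^sub>R c)" if "c \<in> insert b B" for u c
  proof -
    define w where "w = (\<Sum>c\<in>B. u c *\<^sub>R c)"
    let ?x = "u b *\<^sub>R b + w"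
    have sum: "(\<Sum>c\<in>insert b B. u c *\<^sub>R c) = ?x"
      using insert.hyps by (simp add: w_def)
    have ub: "\<bar>u b\<bar> \<le> norm ?x / d"
    proof (cases "u b = 0")
      case True
      then show ?thesis using d(1) by simp
    next
      case False
      have "?x = u b *\<^sub>R (b - (\<Sum>c\<in>B. (- u c / u b) *\<^sub>R c))"
        using False by (simp add: w_def scaleR_right_distrib scaleR_sum_right sum_negf)
      then have "norm ?x = \<bar>u b\<bar> * norm (b - (\<Sum>c\<in>B. (- u c / u b) *\<^sub>R c))"
        by simp
      also have "\<dots> \<ge> \<bar>u b\<bar> * d"
        by (intro mult_left_mono d) auto
      finally show ?thesis
        using d(1) by (simp add: field_simps)
    qed
    show ?thesis
    proof (cases "c = b")
      case True
      have "norm ?x / d \<le> K * norm ?x"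
        using mult_right_mono[of "1 / d" K "norm ?x"] by (simp add: K_def)
      with ub True show ?thesis by (simp add: sum)
    next
      case False
      with that have "\<bar>u c\<bar> \<le> C * norm w"
        using C by (simp add: w_def)
      also have "\<dots> \<le> \<bar>C\<bar> * norm w"
        by (intro mult_right_mono) auto
      also have "norm w \<le> norm ?x + \<bar>u b\<bar> * norm b"
        using norm_triangle_ineq4[of ?x "u b *\<^sub>R b"] by simp
      also have "\<bar>u b\<bar> * norm b \<le> norm ?x / d * norm b"
        using ub by (intro mult_right_mono) auto
      also have "\<bar>C\<bar> * (norm ?x + norm ?x / d * norm b) = \<bar>C\<bar> * (1 + norm b / d) * norm ?x"
        by (simp add: algebra_simps)
      also have "\<dots> \<le> K * norm ?x"
        by (intro mult_right_mono) (auto simp: K_def)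
      finally show ?thesis
        by (simp add: sum mult_left_mono)
    qed
  qed
  then show ?case by blast
qed

locale finite_basis =
  fixes B :: "'v::real_normed_vector set"
  assumes finite_B: "finite B" and independent_B: "independent B" and span_B: "span B = UNIV"
begin

definition coord :: "'v \<Rightarrow> 'v \<Rightarrow> real" where
  "coord b v = representation B v b"

lemma sum_coord: "(\<Sum>b\<in>B. coord b v *\<^sub>R b) = v"
  unfolding coord_def
  using real_vector.sum_representation_eq[OF independent_B, of v B] finite_B span_B by auto

lemma coord_add: "coord b (v + w) = coord b v + coord b w"
  unfolding coord_def
  using real_vector.representation_add[OF independent_B, of w v] span_B by simp

lemma coord_scaleR: "coord b (r *\<^sub>R v) = r * coord b v"
  unfolding coord_def
  using real_vector.representation_scale[OF independent_B, of v r] span_B by simp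

lemma coord_0: "coord b 0 = 0"
  using coord_scaleR[of b 0 0] by simp

lemma coord_basis: "b \<in> B \<Longrightarrow> coord c b = (if c = b then 1 else 0)"
  unfolding coord_def
  using real_vector.representation_basis[OF independent_B, of b] by simp

lemma bounded_linear_coord:
  assumes "b \<in> B"
  shows "bounded_linear (coord b)"
proof -
  obtain C where "\<And>u b. b \<in> B \<Longrightarrow> \<bar>u b\<bar> \<le> C * norm (\<Sum>b\<in>B. u b *\<^sub>R b)"
    using coefficients_bounded_by_norm[OF finite_B independent_B] by blast
  from this[OF assms, of "\<lambda>b. coord b _"] show ?thesis
    by (intro bounded_linear_intro[where K = C])
      (auto simp: coord_add coord_scaleR sum_coord mult.commute)
qed

lemma blinfun_eq_coord: "blinfun_apply \<psi> v = (\<Sum>b\<in>B. coord b v *\<^sub>R blinfun_apply \<psi> b)"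
  by (subst sum_coord[of v, symmetric]) (simp only: blinfun.sum_right blinfun.scaleR_right)

lemma blinfun_with_values:
  obtains \<psi> :: "'v \<Rightarrow>\<^sub>L 'w::real_normed_vector" where "\<And>b. b \<in> B \<Longrightarrow> blinfun_apply \<psi> b = z b"
proof
  have "bounded_linear (\<lambda>v. \<Sum>b\<in>B. coord b v *\<^sub>R z b)"
    by (intro bounded_linear_sum bounded_linear_scaleR_left[THEN bounded_linear_compose]
        bounded_linear_coord)
  then have "blinfun_apply (Blinfun (\<lambda>v. \<Sum>b\<in>B. coord b v *\<^sub>R z b)) c = (\<Sum>b\<in>B. coord b c *\<^sub>R z b)" for c
    by (simp add: bounded_linear_Blinfun_apply)
  then show "blinfun_apply (Blinfun (\<lambda>v. \<Sum>b\<in>B. coord b v *\<^sub>R z b)) c = z c" if "c \<in> B" for c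
    using that finite_B by (simp add: coord_basis if_distrib[of "\<lambda>r. r *\<^sub>R _"] cong: if_cong)
qed

end

section \<open>The universal property of the symmetric algebra\<close>

text \<open>The ring may have zero divisors, so the usual bound on the number of roots fails. It is
  rescued for scalar roots, since differences of distinct scalars are units and the synthetic
  division can continue.\<close>

lemma (in complex_subalgebra) poly_eq_0_if_scalar_roots:
  assumes "infinite S" "\<And>c. c \<in> S \<Longrightarrow> poly P (\<kappa> c) = 0"
  shows "P = 0"
  using assms
proof (induction "degree P" arbitrary: P S)
  case 0
  then obtain a where "P = [:a:]"
    by (metis degree_eq_zeroE)
  moreover obtain c where "c \<in> S"
    using 0 by (metis finite.emptyI ex_in_conv)
  ultimately show ?case
    using 0 by auto
next
  case (Suc n)
  then obtain c where c: "c \<in> S"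
    by (metis finite.emptyI ex_in_conv)
  define Q where "Q = synthetic_div P (\<kappa> c)"
  have P: "P = [:- \<kappa> c, 1:] * Q"
    using synthetic_div_correct'[of "\<kappa> c" P] Suc.prems(2)[OF c] by (simp add: Q_def)
  have "Q = 0"
  proof (rule Suc.hyps(1))
    show "n = degree Q"
      unfolding Q_def degree_synthetic_div using Suc.hyps(2) by simp
    show "infinite (S - {c})"
      using Suc.prems(1) by simp
    fix d assume d: "d \<in> S - {c}"
    then have "\<kappa> (d - c) * poly Q (\<kappa> d) = 0"
      using Suc.prems(2)[of d] unfolding P by (simp add: scalar_diff)
    then have "\<kappa> (inverse (d - c)) * (\<kappa> (d - c) * poly Q (\<kappa> d)) = 0" by simp
    then show "poly Q (\<kappa> d) = 0"
      using d by (simp add: scalar_unit flip: mult.assoc)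
  qed
  then show ?case by (simp add: P)
qed

locale symmetric_lift = complex_subalgebra A \<kappa> + finite_basis B
  for A :: "'r::comm_ring_1 set" and \<kappa> and B :: "'v::real_normed_vector set"
begin

text \<open>The real-linear extension of the values of \<open>\<xi>\<close> on
  \<open>B\<close>.\<close>

definition lift_vec :: "('v \<Rightarrow> 'r) \<Rightarrow> 'v \<Rightarrow> 'r" where
  "lift_vec \<xi> v = (\<Sum>b\<in>B. \<kappa> (of_real (coord b v)) * \<xi> b)"

lemma lift_vec_add: "lift_vec \<xi> (v + w) = lift_vec \<xi> v + lift_vec \<xi> w"
  by (simp add: lift_vec_def coord_add scalar_add distrib_right sum.distrib)

lemma lift_vec_0: "lift_vec \<xi> 0 = 0"
  by (simp add: lift_vec_def coord_0 scalar_0)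

text \<open>
  \<open>lifts p E\<close>: some expression of \<open>p\<close> in terms of constants and vectors becomes \<open>E \<xi>\<close> when each
  basis vector \<open>b\<close> is replaced by \<open>\<xi> b\<close>.
\<close>

inductive lifts :: "(('v \<Rightarrow>\<^sub>L complex) \<Rightarrow> complex) \<Rightarrow> (('v \<Rightarrow> 'r) \<Rightarrow> 'r) \<Rightarrow> bool" where
  const: "lifts (sym_const c) (\<lambda>\<xi>. \<kappa> c)"
| vec: "lifts (sym_vec v) (\<lambda>\<xi>. lift_vec \<xi> v)"
| add: "lifts p E \<Longrightarrow> lifts q F \<Longrightarrow> lifts (\<lambda>\<psi>. p \<psi> + q \<psi>) (\<lambda>\<xi>. E \<xi> + F \<xi>)"
| mult: "lifts p E \<Longrightarrow> lifts q F \<Longrightarrow> lifts (\<lambda>\<psi>. p \<psi> * q \<psi>) (\<lambda>\<xi>. E \<xi> * F \<xi>)"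

lemma lifts_exists: "p \<in> sym_carrier \<Longrightarrow> \<exists>E. lifts p E"
  by (induction rule: sym_carrier.induct) (blast intro: lifts.intros)+

lemma lifts_A: "lifts p E \<Longrightarrow> (\<And>b. b \<in> B \<Longrightarrow> \<xi> b \<in> A) \<Longrightarrow> E \<xi> \<in> A"
  by (induction rule: lifts.induct) (auto simp: lift_vec_def intro!: A_intros)

lemma lifts_cong: "lifts p E \<Longrightarrow> (\<And>b. b \<in> B \<Longrightarrow> \<xi> b = \<xi>' b) \<Longrightarrow> E \<xi> = E \<xi>'"
  by (induction rule: lifts.induct) (auto simp: lift_vec_def)

lemma lifts_scalar: "lifts p E \<Longrightarrow> E (\<lambda>b. \<kappa> (blinfun_apply \<psi> b)) = \<kappa> (p \<psi>)"
proof (induction rule: lifts.induct)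
  case (vec v)
  then show ?case
    by (simp add: sym_vec_def lift_vec_def blinfun_eq_coord[of \<psi> v] scalar_sum scalar_mult scaleR_conv_of_real)
qed (simp_all add: sym_const_def scalar_add scalar_mult)

text \<open>Prepares the replacement of a single scalar by a ring element: as a function of one
  \<open>\<xi> b\<close>, an expression is a polynomial and so is determined by its values at
  scalars.\<close>

lemma lifts_poly: "lifts p E \<Longrightarrow> \<exists>P. \<forall>x. poly P x = E (\<xi>(b := x))"
proof (induction rule: lifts.induct)
  case (const c)
  then show ?case by (intro exI[of _ "[:\<kappa> c:]"]) simp
next
  case (vec v)
  have "poly (\<Sum>c\<in>B. [:\<kappa> (of_real (coord c v)):] * (if c = b then [:0, 1:] else [:\<xi> c:])) x =
      lift_vec (\<xi>(b := x)) v" for x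
    unfolding lift_vec_def poly_sum by (intro sum.cong) auto
  then show ?case by blast
next
  case (add p E q F)
  then show ?case by (metis poly_add)
next
  case (mult p E q F)
  then show ?case by (metis poly_mult)
qed

text \<open>
  An expression that vanishes on all of \<open>U\<^sub>C\<close> vanishes formally: substitute the ring elements \<open>\<xi> b\<close>
  for scalars one basis vector at a time.
\<close>

lemma lifts_zero:
  assumes "lifts (\<lambda>_. 0) E"
  shows "E \<xi> = 0"
proof -
  have "\<forall>z. E (\<lambda>b. if b \<in> F then \<xi> b else \<kappa> (z b)) = 0" if "finite F" for F
    using that
  proof (induction F)
    case empty
    show ?case
    proof
      fix z :: "'v \<Rightarrow> complex"
      obtain \<psi> where "\<And>b. b \<in> B \<Longrightarrow> blinfun_apply \<psi> b = z b"
        using blinfun_with_values[of z] by blast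
      then have "E (\<lambda>b. \<kappa> (z b)) = E (\<lambda>b. \<kappa> (blinfun_apply \<psi> b))"
        by (intro lifts_cong[OF assms]) simp
      then show "E (\<lambda>b. if b \<in> {} then \<xi> b else \<kappa> (z b)) = 0"
        using lifts_scalar[OF assms, of \<psi>] by (simp add: scalar_0)
    qed
  next
    case (insert b F)
    show ?case
    proof
      fix z :: "'v \<Rightarrow> complex"
      let ?\<xi> = "\<lambda>b. if b \<in> F then \<xi> b else \<kappa> (z b)"
      obtain P where P: "\<And>x. poly P x = E (?\<xi>(b := x))"
        using lifts_poly[OF assms, of ?\<xi> b] by blast
      have "P = 0"
      proof (rule poly_eq_0_if_scalar_roots[OF infinite_UNIV_char_0])
        fix c
        \<comment> \<open>A scalar at \<open>b\<close> can be absorbed into \<open>z\<close>, so the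
          induction hypothesis for \<open>z(b := c)\<close> makes every scalar a root of
          \<open>P\<close>.\<close>
        have "?\<xi>(b := \<kappa> c) = (\<lambda>b'. if b' \<in> F then \<xi> b' else \<kappa> ((z(b := c)) b'))"
          using insert.hyps by auto
        then show "poly P (\<kappa> c) = 0"
          using insert.IH[rule_format, of "z(b := c)"] by (simp only: P)
      qed
      moreover have "(\<lambda>b'. if b' \<in> insert b F then \<xi> b' else \<kappa> (z b')) = ?\<xi>(b := \<xi> b)"
        by auto
      ultimately show "E (\<lambda>b'. if b' \<in> insert b F then \<xi> b' else \<kappa> (z b')) = 0"
        using P[of "\<xi> b"] by simp
    qed
  qed
  from this[OF finite_B] have "E (\<lambda>b. if b \<in> B then \<xi> b else \<kappa> 0) = 0" by (rule spec)
  moreover have "E (\<lambda>b. if b \<in> B then \<xi> b else \<kappa> 0) = E \<xi>"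
    by (intro lifts_cong[OF assms]) simp
  ultimately show ?thesis by simp
qed

lemma lifts_unique:
  assumes "lifts p E" "lifts p F"
  shows "E \<xi> = F \<xi>"
proof -
  have "lifts (\<lambda>\<psi>. p \<psi> + sym_const (-1) \<psi> * p \<psi>) (\<lambda>\<xi>. E \<xi> + \<kappa> (-1) * F \<xi>)"
    by (intro lifts.intros assms)
  then have "E \<xi> + \<kappa> (-1) * F \<xi> = 0"
    by (intro lifts_zero) (simp add: sym_const_def)
  then show ?thesis
    by (simp add: scalar_minus scalar_1)
qed

text \<open>The chosen expression does not matter, by \<open>lifts_unique\<close>; this is what
  turns substitution into a homomorphism on functions.\<close>

definition lift :: "('v \<Rightarrow> 'r) \<Rightarrow> (('v \<Rightarrow>\<^sub>L complex) \<Rightarrow> complex) \<Rightarrow> 'r" where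
  "lift \<xi> p = (SOME E. lifts p E) \<xi>"

lemma lift_eq: "lifts p E \<Longrightarrow> lift \<xi> p = E \<xi>"
  unfolding lift_def by (rule lifts_unique[OF someI[of "lifts p" E]])

lemma lift_const: "lift \<xi> (sym_const c) = \<kappa> c"
  using lift_eq[OF lifts.const] .

lemma lift_sym_vec: "lift \<xi> (sym_vec v) = lift_vec \<xi> v"
  using lift_eq[OF lifts.vec] .

lemma lift_add:
  assumes "p \<in> sym_carrier" "q \<in> sym_carrier"
  shows "lift \<xi> (\<lambda>\<psi>. p \<psi> + q \<psi>) = lift \<xi> p + lift \<xi> q"
proof -
  obtain E F where "lifts p E" "lifts q F"
    using assms lifts_exists by blast
  with lifts.add[OF this] show ?thesis by (simp add: lift_eq)
qed

lemma lift_mult: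
  assumes "p \<in> sym_carrier" "q \<in> sym_carrier"
  shows "lift \<xi> (\<lambda>\<psi>. p \<psi> * q \<psi>) = lift \<xi> p * lift \<xi> q"
proof -
  obtain E F where "lifts p E" "lifts q F"
    using assms lifts_exists by blast
  with lifts.mult[OF this] show ?thesis by (simp add: lift_eq)
qed

lemma lift_A:
  assumes "p \<in> sym_carrier" "\<And>b. b \<in> B \<Longrightarrow> \<xi> b \<in> A"
  shows "lift \<xi> p \<in> A"
proof -
  obtain E where "lifts p E"
    using assms(1) lifts_exists by blast
  then show ?thesis
    using lifts_A[OF _ assms(2)] by (simp add: lift_eq)
qed

end

section \<open>The group algebra of a lattice\<close>

lemma poly_mapping_expand:
  "p = (\<Sum>a\<in>Poly_Mapping.keys p. Poly_Mapping.single a (Poly_Mapping.lookup p a))"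
proof (rule poly_mapping_eqI)
  fix a
  have "Poly_Mapping.lookup (\<Sum>a\<in>Poly_Mapping.keys p. Poly_Mapping.single a (Poly_Mapping.lookup p a)) a =
      (\<Sum>c\<in>Poly_Mapping.keys p. if c = a then Poly_Mapping.lookup p a else 0)"
    unfolding lookup_sum by (intro sum.cong) (auto simp: lookup_single)
  then show "Poly_Mapping.lookup p a =
      Poly_Mapping.lookup (\<Sum>a\<in>Poly_Mapping.keys p. Poly_Mapping.single a (Poly_Mapping.lookup p a)) a"
    by (simp add: in_keys_iff)
qed

lemma pairing_superset:
  assumes "finite S" "Poly_Mapping.keys p \<subseteq> S"
  shows "pairing f p = (\<Sum>a\<in>S. Poly_Mapping.lookup p a * f a)"
  unfolding pairing_def using assms by (intro sum.mono_neutral_left) (auto simp: in_keys_iff)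

lemma pairing_add: "pairing f (p + q) = pairing f p + pairing f q"
proof -
  let ?S = "Poly_Mapping.keys p \<union> Poly_Mapping.keys q"
  have "pairing f (p + q) = (\<Sum>a\<in>?S. Poly_Mapping.lookup (p + q) a * f a)"
    using Poly_Mapping.keys_add[of p q] by (intro pairing_superset) auto
  also have "\<dots> = pairing f p + pairing f q"
    by (subst (1 2) pairing_superset[of ?S]) (auto simp: lookup_add distrib_right sum.distrib)
  finally show ?thesis .
qed

lemma pairing_0: "pairing f 0 = 0"
  by (simp add: pairing_def)

lemma pairing_single: "pairing f (Poly_Mapping.single a c) = c * f a"
  by (cases "c = 0") (simp_all add: pairing_def)

lemma pairing_sum: "pairing f (sum g S) = (\<Sum>i\<in>S. pairing f (g i))"
  by (induction S rule: infinite_finite_induct) (simp_all add: pairing_0 pairing_add)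

lemma pairing_scale: "pairing f (Poly_Mapping.single 0 c * p) = c * pairing f p"
proof -
  have "Poly_Mapping.single 0 c * p =
      (\<Sum>a\<in>Poly_Mapping.keys p. Poly_Mapping.single a (c * Poly_Mapping.lookup p a))"
    by (subst poly_mapping_expand[of p]) (simp add: sum_distrib_left mult_single)
  then show ?thesis
    by (simp add: pairing_sum pairing_single sum_distrib_left pairing_def[of f p] mult_ac)
qed

lemma pairing_mult:
  assumes "\<And>a b. a \<in> \<Lambda> \<Longrightarrow> b \<in> \<Lambda> \<Longrightarrow> f (a + b) = f a * f b"
    and "Poly_Mapping.keys p \<subseteq> \<Lambda>" "Poly_Mapping.keys q \<subseteq> \<Lambda>"
  shows "pairing f (p * q) = pairing f p * pairing f q"
proof -
  have "p * q = (\<Sum>a\<in>Poly_Mapping.keys p. \<Sum>b\<in>Poly_Mapping.keys q.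
      Poly_Mapping.single (a + b) (Poly_Mapping.lookup p a * Poly_Mapping.lookup q b))"
    by (subst (1) poly_mapping_expand[of p], subst (1) poly_mapping_expand[of q])
      (simp add: sum_product mult_single)
  then have "pairing f (p * q) = (\<Sum>a\<in>Poly_Mapping.keys p. \<Sum>b\<in>Poly_Mapping.keys q.
      Poly_Mapping.lookup p a * Poly_Mapping.lookup q b * f (a + b))"
    by (simp add: pairing_sum pairing_single)
  also have "\<dots> = (\<Sum>a\<in>Poly_Mapping.keys p. \<Sum>b\<in>Poly_Mapping.keys q.
      (Poly_Mapping.lookup p a * f a) * (Poly_Mapping.lookup q b * f b))"
  proof (intro sum.cong refl)
    fix a b assume "a \<in> Poly_Mapping.keys p" "b \<in> Poly_Mapping.keys q"
    then have "f (a + b) = f a * f b" using assms by blast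
    then show "Poly_Mapping.lookup p a * Poly_Mapping.lookup q b * f (a + b) =
        (Poly_Mapping.lookup p a * f a) * (Poly_Mapping.lookup q b * f b)" by simp
  qed
  also have "\<dots> = pairing f p * pairing f q"
    by (simp add: pairing_def sum_product)
  finally show ?thesis .
qed

locale lattice_basis = finite_basis B for B :: "'v::real_normed_vector set" +
  fixes \<Lambda> :: "'v set"
  assumes lattice: "\<Lambda> = range (\<lambda>k :: 'v \<Rightarrow> int. \<Sum>b\<in>B. of_int (k b) *\<^sub>R b)"
begin

lemma lattice_0: "0 \<in> \<Lambda>"
  unfolding lattice by (intro range_eqI[of _ _ "\<lambda>_. 0"]) simp

lemma lattice_add: "a \<in> \<Lambda> \<Longrightarrow> c \<in> \<Lambda> \<Longrightarrow> a + c \<in> \<Lambda>"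
proof -
  assume "a \<in> \<Lambda>" "c \<in> \<Lambda>"
  then obtain k l :: "'v \<Rightarrow> int" where "a = (\<Sum>b\<in>B. of_int (k b) *\<^sub>R b)" "c = (\<Sum>b\<in>B. of_int (l b) *\<^sub>R b)"
    unfolding lattice by blast
  then have "a + c = (\<Sum>b\<in>B. of_int (k b + l b) *\<^sub>R b)"
    by (simp add: scaleR_left_distrib sum.distrib)
  then show ?thesis
    unfolding lattice by (intro range_eqI[of _ _ "\<lambda>b. k b + l b"]) simp
qed

lemma lattice_minus: "a \<in> \<Lambda> \<Longrightarrow> - a \<in> \<Lambda>"
proof -
  assume "a \<in> \<Lambda>"
  then obtain k :: "'v \<Rightarrow> int" where "a = (\<Sum>b\<in>B. of_int (k b) *\<^sub>R b)"
    unfolding lattice by blast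
  then have "- a = (\<Sum>b\<in>B. of_int (- k b) *\<^sub>R b)"
    by (simp add: sum_negf)
  then show ?thesis
    unfolding lattice by (intro range_eqI[of _ _ "\<lambda>b. - k b"]) simp
qed

lemma basis_lattice: "b \<in> B \<Longrightarrow> b \<in> \<Lambda>"
proof -
  assume "b \<in> B"
  have "(\<Sum>c\<in>B. of_int (if c = b then 1 else 0) *\<^sub>R c) = (\<Sum>c\<in>B. if c = b then b else 0)"
    by (intro sum.cong) auto
  then show ?thesis
    unfolding lattice using \<open>b \<in> B\<close> finite_B
    by (intro range_eqI[of _ _ "\<lambda>c. if c = b then 1 else 0"]) simp
qed

text \<open>Integer multiples of single basis vectors are reached first, upwards and downwards from
  0, and then summed over the basis.\<close>

lemma lattice_induct [consumes 1, case_names zero basis add minus]: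
  assumes a: "a \<in> \<Lambda>" and "P 0" and "\<And>b. b \<in> B \<Longrightarrow> P b"
    and add: "\<And>a c. a \<in> \<Lambda> \<Longrightarrow> c \<in> \<Lambda> \<Longrightarrow> P a \<Longrightarrow> P c \<Longrightarrow> P (a + c)"
    and minus: "\<And>a. a \<in> \<Lambda> \<Longrightarrow> P a \<Longrightarrow> P (- a)"
  shows "P a"
proof -
  have mult: "of_int k *\<^sub>R b \<in> \<Lambda> \<and> P (of_int k *\<^sub>R b)" if "b \<in> B" for k :: int and b
  proof (induction k rule: int_induct[where k = 0])
    case base
    then show ?case using assms(2) lattice_0 by simp
  next
    case (step1 i)
    have "of_int (i + 1) *\<^sub>R b = of_int i *\<^sub>R b + b"
      by (simp add: scaleR_left_distrib)
    with step1 add[of "of_int i *\<^sub>R b" b] that assms(3) show ?case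
      by (simp add: lattice_add basis_lattice)
  next
    case (step2 i)
    have "of_int (i - 1) *\<^sub>R b = of_int i *\<^sub>R b + - b"
      by (simp add: scaleR_left_diff_distrib)
    with step2 add[of "of_int i *\<^sub>R b" "- b"] minus[of b] that assms(3) show ?case
      by (simp add: lattice_add lattice_minus basis_lattice del: add_uminus_conv_diff)
  qed
  have "(\<Sum>b\<in>F. of_int (k b) *\<^sub>R b) \<in> \<Lambda> \<and> P (\<Sum>b\<in>F. of_int (k b) *\<^sub>R b)"
    if "F \<subseteq> B" for F and k :: "'v \<Rightarrow> int"
    using finite_subset[OF that finite_B] that
  proof (induction F)
    case empty
    then show ?case using assms(2) lattice_0 by simp
  next
    case (insert b F)
    then show ?case
      using mult[of b "k b"] by (auto intro: lattice_add add)
  qed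
  then show ?thesis
    using a unfolding lattice by blast
qed

lemma countable_lattice: "countable \<Lambda>"
proof -
  have "\<Lambda> \<subseteq> (\<lambda>k. \<Sum>b\<in>B. of_int (k b) *\<^sub>R b) ` (PiE B (\<lambda>_. UNIV :: int set))"
  proof
    fix a assume "a \<in> \<Lambda>"
    then obtain k :: "'v \<Rightarrow> int" where "a = (\<Sum>b\<in>B. of_int (k b) *\<^sub>R b)"
      unfolding lattice by blast
    then show "a \<in> (\<lambda>k. \<Sum>b\<in>B. of_int (k b) *\<^sub>R b) ` (PiE B (\<lambda>_. UNIV :: int set))"
      by (intro image_eqI[of _ _ "restrict k B"]) auto
  qed
  then show ?thesis
    using finite_B by (meson countable_PiE countable_image countable_subset countableI_type)
qed

end

sublocale lattice_basis \<subseteq> symmetric_lift "{p. Poly_Mapping.keys p \<subseteq> \<Lambda>}" "Poly_Mapping.single 0" B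
proof unfold_locales
  fix p q :: "'v \<Rightarrow>\<^sub>0 complex"
  assume "p \<in> {p. Poly_Mapping.keys p \<subseteq> \<Lambda>}" "q \<in> {p. Poly_Mapping.keys p \<subseteq> \<Lambda>}"
  then show "p + q \<in> {p. Poly_Mapping.keys p \<subseteq> \<Lambda>}" "p * q \<in> {p. Poly_Mapping.keys p \<subseteq> \<Lambda>}"
    using Poly_Mapping.keys_add[of p q] keys_mult[of p q] lattice_add by blast+
qed (use lattice_0 in \<open>auto simp: single_add mult_single single_one\<close>)

text \<open>Together with \<open>countable_lattice\<close> this is the countable-dimension
  hypothesis of the Nullstellensatz.\<close>

lemma (in lattice_basis) group_algebra_span:
  assumes "Poly_Mapping.keys p \<subseteq> \<Lambda>"
  shows "\<exists>F. finite F \<and> F \<subseteq> (\<lambda>a. Poly_Mapping.single a (1::complex)) ` \<Lambda> \<and> p \<in> scal.span F"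
proof (intro exI conjI)
  let ?F = "(\<lambda>a. Poly_Mapping.single a (1::complex)) ` Poly_Mapping.keys p"
  show "finite ?F" by simp
  show "?F \<subseteq> (\<lambda>a. Poly_Mapping.single a 1) ` \<Lambda>"
    using assms by blast
  have "p = (\<Sum>a\<in>Poly_Mapping.keys p. Poly_Mapping.single 0 (Poly_Mapping.lookup p a) * Poly_Mapping.single a 1)"
    by (subst poly_mapping_expand[of p]) (simp add: mult_single)
  also have "\<dots> \<in> scal.span ?F"
    by (intro scal.span_sum scal.span_scale scal.span_base) auto
  finally show "p \<in> scal.span ?F" .
qed

lemma group_algebra_simps [simp]:
  "carrier (group_algebra \<Lambda>) = {p. Poly_Mapping.keys p \<subseteq> \<Lambda>}"
  "mult (group_algebra \<Lambda>) = (*)" "one (group_algebra \<Lambda>) = 1"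
  "zero (group_algebra \<Lambda>) = 0" "add (group_algebra \<Lambda>) = (+)"
  by (simp_all add: group_algebra_def)

locale lattice_ideal = lattice_basis B \<Lambda> for B :: "'v::real_normed_vector set" and \<Lambda> +
  fixes J :: "('v \<Rightarrow>\<^sub>0 complex) set" and \<phi> :: "'v \<Rightarrow>\<^sub>L complex"
  assumes ideal_J: "ideal J (group_algebra \<Lambda>)"
    and zeros_J: "torus_zeros \<Lambda> J = {exp_point \<Lambda> \<phi>}"

sublocale lattice_ideal \<subseteq> subalgebra_ideal "{p. Poly_Mapping.keys p \<subseteq> \<Lambda>}" "Poly_Mapping.single 0" J
proof
  interpret ideal J "group_algebra \<Lambda>" by (rule ideal_J)
  show "is_idl J"
    unfolding is_idl_def
    using Icarr I_l_closed a_closed[of _ _] additive_subgroup.zero_closed[OF is_additive_subgroup]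
      additive_subgroup.a_closed[OF is_additive_subgroup] by auto
qed

context lattice_ideal
begin

abbreviation A :: "('v \<Rightarrow>\<^sub>0 complex) set" where
  "A \<equiv> {p. Poly_Mapping.keys p \<subseteq> \<Lambda>}"

abbreviation \<kappa> :: "complex \<Rightarrow> 'v \<Rightarrow>\<^sub>0 complex" where
  "\<kappa> \<equiv> Poly_Mapping.single 0"

abbreviation e :: "'v \<Rightarrow> 'v \<Rightarrow>\<^sub>0 complex" where
  "e a \<equiv> Poly_Mapping.single a 1"

definition unip :: "'v \<Rightarrow> 'v \<Rightarrow>\<^sub>0 complex" where
  "unip a = Poly_Mapping.single a (exp (- blinfun_apply \<phi> a)) - 1"

lemma e_A: "a \<in> \<Lambda> \<Longrightarrow> e a \<in> A"
  by simp

lemma unip_A: "a \<in> \<Lambda> \<Longrightarrow> unip a \<in> A"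
  unfolding unip_def by (intro A_diff A_1) simp

text \<open>\<open>1 + unip a\<close> is multiplicative in \<open>a\<close>; the expanded form is
  the one that \<open>ln_at_add\<close> expects.\<close>

lemma unip_add: "unip (a + c) = unip a + unip c + unip a * unip c"
proof -
  have "exp (- blinfun_apply \<phi> (a + c)) = exp (- blinfun_apply \<phi> a) * exp (- blinfun_apply \<phi> c)"
    by (simp add: blinfun.add_right flip: exp_add)
  then show ?thesis
    unfolding unip_def by (simp add: algebra_simps mult_single)
qed

lemma exp_unip: "e a = \<kappa> (exp (blinfun_apply \<phi> a)) * (1 + unip a)"
  by (simp add: unip_def mult_single exp_minus_inverse)

section \<open>Evaluation at the given torus point, and nilpotency\<close>

definition point :: "('v \<Rightarrow>\<^sub>0 complex) \<Rightarrow> complex" where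
  "point p = pairing (exp_point \<Lambda> \<phi>) p"

lemma point_add: "point (p + q) = point p + point q"
  by (simp add: point_def pairing_add)

lemma point_mult: "p \<in> A \<Longrightarrow> q \<in> A \<Longrightarrow> point (p * q) = point p * point q"
  unfolding point_def
  by (intro pairing_mult[of \<Lambda>]) (auto simp: exp_point_def lattice_add blinfun.add_right exp_add)

lemma point_scalar: "point (\<kappa> c) = c"
  by (simp add: point_def pairing_single exp_point_def lattice_0)

lemma point_1: "point 1 = 1"
  using point_scalar[of 1] by (simp add: single_one)

lemma point_power: "p \<in> A \<Longrightarrow> point (p ^ n) = point p ^ n"
  using A_power by (induction n) (simp_all add: point_1 point_mult del: mem_Collect_eq)

lemma point_sum: "point (sum f S) = (\<Sum>i\<in>S. point (f i))"
  by (simp add: point_def pairing_sum)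

lemma point_J: "p \<in> J \<Longrightarrow> point p = 0"
  using zeros_J unfolding point_def torus_zeros_def by blast

text \<open>
  If no power of \<open>unip a\<close> were in \<open>J\<close>, then \<open>J\<close> would have a zero on the torus at which \<open>unip a\<close> does
  not vanish.
\<close>

lemma unip_nilpotent:
  assumes a: "a \<in> \<Lambda>"
  shows "\<exists>n. unip a ^ n \<in> J"
proof (rule ccontr)
  assume "\<not> ?thesis"
  then have nonnil: "\<And>n. unip a ^ n \<notin> J" by blast
  have E: "countable (e ` \<Lambda>)"
    using countable_lattice by simp
  obtain J' c where J': "is_idl J'" "J \<subseteq> J'" "\<And>n. unip a ^ n \<notin> J'"
    and c: "\<And>b. b \<in> B \<Longrightarrow> e b - \<kappa> (c b) \<in> J'"
    using scalar_values_avoiding_powers[OF finite_B idl unip_A[OF a] nonnil, of e, OF e_A[OF basis_lattice] E]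
      group_algebra_span by blast
  interpret J': subalgebra_ideal A \<kappa> J'
    by unfold_locales (rule J'(1))
  have one: "1 \<notin> J'"
    using J'(3)[of 0] by simp
  have scalar_J': "d = 0" if "\<kappa> d \<in> J'" for d
  proof (rule ccontr)
    assume "d \<noteq> 0"
    with J'.J_mult[OF scalar_A[of "inverse d"] that] one show False
      by (simp add: scalar_unit)
  qed
  \<comment> \<open>So far only basis vectors have scalar values. A value 0 at \<open>b\<close>
    would put \<open>e (- b) * e b = 1\<close> into the proper ideal \<open>J'\<close>; sums and
    negatives then follow from multiplicativity of \<open>e\<close>.\<close>
  have "\<exists>d. d \<noteq> 0 \<and> e u - \<kappa> d \<in> J'" if "u \<in> \<Lambda>" for u
    using that
  proof (induction rule: lattice_induct)
    case zero
    then show ?case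
      by (intro exI[of _ 1]) (simp add: J'.J_0)
  next
    case (basis b)
    have "c b \<noteq> 0"
    proof
      assume "c b = 0"
      with c[OF basis] have "e (- b) * e b \<in> J'"
        using basis by (intro J'.J_mult e_A lattice_minus basis_lattice) auto
      with one show False by (simp add: mult_single)
    qed
    with c[OF basis] show ?case by blast
  next
    case (add u v)
    then obtain d d' where d: "d \<noteq> 0" "d' \<noteq> 0" "J'.cong (e u) (\<kappa> d)" "J'.cong (e v) (\<kappa> d')"
      unfolding J'.cong_def by blast
    have "J'.cong (e u * e v) (\<kappa> d * \<kappa> d')"
      using d add.hyps by (intro J'.cong_mult scalar_A e_A)
    then have "J'.cong (e (u + v)) (\<kappa> (d * d'))"
      by (simp add: mult_single)
    then show ?case
      using d(1,2) unfolding J'.cong_def by (intro exI[of _ "d * d'"]) auto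
  next
    case (minus u)
    then obtain d where d: "d \<noteq> 0" "e u - \<kappa> d \<in> J'" by blast
    have "(- \<kappa> (inverse d) * e (- u)) * (e u - \<kappa> d) \<in> J'"
      using d(2) minus.hyps by (intro J'.J_mult A_mult A_minus scalar_A e_A lattice_minus)
    also have "(- \<kappa> (inverse d) * e (- u)) * (e u - \<kappa> d) = e (- u) - \<kappa> (inverse d)"
      using d(1) by (simp add: right_diff_distrib mult_single)
    finally show ?case
      using d(1) by (intro exI[of _ "inverse d"]) auto
  qed
  then obtain t0 where t0: "\<And>u. u \<in> \<Lambda> \<Longrightarrow> t0 u \<noteq> 0" "\<And>u. u \<in> \<Lambda> \<Longrightarrow> J'.cong (e u) (\<kappa> (t0 u))"
    unfolding J'.cong_def by metis
  define t where "t u = (if u \<in> \<Lambda> then t0 u else 0)" for u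
  have t: "J'.cong (e u) (\<kappa> (t u))" if "u \<in> \<Lambda>" for u
    using t0 that by (simp add: t_def)
  have at_t: "J'.cong p (\<kappa> (pairing t p))" if "p \<in> A" for p
  proof -
    have "p = (\<Sum>u\<in>Poly_Mapping.keys p. \<kappa> (Poly_Mapping.lookup p u) * e u)"
      by (subst poly_mapping_expand[of p]) (simp add: mult_single)
    also have "J'.cong \<dots> (\<Sum>u\<in>Poly_Mapping.keys p. \<kappa> (Poly_Mapping.lookup p u) * \<kappa> (t u))"
      using that by (intro J'.cong_sum J'.cong_scalar t) auto
    also have "\<dots> = \<kappa> (pairing t p)"
      by (simp add: pairing_def scalar_sum mult_single)
    finally show ?thesis .
  qed
  have "t (u + v) = t u * t v" if "u \<in> \<Lambda>" "v \<in> \<Lambda>" for u v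
  proof -
    have "J'.cong (e u * e v) (\<kappa> (t u) * \<kappa> (t v))"
      using that by (intro J'.cong_mult t scalar_A e_A)
    moreover have "J'.cong (e u * e v) (\<kappa> (t (u + v)))"
      using t[OF lattice_add[OF that]] by (simp add: mult_single)
    ultimately have "J'.cong (\<kappa> (t (u + v))) (\<kappa> (t u) * \<kappa> (t v))"
      by (blast intro: J'.cong_trans J'.cong_sym)
    then have "\<kappa> (t (u + v) - t u * t v) \<in> J'"
      by (simp add: J'.cong_def scalar_diff scalar_mult)
    then show ?thesis
      using scalar_J' by fastforce
  qed
  moreover have "pairing t p = 0" if "p \<in> J" for p
    using that J'(2) J_A at_t[of p] J'.cong_J scalar_J' by blast
  ultimately have "t \<in> torus_zeros \<Lambda> J"
    using t0 unfolding torus_zeros_def torus_def by (auto simp: t_def)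
  \<comment> \<open>\<open>t\<close> is a torus zero of \<open>J\<close>, hence the given one. Since
    each element of \<open>A\<close> is congruent modulo \<open>J'\<close> to its value at
    \<open>t\<close>, and \<open>unip a\<close> has value 0 there, \<open>unip a\<close> falls into
    \<open>J'\<close>.\<close>
  then have "pairing t = point"
    using zeros_J by (auto simp: point_def)
  moreover have "point (unip a) = 0"
    using a point_add[of "unip a" 1]
    by (simp add: unip_def point_1 point_def[of "Poly_Mapping.single _ _"] pairing_single exp_point_def exp_minus)
  ultimately have "unip a \<in> J'"
    using at_t[OF unip_A[OF a]] by (simp add: J'.J_cong_0 scalar_0)
  with J'(3)[of 1] show False by simp
qed

section \<open>The logarithm\<close>

lemma fps_at_unique:
  assumes "x ^ M \<in> J" "x ^ N \<in> J" "x \<in> A"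
  shows "fps_at M F x \<asymp> fps_at N F x"
  using assms fps_at_mono[of x "min M N" M N F] by (cases "M \<le> N") (auto simp: min_def)

text \<open>The condition \<open>1 < n\<close> guarantees that a series truncated at this order
  still contains its linear term, as the inversion of exp and log requires.\<close>

definition nil_index :: "'v \<Rightarrow> nat" where
  "nil_index a = (SOME n. 1 < n \<and> unip a ^ n \<in> J)"

lemma nil_index:
  assumes "a \<in> \<Lambda>"
  shows "1 < nil_index a" "unip a ^ nil_index a \<in> J"
proof -
  obtain n where "unip a ^ n \<in> J"
    using unip_nilpotent[OF assms] by blast
  then have "unip a ^ (n + 2) \<in> J"
    by (rule J_power_le) (use unip_A[OF assms] in auto)
  then have "\<exists>n. 1 < n \<and> unip a ^ n \<in> J"
    by (intro exI[of _ "n + 2"]) auto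
  from someI_ex[OF this] show "1 < nil_index a" "unip a ^ nil_index a \<in> J"
    unfolding nil_index_def by auto
qed

text \<open>A representative in the group algebra of the class written a-tilde;
  \<open>log_e_cong\<close> frees it from the chosen truncation order.\<close>

definition log_e :: "'v \<Rightarrow> 'v \<Rightarrow>\<^sub>0 complex" where
  "log_e a = ln_at (nil_index a) (unip a)"

lemma log_e_cong:
  assumes "a \<in> \<Lambda>" "unip a ^ n \<in> J"
  shows "log_e a \<asymp> ln_at n (unip a)"
  unfolding log_e_def using assms nil_index unip_A by (intro fps_at_unique) auto

lemma log_e_A: "a \<in> \<Lambda> \<Longrightarrow> log_e a \<in> A"
  unfolding log_e_def by (intro fps_at_A unip_A)

lemma log_e_nilpotent: "a \<in> \<Lambda> \<Longrightarrow> log_e a ^ nil_index a \<in> J"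
  unfolding log_e_def by (intro fps_at_nilpotent nil_index unip_A) simp_all

lemma log_e_add:
  assumes "a \<in> \<Lambda>" "c \<in> \<Lambda>"
  shows "log_e (a + c) \<asymp> log_e a + log_e c"
proof -
  define N where "N = max (nil_index a) (nil_index c)"
  have N: "1 < N" "unip a ^ N \<in> J" "unip c ^ N \<in> J"
    using nil_index(1)[OF assms(1)] J_power_le[OF nil_index(2)[OF assms(1)] unip_A[OF assms(1)], of N]
      J_power_le[OF nil_index(2)[OF assms(2)] unip_A[OF assms(2)], of N]
    by (simp_all add: N_def)
  have 2: "unip a ^ (2 * N) \<in> J" "unip c ^ (2 * N) \<in> J"
    using J_power_le[OF N(2) unip_A[OF assms(1)], of "2 * N"]
      J_power_le[OF N(3) unip_A[OF assms(2)], of "2 * N"] by simp_all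
  \<comment> \<open>\<open>unip (a + c)\<close> is regrouped as \<open>unip a\<close> plus this
    product, a sum of two elements killed by the exponent \<open>N\<close>; that gives the exponent
    \<open>2 * N\<close> used for all three logarithms.\<close>
  have "(unip c * (1 + unip a)) ^ N \<in> J"
    unfolding power_mult_distrib by (intro J_mult'[OF N(3)] A_power A_add A_1 unip_A assms)
  then have "(unip a + unip c * (1 + unip a)) ^ (N + N) \<in> J"
    using N(2) by (intro nilpotent_add A_add A_mult A_1 unip_A assms)
  then have "unip (a + c) ^ (2 * N) \<in> J"
    unfolding unip_add mult_2 by (simp add: algebra_simps)
  with assms have "log_e (a + c) \<asymp> ln_at (2 * N) (unip a + unip c + unip a * unip c)"
    using log_e_cong[of "a + c" "2 * N"] by (simp add: unip_add lattice_add)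
  also have "\<dots> \<asymp> ln_at (2 * N) (unip a) + ln_at (2 * N) (unip c)"
    using N assms by (intro ln_at_add unip_A)
  also have "\<dots> \<asymp> log_e a + log_e c"
    by (intro cong_add cong_sym[OF log_e_cong] assms 2)
  finally show ?thesis .
qed

lemma exp_log_e:
  assumes "a \<in> \<Lambda>" "1 < M" "unip a ^ M \<in> J"
  shows "e a \<asymp> \<kappa> (exp (blinfun_apply \<phi> a)) * exp_at M (log_e a)"
proof -
  have "exp_at M (log_e a) \<asymp> exp_at M (ln_at M (unip a))"
    using assms by (intro fps_at_cong fps_at_A log_e_cong log_e_A unip_A)
  also have "\<dots> \<asymp> 1 + unip a"
    using assms by (intro exp_ln_at unip_A)
  finally show ?thesis
    unfolding exp_unip[of a] by (rule cong_scalar[OF cong_sym])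
qed

text \<open>An additive map on the lattice is determined by its values on the basis. The real-linear
  extension on the right-hand side makes sense for every vector, which opens the way from functions
  on the lattice to functions on the whole space.\<close>

lemma log_e_linear: "a \<in> \<Lambda> \<Longrightarrow> log_e a \<asymp> lift_vec log_e a"
proof (induction rule: lattice_induct)
  case zero
  have "log_e 0 + log_e 0 - log_e 0 \<asymp> log_e 0 - log_e 0"
    using log_e_add[OF lattice_0 lattice_0] by (intro cong_diff cong_refl) (simp add: cong_sym)
  then show ?case
    by (simp add: lift_vec_def coord_0 scalar_0)
next
  case (basis b)
  have "lift_vec log_e b = (\<Sum>c\<in>B. if c = b then log_e b else 0)"
    unfolding lift_vec_def by (intro sum.cong) (auto simp: coord_basis[OF basis] scalar_0 scalar_1)
  then show ?case
    using basis finite_B by simp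
next
  case (add a c)
  have "log_e (a + c) \<asymp> log_e a + log_e c"
    using add by (intro log_e_add)
  also have "\<dots> \<asymp> lift_vec log_e a + lift_vec log_e c"
    using add by (intro cong_add)
  also have "\<dots> = lift_vec log_e (a + c)"
    by (simp add: lift_vec_add)
  finally show ?case .
next
  case (minus a)
  have "log_e 0 + log_e 0 - log_e 0 \<asymp> log_e 0 - log_e 0"
    using log_e_add[OF lattice_0 lattice_0] by (intro cong_diff cong_refl) (simp add: cong_sym)
  then have "log_e (a + - a) - log_e a \<asymp> 0 - lift_vec log_e a"
    using minus by (intro cong_diff) auto
  moreover have "log_e (a + - a) - log_e a \<asymp> log_e a + log_e (- a) - log_e a"
    using minus.hyps by (intro cong_diff log_e_add lattice_minus cong_refl)
  ultimately have "log_e (- a) \<asymp> - lift_vec log_e a"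
    by (auto intro: cong_trans cong_sym)
  also have "- lift_vec log_e a = lift_vec log_e (- a)"
    using lift_vec_add[of log_e a "- a"] by (simp add: lift_vec_0 add_eq_0_iff)
  finally show ?case .
qed

text \<open>The exponent comes from adding up the nilpotency exponents of the basis logarithms; real
  coefficients do not affect these, so it is uniform in \<open>v\<close>.\<close>

lemma lift_vec_log_e_nilpotent: "\<exists>n. \<forall>v. lift_vec log_e v ^ n \<in> J"
proof -
  have "\<exists>n. \<forall>v. (\<Sum>b\<in>F. \<kappa> (of_real (coord b v)) * log_e b) ^ n \<in> J" if "F \<subseteq> B" for F
    using finite_subset[OF that finite_B] that
  proof (induction F)
    case empty
    then show ?case
      by (intro exI[of _ 1]) (simp add: J_0)
  next
    case (insert b F)
    then obtain n where n: "\<And>v. (\<Sum>b\<in>F. \<kappa> (of_real (coord b v)) * log_e b) ^ n \<in> J" by blast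
    have b: "b \<in> \<Lambda>" and F: "\<And>c. c \<in> F \<Longrightarrow> c \<in> \<Lambda>"
      using insert.prems basis_lattice by auto
    have "(\<kappa> (of_real (coord b v)) * log_e b) ^ nil_index b \<in> J" for v
      unfolding power_mult_distrib by (intro J_mult A_power scalar_A log_e_nilpotent b)
    then have "(\<kappa> (of_real (coord b v)) * log_e b + (\<Sum>b\<in>F. \<kappa> (of_real (coord b v)) * log_e b))
        ^ (nil_index b + n) \<in> J" for v
      using n by (intro nilpotent_add A_sum A_mult scalar_A log_e_A b F)
    then show ?case
      using insert.hyps by auto
  qed
  from this[of B] show ?thesis
    by (simp add: lift_vec_def)
qed

definition nil_bound :: nat where
  "nil_bound = (SOME n. \<forall>v. lift_vec log_e v ^ n \<in> J)"

lemma nil_bound: "lift_vec log_e v ^ nil_bound \<in> J"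
  unfolding nil_bound_def using someI_ex[OF lift_vec_log_e_nilpotent] by blast

lemma lift_vec_log_e_A: "lift_vec log_e v \<in> A"
  unfolding lift_vec_def by (intro A_sum A_mult scalar_A log_e_A basis_lattice)

section \<open>The logarithm homomorphism\<close>

text \<open>Prescribing values only on the basis gives an exact homomorphism into the group algebra
  itself; the prescribed value at a general lattice vector is attained modulo \<open>J\<close>
  (\<open>log_hom_lattice\<close>).\<close>

definition log_hom :: "(('v \<Rightarrow>\<^sub>L complex) \<Rightarrow> complex) \<Rightarrow> 'v \<Rightarrow>\<^sub>0 complex" where
  "log_hom = lift (\<lambda>b. log_e b + \<kappa> (blinfun_apply \<phi> b))"

lemma log_hom_A: "p \<in> sym_carrier \<Longrightarrow> log_hom p \<in> A"
  unfolding log_hom_def by (intro lift_A A_add scalar_A log_e_A basis_lattice)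

lemma log_hom_const: "log_hom (sym_const c) = \<kappa> c"
  unfolding log_hom_def by (rule lift_const)

lemma log_hom_sym_vec: "log_hom (sym_vec v) = lift_vec log_e v + \<kappa> (blinfun_apply \<phi> v)"
  unfolding log_hom_def lift_sym_vec lift_vec_def
  by (simp add: distrib_left sum.distrib blinfun_eq_coord[of \<phi> v] scalar_sum scalar_mult scaleR_conv_of_real)

lemma log_hom_add:
  "p \<in> sym_carrier \<Longrightarrow> q \<in> sym_carrier \<Longrightarrow> log_hom (\<lambda>\<psi>. p \<psi> + q \<psi>) = log_hom p + log_hom q"
  unfolding log_hom_def by (rule lift_add)

lemma log_hom_mult:
  "p \<in> sym_carrier \<Longrightarrow> q \<in> sym_carrier \<Longrightarrow> log_hom (\<lambda>\<psi>. p \<psi> * q \<psi>) = log_hom p * log_hom q"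
  unfolding log_hom_def by (rule lift_mult)

lemma sym_carrier_power: "p \<in> sym_carrier \<Longrightarrow> (\<lambda>\<psi>. p \<psi> ^ n) \<in> sym_carrier"
proof (induction n)
  case 0
  then show ?case using sym_carrier.const[of 1] by (simp add: sym_const_def)
qed (simp add: sym_carrier.mult)

lemma log_hom_power: "p \<in> sym_carrier \<Longrightarrow> log_hom (\<lambda>\<psi>. p \<psi> ^ n) = log_hom p ^ n"
proof (induction n)
  case 0
  then show ?case using log_hom_const[of 1] by (simp add: sym_const_def scalar_1)
qed (simp add: log_hom_mult sym_carrier_power)

lemma log_hom_lattice:
  "a \<in> \<Lambda> \<Longrightarrow> log_hom (sym_vec a) \<asymp> log_e a + \<kappa> (blinfun_apply \<phi> a)"
  unfolding log_hom_sym_vec by (intro cong_add cong_sym[OF log_e_linear] cong_refl)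

text \<open>\<open>point\<close> is multiplicative and kills \<open>J\<close>, so it sends an
  element with a power in \<open>J\<close> to a nilpotent complex number.\<close>

lemma point_log_e: "a \<in> \<Lambda> \<Longrightarrow> point (log_e a) = 0"
  using point_power[OF log_e_A, of a "nil_index a"] point_J[OF log_e_nilpotent, of a] by simp

lemma point_log_hom: "p \<in> sym_carrier \<Longrightarrow> point (log_hom p) = p \<phi>"
proof (induction rule: sym_carrier.induct)
  case (const c)
  then show ?case unfolding log_hom_const point_scalar by (simp add: sym_const_def)
next
  case (vec v)
  have "point (lift_vec log_e v) = 0"
    unfolding lift_vec_def point_sum
    by (intro sum.neutral) (simp add: point_mult scalar_A log_e_A basis_lattice point_log_e del: mem_Collect_eq)
  then show ?case unfolding log_hom_sym_vec point_add point_scalar by (simp add: sym_vec_def)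
next
  case (add p q)
  then show ?case by (simp add: log_hom_add point_add)
next
  case (mult p q)
  then show ?case by (simp add: log_hom_mult point_mult log_hom_A del: mem_Collect_eq)
qed

text \<open>The ideal contains a power of \<open>v - \<langle>v|\<phi>\<rangle>\<close> for every
  vector \<open>v\<close>, which forces any zero to agree with \<open>\<phi>\<close>. Conversely
  \<open>point\<close> after \<open>log_hom\<close> is evaluation at \<open>\<phi>\<close>, and
  \<open>point\<close> vanishes on \<open>J\<close>.\<close>

lemma sym_zeros_log_hom: "sym_zeros {p \<in> sym_carrier. log_hom p \<in> J} = {\<phi>}"
proof (intro equalityI subsetI)
  fix \<psi> assume \<psi>: "\<psi> \<in> sym_zeros {p \<in> sym_carrier. log_hom p \<in> J}"
  have "blinfun_apply \<psi> v = blinfun_apply \<phi> v" for v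
  proof -
    let ?l = "\<lambda>\<psi>. sym_vec v \<psi> + sym_const (- blinfun_apply \<phi> v) \<psi>"
    have l: "?l \<in> sym_carrier"
      by (intro sym_carrier.intros)
    have "log_hom ?l = lift_vec log_e v"
      by (simp add: log_hom_add sym_carrier.intros log_hom_sym_vec log_hom_const scalar_minus)
    then have "log_hom (\<lambda>\<psi>. ?l \<psi> ^ nil_bound) \<in> J"
      using nil_bound log_hom_power[OF l] by simp
    with sym_carrier_power[OF l]
    have mem: "(\<lambda>\<psi>. ?l \<psi> ^ nil_bound) \<in> {p \<in> sym_carrier. log_hom p \<in> J}" by simp
    have "\<forall>p\<in>{p \<in> sym_carrier. log_hom p \<in> J}. p \<psi> = 0"
      using \<psi> by (simp add: sym_zeros_def)
    from bspec[OF this mem] have "?l \<psi> ^ nil_bound = 0" .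
    then show ?thesis
      by (simp add: sym_vec_def sym_const_def)
  qed
  then show "\<psi> \<in> {\<phi>}"
    by (simp add: blinfun_eqI)
next
  fix \<psi> assume "\<psi> \<in> {\<phi>}"
  then show "\<psi> \<in> sym_zeros {p \<in> sym_carrier. log_hom p \<in> J}"
    by (auto simp: sym_zeros_def simp flip: point_log_hom intro: point_J)
qed

text \<open>Each \<open>e a\<close> is a scalar multiple of a truncated exponential of
  \<open>log_e a\<close>, hence a polynomial in the image of
  \<open>a - \<langle>a|\<phi>\<rangle>\<close>; these elements span the group algebra.\<close>

lemma log_hom_surj:
  assumes "p \<in> A"
  shows "\<exists>q\<in>sym_carrier. log_hom q \<asymp> p"
proof -
  have e: "\<exists>q\<in>sym_carrier. log_hom q \<asymp> e a" if a: "a \<in> \<Lambda>" for a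
  proof -
    let ?l = "\<lambda>\<psi>. sym_vec a \<psi> + sym_const (- blinfun_apply \<phi> a) \<psi>"
    have l: "?l \<in> sym_carrier"
      by (intro sym_carrier.intros)
    have "log_hom ?l = lift_vec log_e a"
      by (simp add: log_hom_add sym_carrier.intros log_hom_sym_vec log_hom_const scalar_minus)
    then have hl: "log_hom ?l \<asymp> log_e a"
      using cong_sym[OF log_e_linear[OF a]] by simp
    have sums: "\<exists>q\<in>sym_carrier. log_hom q = fps_at M F (log_hom ?l)" for M F
    proof (induction M)
      case 0
      then show ?case
        using log_hom_const[of 0] sym_carrier.const[of 0] by (force simp: fps_at_def scalar_0)
    next
      case (Suc M)
      then obtain q where q: "q \<in> sym_carrier" "log_hom q = fps_at M F (log_hom ?l)" by blast
      let ?t = "\<lambda>\<psi>. sym_const (fps_nth F M) \<psi> * ?l \<psi> ^ M"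
      have t: "?t \<in> sym_carrier"
        by (intro sym_carrier.mult sym_carrier.const sym_carrier_power l)
      have "log_hom ?t = \<kappa> (fps_nth F M) * log_hom ?l ^ M"
        by (subst log_hom_mult) (simp_all only: sym_carrier.const sym_carrier_power[OF l] log_hom_const log_hom_power[OF l])
      then have "log_hom (\<lambda>\<psi>. q \<psi> + ?t \<psi>) = fps_at (Suc M) F (log_hom ?l)"
        using log_hom_add[OF q(1) t] q(2) by (simp add: fps_at_def)
      with sym_carrier.add[OF q(1) t] show ?case by blast
    qed
    let ?M = "nil_index a"
    obtain q where q: "q \<in> sym_carrier" "log_hom q = exp_at ?M (log_hom ?l)"
      using sums by blast
    let ?q = "\<lambda>\<psi>. sym_const (exp (blinfun_apply \<phi> a)) \<psi> * q \<psi>"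
    have "log_hom ?q = \<kappa> (exp (blinfun_apply \<phi> a)) * exp_at ?M (log_hom ?l)"
      using q by (simp add: log_hom_mult sym_carrier.const log_hom_const)
    also have "\<dots> \<asymp> \<kappa> (exp (blinfun_apply \<phi> a)) * exp_at ?M (log_e a)"
      using a by (intro cong_scalar fps_at_cong hl log_hom_A l log_e_A)
    also have "\<dots> \<asymp> e a"
      using a nil_index by (intro cong_sym[OF exp_log_e])
    finally show ?thesis
      using sym_carrier.mult[OF sym_carrier.const q(1)] by blast
  qed
  have "\<exists>q\<in>sym_carrier. log_hom q \<asymp> (\<Sum>a\<in>F. \<kappa> (Poly_Mapping.lookup p a) * e a)" if "finite F" "F \<subseteq> \<Lambda>" for F
    using that
  proof (induction F)
    case empty
    then show ?case
      using log_hom_const[of 0] sym_carrier.const[of 0] by (force simp: scalar_0)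
  next
    case (insert a F)
    then obtain q r where q: "q \<in> sym_carrier" "log_hom q \<asymp> (\<Sum>a\<in>F. \<kappa> (Poly_Mapping.lookup p a) * e a)"
      and r: "r \<in> sym_carrier" "log_hom r \<asymp> e a"
      using e by blast
    let ?r = "\<lambda>\<psi>. sym_const (Poly_Mapping.lookup p a) \<psi> * r \<psi>"
    have r': "?r \<in> sym_carrier"
      by (intro sym_carrier.intros r)
    have "log_hom (\<lambda>\<psi>. ?r \<psi> + q \<psi>) = \<kappa> (Poly_Mapping.lookup p a) * log_hom r + log_hom q"
      using r r' q by (simp add: log_hom_add log_hom_mult sym_carrier.const log_hom_const)
    also have "\<dots> \<asymp> \<kappa> (Poly_Mapping.lookup p a) * e a + (\<Sum>a\<in>F. \<kappa> (Poly_Mapping.lookup p a) * e a)"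
      using q r by (intro cong_add cong_scalar)
    also have "\<dots> = (\<Sum>a\<in>insert a F. \<kappa> (Poly_Mapping.lookup p a) * e a)"
      using insert.hyps by simp
    finally show ?case
      using sym_carrier.add[OF r' q(1)] by blast
  qed
  from this[of "Poly_Mapping.keys p"] assms
  have "\<exists>q\<in>sym_carrier. log_hom q \<asymp> (\<Sum>a\<in>Poly_Mapping.keys p. \<kappa> (Poly_Mapping.lookup p a) * e a)"
    by simp
  moreover have "(\<Sum>a\<in>Poly_Mapping.keys p. \<kappa> (Poly_Mapping.lookup p a) * e a) = p"
    by (subst (3) poly_mapping_expand[of p]) (simp add: mult_single)
  ultimately show ?thesis by simp
qed

end

section \<open>Smooth functions and differential operators\<close>

lemma dir_deriv_eq: "(f has_derivative f') (at x) \<Longrightarrow> dir_deriv v f x = f' v"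
  unfolding dir_deriv_def using frechet_derivative_at by metis

lemma times_cont_diff_linear:
  "times_cont_diff k f \<Longrightarrow> times_cont_diff k g \<Longrightarrow> times_cont_diff k (\<lambda>x. a * f x + b * g x)"
proof (induction k arbitrary: f g)
  case 0
  then show ?case by (auto intro!: continuous_intros)
next
  case (Suc k)
  have der: "((\<lambda>x. a * f x + b * g x) has_derivative
      (\<lambda>v. a * frechet_derivative f (at x) v + b * frechet_derivative g (at x) v)) (at x)" for x
    using Suc.prems by (auto intro!: derivative_eq_intros simp: frechet_derivative_works[symmetric])
  have "dir_deriv v (\<lambda>x. a * f x + b * g x) = (\<lambda>x. a * dir_deriv v f x + b * dir_deriv v g x)" for v
    using dir_deriv_eq[OF der] by (simp add: dir_deriv_def fun_eq_iff)
  moreover have "(\<lambda>x. a * f x + b * g x) differentiable (at x)" for x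
    using der differentiableI by blast
  ultimately show ?case
    using Suc by simp
qed

lemma smooth_linear: "smooth f \<Longrightarrow> smooth g \<Longrightarrow> smooth (\<lambda>x. a * f x + b * g x)"
  unfolding smooth_def by (simp add: times_cont_diff_linear)

lemma smooth_differentiable: "smooth f \<Longrightarrow> f differentiable (at x)"
  unfolding smooth_def by (metis times_cont_diff.simps(2))

lemma smooth_dir_deriv: "smooth f \<Longrightarrow> smooth (dir_deriv v f)"
  unfolding smooth_def by (metis times_cont_diff.simps(2))

lemma smooth_diff_op: "diff_op p P \<Longrightarrow> smooth f \<Longrightarrow> smooth (P f)"
proof (induction arbitrary: f rule: diff_op.induct)
  case (const c)
  from smooth_linear[OF const const, of c 0] show ?case by simp
next
  case (vec v)
  then show ?case by (rule smooth_dir_deriv)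
next
  case (add p P q Q)
  from smooth_linear[OF add.IH(1)[OF add.prems] add.IH(2)[OF add.prems], of 1 1] show ?case by simp
next
  case (mult p P q Q)
  then show ?case by blast
qed

lemma diff_op_power: "diff_op p P \<Longrightarrow> diff_op (\<lambda>\<psi>. p \<psi> ^ n) (P ^^ n)"
proof (induction n)
  case 0
  have "diff_op (sym_const 1) (\<lambda>f. f)"
    using diff_op.const[of 1] by simp
  then show ?case
    by (simp add: sym_const_def id_def)
next
  case (Suc n)
  from diff_op.mult[OF Suc.prems Suc.IH[OF Suc.prems]] show ?case
    by (simp add: o_def)
qed

lemma differential_solutionsD:
  "f \<in> differential_solutions I \<Longrightarrow> p \<in> I \<Longrightarrow> diff_op p P \<Longrightarrow> P f = (\<lambda>x. 0)"
  unfolding differential_solutions_def by blast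

text \<open>The shifted sequence \<open>u (Suc j)\<close> satisfies the claim by induction, so
  \<open>u 0\<close> minus its Taylor sum has derivative 0 and vanishes at 0. No remainder formula
  is involved, which suits complex values.\<close>

lemma terminating_derivatives_eq_taylor:
  fixes u :: "nat \<Rightarrow> real \<Rightarrow> complex"
  assumes "\<And>j t. (u j has_vector_derivative u (Suc j) t) (at t)" and "\<And>t. u M t = 0"
  shows "u 0 t = (\<Sum>j<M. u j 0 * of_real (t ^ j / fact j))"
  using assms
proof (induction M arbitrary: u t)
  case 0
  then show ?case by simp
next
  case (Suc M)
  define r where "r t = u 0 t - (\<Sum>j<Suc M. u j 0 * of_real (t ^ j / fact j))" for t
  have IH: "u (Suc 0) t = (\<Sum>j<M. u (Suc j) 0 * of_real (t ^ j / fact j))" for t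
    using Suc.IH[of "\<lambda>j. u (Suc j)" t] Suc.prems by blast
  have "((\<lambda>t. t ^ Suc j / fact (Suc j)) has_real_derivative t ^ j / fact j) (at t)" for j and t :: real
    using DERIV_cdivide[OF DERIV_pow[of "Suc j" t UNIV], of "fact (Suc j)"]
    by (simp del: of_nat_Suc)
  then have "((\<lambda>t. of_real (t ^ Suc j / fact (Suc j)) :: complex) has_vector_derivative
      of_real (t ^ j / fact j)) (at t)" for j and t :: real
    by (intro has_vector_derivative_of_real) (simp add: has_real_derivative_iff_has_vector_derivative)
  then have "((\<lambda>t. \<Sum>j<M. u (Suc j) 0 * of_real (t ^ Suc j / fact (Suc j))) has_vector_derivative
      (\<Sum>j<M. u (Suc j) 0 * of_real (t ^ j / fact j))) (at t)" for t
    by (intro has_vector_derivative_sum has_vector_derivative_mult_right)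
  then have "((\<lambda>t. u 0 t - (u 0 0 + (\<Sum>j<M. u (Suc j) 0 * of_real (t ^ Suc j / fact (Suc j)))))
      has_vector_derivative u (Suc 0) t - (0 + (\<Sum>j<M. u (Suc j) 0 * of_real (t ^ j / fact j)))) (at t)" for t
    using Suc.prems(1)[of 0]
    by (intro has_vector_derivative_diff has_vector_derivative_add has_vector_derivative_const)
  then have "(r has_vector_derivative 0) (at t)" for t
    unfolding r_def[abs_def] sum.lessThan_Suc_shift by (simp add: IH)
  then obtain c where "\<And>t. r t = c"
    using has_vector_derivative_zero_constant[of UNIV r] by auto
  moreover have "r 0 = 0"
    unfolding r_def sum.lessThan_Suc_shift by simp
  ultimately have "r t = 0" by metis
  then show ?case by (simp add: r_def)
qed

section \<open>Functionals as solutions of differential equations\<close>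

context lattice_ideal
begin

abbreviation T :: "'v \<Rightarrow> 'v \<Rightarrow>\<^sub>0 complex" where
  "T \<equiv> lift_vec log_e"

text \<open>The dual of the quotient, on representatives. Values outside \<open>A\<close> are
  unconstrained, hence the congruence rules for \<open>poly_part\<close> and \<open>solution\<close>
  that compare on \<open>A\<close> only.\<close>

definition functional :: "(('v \<Rightarrow>\<^sub>0 complex) \<Rightarrow> complex) \<Rightarrow> bool" where
  "functional G \<longleftrightarrow> (\<forall>x\<in>A. \<forall>y\<in>A. G (x + y) = G x + G y) \<and>
     (\<forall>c. \<forall>x\<in>A. G (\<kappa> c * x) = c * G x) \<and> (\<forall>x\<in>J. G x = 0)"

lemma functional_add: "functional G \<Longrightarrow> x \<in> A \<Longrightarrow> y \<in> A \<Longrightarrow> G (x + y) = G x + G y"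
  and functional_scale: "functional G \<Longrightarrow> x \<in> A \<Longrightarrow> G (\<kappa> c * x) = c * G x"
  and functional_J: "functional G \<Longrightarrow> x \<in> J \<Longrightarrow> G x = 0"
  unfolding functional_def by blast+

lemma functional_0: "functional G \<Longrightarrow> G 0 = 0"
  using functional_J J_0 by blast

lemma functional_sum:
  "functional G \<Longrightarrow> (\<And>i. i \<in> S \<Longrightarrow> f i \<in> A) \<Longrightarrow> G (sum f S) = (\<Sum>i\<in>S. G (f i))"
proof (induction S rule: infinite_finite_induct)
  case (insert i S)
  then have "G (f i + sum f S) = G (f i) + G (sum f S)"
    by (intro functional_add A_sum) auto
  with insert show ?case by simp
qed (simp_all add: functional_0)

lemma functional_cong:
  assumes "functional G" "x \<asymp> y" "y \<in> A"
  shows "G x = G y"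
  using functional_add[OF assms(1), of "x - y" y] functional_J[OF assms(1), of "x - y"] assms J_A[of "x - y"]
  by (simp add: cong_def)

text \<open>The module structure on the dual space; by \<open>diff_op_solution\<close> it is the
  counterpart of applying a differential operator.\<close>

lemma functional_mult:
  assumes "functional G" "q \<in> A"
  shows "functional (\<lambda>x. G (q * x))"
  unfolding functional_def
proof (intro conjI allI ballI)
  fix x y assume "x \<in> A" "y \<in> A"
  then show "G (q * (x + y)) = G (q * x) + G (q * y)"
    unfolding distrib_left by (intro functional_add assms A_mult)
next
  fix c x assume "x \<in> A"
  then show "G (q * (\<kappa> c * x)) = c * G (q * x)"
    unfolding mult.left_commute[of q] by (intro functional_scale assms A_mult)
next
  fix x assume "x \<in> J"
  then show "G (q * x) = 0"
    using assms by (intro functional_J J_mult)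
qed

text \<open>Peeling off a single factor \<open>T x\<close> exposes the real coordinates of
  \<open>x\<close> and leaves a new functional applied to \<open>y\<close>. Differentiability and
  polynomiality are both proved by iterating this.\<close>

lemma functional_T_mult:
  assumes G: "functional G" and y: "y \<in> A"
  shows "G (T x * y) = (\<Sum>b\<in>B. of_real (coord b x) * G (log_e b * y))"
proof -
  have b: "log_e b * y \<in> A" if "b \<in> B" for b
    using that y by (intro A_mult log_e_A basis_lattice)
  have "T x * y = (\<Sum>b\<in>B. \<kappa> (of_real (coord b x)) * (log_e b * y))"
    by (simp add: lift_vec_def sum_distrib_right mult.assoc)
  then have "G (T x * y) = (\<Sum>b\<in>B. G (\<kappa> (of_real (coord b x)) * (log_e b * y)))"
    using functional_sum[OF G, of B "\<lambda>b. \<kappa> (of_real (coord b x)) * (log_e b * y)"] b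
    by (metis (no_types, lifting) A_mult scalar_A)
  also have "\<dots> = (\<Sum>b\<in>B. of_real (coord b x) * G (log_e b * y))"
    by (intro sum.cong refl functional_scale[OF G] b)
  finally show ?thesis .
qed

text \<open>The power rule, with \<open>G\<close> left arbitrary because the induction applies it to
  the functionals \<open>y \<mapsto> G (log_e b * y)\<close>.\<close>

lemma has_derivative_functional_T_power:
  "functional G \<Longrightarrow>
   ((\<lambda>x. G (T x ^ j)) has_derivative (\<lambda>v. of_nat j * G (T v * T x ^ (j - 1)))) (at x)"
proof (induction j arbitrary: G)
  case 0
  then show ?case by simp
next
  case (Suc j)
  have TA: "T v * T x ^ i \<in> A" "T x ^ i \<in> A" for i v x
    by (intro A_mult A_power lift_vec_log_e_A)+
  have bA: "b \<in> B \<Longrightarrow> log_e b \<in> A" for b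
    by (intro log_e_A basis_lattice)
  have "((\<lambda>x. \<Sum>b\<in>B. of_real (coord b x) * G (log_e b * T x ^ j)) has_derivative
      (\<lambda>v. \<Sum>b\<in>B. of_real (coord b x) * (of_nat j * G (log_e b * (T v * T x ^ (j - 1)))) +
        of_real (coord b v) * G (log_e b * T x ^ j))) (at x)"
    by (intro has_derivative_sum has_derivative_mult Suc.IH functional_mult[OF Suc.prems bA]
        bounded_linear.has_derivative[OF bounded_linear_of_real] has_derivative_ident
        bounded_linear.has_derivative[OF bounded_linear_coord])
  moreover have "(\<Sum>b\<in>B. of_real (coord b x) * (of_nat j * G (log_e b * (T v * T x ^ (j - 1)))) +
        of_real (coord b v) * G (log_e b * T x ^ j)) = of_nat (Suc j) * G (T v * T x ^ j)" for v
  proof -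
    have "(\<Sum>b\<in>B. of_real (coord b x) * (of_nat j * G (log_e b * (T v * T x ^ (j - 1)))) +
        of_real (coord b v) * G (log_e b * T x ^ j)) =
        of_nat j * G (T x * (T v * T x ^ (j - 1))) + G (T v * T x ^ j)"
      unfolding functional_T_mult[OF Suc.prems TA(1)] functional_T_mult[OF Suc.prems TA(2)]
      by (simp add: sum.distrib sum_distrib_left mult_ac)
    \<comment> \<open>At \<open>j = 0\<close> the exponent \<open>j - 1\<close> is cut off to 0 and
      the arguments disagree, but the factor \<open>of_nat j\<close> makes both sides 0.\<close>
    also have "of_nat j * G (T x * (T v * T x ^ (j - 1))) = of_nat j * G (T v * T x ^ j)"
      by (cases j) (simp_all add: mult_ac)
    finally show ?thesis by (simp add: algebra_simps)
  qed
  ultimately show ?case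
    by (simp add: functional_T_mult[OF Suc.prems TA(2)])
qed

text \<open>The truncated exponential of \<open>T x\<close> under \<open>G\<close>. For a functional
  the term at \<open>nil_bound\<close> is 0; including it keeps the range in the form
  \<open>Suc _\<close>, from which the degree 0 term splits off.\<close>

definition poly_part :: "(('v \<Rightarrow>\<^sub>0 complex) \<Rightarrow> complex) \<Rightarrow> 'v \<Rightarrow> complex" where
  "poly_part G x = (\<Sum>j<Suc nil_bound. G (T x ^ j) / fact j)"

definition solution :: "(('v \<Rightarrow>\<^sub>0 complex) \<Rightarrow> complex) \<Rightarrow> 'v \<Rightarrow> complex" where
  "solution G x = exp (blinfun_apply \<phi> x) * poly_part G x"

lemma poly_part_cong: "(\<And>y. y \<in> A \<Longrightarrow> G y = H y) \<Longrightarrow> poly_part G = poly_part H"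
  unfolding poly_part_def by (intro ext sum.cong) (auto simp: A_power lift_vec_log_e_A simp del: mem_Collect_eq)

lemma solution_cong: "(\<And>y. y \<in> A \<Longrightarrow> G y = H y) \<Longrightarrow> solution G = solution H"
  unfolding solution_def[abs_def] using poly_part_cong[of G H] by simp

lemma poly_part_add: "poly_part (\<lambda>y. G y + H y) x = poly_part G x + poly_part H x"
  by (simp only: poly_part_def add_divide_distrib sum.distrib)

lemma poly_part_scale: "poly_part (\<lambda>y. c * G y) x = c * poly_part G x"
  by (simp only: poly_part_def sum_distrib_left times_divide_eq_right)

lemma solution_add: "solution (\<lambda>y. G y + H y) = (\<lambda>x. solution G x + solution H x)"
  by (simp add: solution_def[abs_def] poly_part_add distrib_left)

lemma solution_scale: "solution (\<lambda>y. c * G y) = (\<lambda>x. c * solution G x)"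
  by (simp add: solution_def[abs_def] poly_part_scale mult_ac)

lemma polynomial_function_poly_part:
  assumes "functional G"
  shows "polynomial_function (poly_part G)"
proof -
  have "polynomial_function (\<lambda>x. G (T x ^ j))" if "functional G" for G j
    using that
  proof (induction j arbitrary: G)
    case 0
    then show ?case by simp
  next
    case (Suc j)
    have "polynomial_function (\<lambda>x. coord b x *\<^sub>R G (log_e b * T x ^ j))" if "b \<in> B" for b
      using that by (intro polynomial_function_mult polynomial_function_bounded_linear
          bounded_linear_coord Suc.IH functional_mult[OF Suc.prems] log_e_A basis_lattice)
    then have "polynomial_function (\<lambda>x. \<Sum>b\<in>B. coord b x *\<^sub>R G (log_e b * T x ^ j))"
      using finite_B by (intro polynomial_function_sum)
    then show ?case
      by (simp add: functional_T_mult[OF Suc.prems A_power[OF lift_vec_log_e_A]] scaleR_conv_of_real)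
  qed
  then have "polynomial_function (\<lambda>x. \<Sum>j<Suc nil_bound. (1 / fact j) *\<^sub>R G (T x ^ j))"
    using assms by (intro polynomial_function_sum polynomial_function_cmul) auto
  then show ?thesis
    by (simp add: poly_part_def[abs_def] scaleR_conv_of_real)
qed

text \<open>Like the exponential series, the sum reproduces itself with \<open>T v\<close> pulled
  out. Differentiation ends one degree lower, and the missing top term is 0 because it contains
  \<open>T x ^ nil_bound\<close>.\<close>

lemma has_derivative_poly_part:
  assumes G: "functional G"
  shows "(poly_part G has_derivative (\<lambda>v. poly_part (\<lambda>y. G (T v * y)) x)) (at x)"
proof -
  have "(poly_part G has_derivative
      (\<lambda>v. \<Sum>j<Suc nil_bound. (of_nat j * G (T v * T x ^ (j - 1))) / fact j)) (at x)"
    unfolding poly_part_def[abs_def] divide_inverse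
    by (intro has_derivative_sum has_derivative_mult_left has_derivative_functional_T_power G)
  moreover have "(\<Sum>j<Suc nil_bound. (of_nat j * G (T v * T x ^ (j - 1))) / fact j) =
      poly_part (\<lambda>y. G (T v * y)) x" for v
  proof -
    have "G (T v * T x ^ nil_bound) = 0"
      by (intro functional_J[OF G] J_mult nil_bound lift_vec_log_e_A)
    then have "poly_part (\<lambda>y. G (T v * y)) x = (\<Sum>j<nil_bound. G (T v * T x ^ j) / fact j)"
      by (simp add: poly_part_def)
    also have "\<dots> = (\<Sum>j<Suc nil_bound. (of_nat j * G (T v * T x ^ (j - 1))) / fact j)"
      unfolding sum.lessThan_Suc_shift by (simp add: field_simps del: of_nat_Suc)
    finally show ?thesis by simp
  qed
  ultimately show ?thesis by simp
qed

text \<open>The product rule adds the contribution \<open>\<langle>v|\<phi>\<rangle>\<close> of the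
  exponential factor to that of \<open>T v\<close>, and the sum is the image of \<open>v\<close>
  under \<open>log_hom\<close>.\<close>

lemma has_derivative_solution:
  assumes G: "functional G"
  shows "(solution G has_derivative (\<lambda>v. solution (\<lambda>y. G (log_hom (sym_vec v) * y)) x)) (at x)"
proof -
  have exp: "((\<lambda>x. exp (blinfun_apply \<phi> x)) has_derivative
      (\<lambda>v. blinfun_apply \<phi> v * exp (blinfun_apply \<phi> x))) (at x)"
    using has_derivative_compose[OF bounded_linear.has_derivative[OF blinfun.bounded_linear_right
          has_derivative_ident] has_field_derivative_imp_has_derivative[OF DERIV_exp]]
    by (simp add: mult.commute)
  have "(solution G has_derivative (\<lambda>v. exp (blinfun_apply \<phi> x) * poly_part (\<lambda>y. G (T v * y)) x +
      blinfun_apply \<phi> v * exp (blinfun_apply \<phi> x) * poly_part G x)) (at x)"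
    unfolding solution_def[abs_def]
    by (intro has_derivative_mult has_derivative_poly_part[OF G] exp)
  moreover have "exp (blinfun_apply \<phi> x) * poly_part (\<lambda>y. G (T v * y)) x +
      blinfun_apply \<phi> v * exp (blinfun_apply \<phi> x) * poly_part G x =
      solution (\<lambda>y. G (log_hom (sym_vec v) * y)) x" for v
  proof -
    have "solution (\<lambda>y. G (log_hom (sym_vec v) * y)) =
        solution (\<lambda>y. G (T v * y) + blinfun_apply \<phi> v * G y)"
    proof (rule solution_cong)
      fix y assume y: "y \<in> A"
      show "G (log_hom (sym_vec v) * y) = G (T v * y) + blinfun_apply \<phi> v * G y"
        unfolding log_hom_sym_vec distrib_right functional_scale[OF G y, symmetric]
        by (intro functional_add G A_mult scalar_A lift_vec_log_e_A y)
    qed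
    then show ?thesis
      by (simp add: solution_add solution_scale) (simp add: solution_def mult_ac)
  qed
  ultimately show ?thesis by simp
qed

lemma dir_deriv_solution:
  "functional G \<Longrightarrow> dir_deriv v (solution G) = solution (\<lambda>y. G (log_hom (sym_vec v) * y))"
  using dir_deriv_eq[OF has_derivative_solution] by blast

lemma functional_log_hom: "functional G \<Longrightarrow> p \<in> sym_carrier \<Longrightarrow> functional (\<lambda>y. G (log_hom p * y))"
  by (intro functional_mult log_hom_A)

lemma smooth_solution: "functional G \<Longrightarrow> smooth (solution G)"
proof -
  have "times_cont_diff k (solution G)" if "functional G" for k G
    using that
  proof (induction k arbitrary: G)
    case 0
    have "continuous_on UNIV (solution G)"
      using has_derivative_solution[OF 0]
      by (intro continuous_at_imp_continuous_on ballI) (blast intro: has_derivative_continuous)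
    then show ?case by simp
  next
    case (Suc k)
    have "solution G differentiable (at x)" for x
      using has_derivative_solution[OF Suc.prems] differentiableI by blast
    then show ?case
      using Suc by (simp add: dir_deriv_solution functional_log_hom sym_carrier.vec)
  qed
  then show "functional G \<Longrightarrow> smooth (solution G)"
    by (simp add: smooth_def)
qed

text \<open>Composition of operators moves the inner factor into the functional first; commutativity
  of the ring restores the order.\<close>

lemma diff_op_solution:
  "diff_op p P \<Longrightarrow> functional G \<Longrightarrow> P (solution G) = solution (\<lambda>y. G (log_hom p * y))"
proof (induction arbitrary: G rule: diff_op.induct)
  case (const c)
  have "solution (\<lambda>y. G (log_hom (sym_const c) * y)) = solution (\<lambda>y. c * G y)"
    unfolding log_hom_const by (intro solution_cong functional_scale const)
  then show ?case by (simp add: solution_scale)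
next
  case (vec v)
  then show ?case by (rule dir_deriv_solution)
next
  case (add p P q Q)
  have pq: "p \<in> sym_carrier" "q \<in> sym_carrier"
    using add.hyps sym_carrier_iff_diff_op by blast+
  have "solution (\<lambda>y. G (log_hom (\<lambda>\<psi>. p \<psi> + q \<psi>) * y)) =
      solution (\<lambda>y. G (log_hom p * y) + G (log_hom q * y))"
    unfolding log_hom_add[OF pq] distrib_right
    by (intro solution_cong functional_add add.prems A_mult log_hom_A pq)
  then show ?case
    by (simp add: solution_add add)
next
  case (mult p P q Q)
  have pq: "p \<in> sym_carrier" "q \<in> sym_carrier"
    using mult.hyps sym_carrier_iff_diff_op by blast+
  have "P (Q (solution G)) = solution (\<lambda>y. G (log_hom q * (log_hom p * y)))"
    using mult pq functional_log_hom[OF mult.prems pq(2)] by simp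
  then show ?case
    by (simp add: log_hom_mult[OF pq] mult_ac)
qed

section \<open>The correspondence between functionals and solutions\<close>

definition log_ideal :: "(('v \<Rightarrow>\<^sub>L complex) \<Rightarrow> complex) set" where
  "log_ideal = {p \<in> sym_carrier. log_hom p \<in> J}"

lemma solution_differential: "functional G \<Longrightarrow> solution G \<in> differential_solutions log_ideal"
  unfolding differential_solutions_def
proof (intro CollectI conjI ballI allI impI smooth_solution)
  fix p P assume G: "functional G" and p: "p \<in> log_ideal" and P: "diff_op p P"
  have "solution (\<lambda>y. G (log_hom p * y)) = solution (\<lambda>y. 0)"
    using p by (intro solution_cong) (simp add: log_ideal_def functional_J[OF G] J_mult')
  also have "\<dots> = (\<lambda>x. 0)"
    by (simp add: solution_def[abs_def] poly_part_def)
  finally show "P (solution G) = (\<lambda>x. 0)"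
    using diff_op_solution[OF P G] by simp
qed

lemma solution_at_0: "functional G \<Longrightarrow> solution G 0 = G 1"
proof -
  assume G: "functional G"
  have "poly_part G 0 = G 1"
    unfolding poly_part_def sum.lessThan_Suc_shift by (simp add: lift_vec_0 functional_0[OF G])
  then show ?thesis by (simp add: solution_def blinfun.zero_right)
qed

text \<open>The functional can be recovered from its solution: \<open>G y\<close> is the value at
  the origin of \<open>P (solution G)\<close>, for any operator \<open>P\<close> whose symbol maps
  to \<open>y\<close>.\<close>

lemma solution_inject:
  assumes "functional G" "functional H" "solution G = solution H" "y \<in> A"
  shows "G y = H y"
proof -
  obtain p where p: "p \<in> sym_carrier" "log_hom p \<asymp> y"
    using log_hom_surj[OF assms(4)] by blast
  obtain P where P: "diff_op p P"
    using p(1) sym_carrier_iff_diff_op by blast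
  have "K y = P (solution K) 0" if K: "functional K" for K
    using diff_op_solution[OF P K] solution_at_0[OF functional_log_hom[OF K p(1)]]
      functional_cong[OF K p(2) assms(4)] by simp
  with assms show ?thesis by metis
qed

text \<open>The prescribed series in powers of \<open>x\<close> is the Cauchy product of the
  terminating series in \<open>T x\<close> with the ordinary exponential series of
  \<open>\<langle>x|\<phi>\<rangle>\<close>; the binomial theorem matches the coefficients.\<close>

lemma solution_sums:
  assumes G: "functional G"
  shows "(\<lambda>k. G (log_hom (sym_vec x) ^ k) / fact k) sums solution G x"
proof -
  define c where "c = blinfun_apply \<phi> x"
  define a where "a j = G (T x ^ j) / fact j" for j
  define b where "b k = c ^ k /\<^sub>R fact k" for k
  have a0: "a j = 0" if "j \<notin> {..<Suc nil_bound}" for j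
    using that J_power_le[OF nil_bound lift_vec_log_e_A, of j x] functional_J[OF G] by (simp add: a_def)
  have "(\<lambda>k. \<Sum>i\<le>k. a i * b (k - i)) sums (suminf a * suminf b)"
  proof (rule Cauchy_product_sums)
    show "summable (\<lambda>k. norm (a k))"
      by (rule summable_finite[of "{..<Suc nil_bound}"]) (auto simp: a0)
    show "summable (\<lambda>k. norm (b k))"
      unfolding b_def by (rule summable_norm_exp)
  qed
  moreover have "suminf a * suminf b = solution G x"
  proof -
    have "suminf a = poly_part G x"
      unfolding poly_part_def a_def[symmetric] by (rule suminf_finite) (auto simp: a0)
    moreover have "suminf b = exp c"
      by (simp add: b_def[abs_def] exp_def)
    ultimately show ?thesis
      by (simp add: solution_def c_def mult.commute)
  qed
  moreover have "(\<Sum>i\<le>k. a i * b (k - i)) = G (log_hom (sym_vec x) ^ k) / fact k" for k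
  proof -
    have "log_hom (sym_vec x) ^ k = (\<Sum>i\<le>k. \<kappa> (of_nat (k choose i) * c ^ (k - i)) * T x ^ i)"
      unfolding log_hom_sym_vec binomial_ring c_def[symmetric] scalar_mult scalar_of_nat scalar_power
      by (simp only: mult_ac)
    then have "G (log_hom (sym_vec x) ^ k) = (\<Sum>i\<le>k. of_nat (k choose i) * c ^ (k - i) * G (T x ^ i))"
      by (simp only: functional_sum[OF G A_mult[OF scalar_A A_power[OF lift_vec_log_e_A]]]
          functional_scale[OF G A_power[OF lift_vec_log_e_A]])
    also have "\<dots> / fact k = (\<Sum>i\<le>k. a i * b (k - i))"
      unfolding sum_divide_distrib
      by (intro sum.cong refl) (simp add: a_def b_def binomial_fact scaleR_conv_of_real field_simps)
    finally show ?thesis by simp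
  qed
  ultimately show ?thesis by simp
qed

text \<open>The formal difference of the two operators has its symbol in the ideal, so it
  annihilates \<open>f\<close>. With \<open>p = q\<close> this also shows that on solutions an
  operator depends only on its symbol, without an appeal to symmetry of second derivatives.\<close>

lemma diff_op_agree:
  assumes f: "f \<in> differential_solutions log_ideal"
    and P: "diff_op p P" and Q: "diff_op q Q" and pq: "log_hom p \<asymp> log_hom q"
  shows "P f = Q f"
proof -
  have pq': "p \<in> sym_carrier" "q \<in> sym_carrier"
    using P Q sym_carrier_iff_diff_op by blast+
  let ?d = "\<lambda>\<psi>. p \<psi> + sym_const (-1) \<psi> * q \<psi>"
  have "log_hom ?d = log_hom p - log_hom q"
    using pq' by (simp add: log_hom_add log_hom_mult log_hom_const sym_carrier.intros scalar_minus scalar_1)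
  then have "?d \<in> log_ideal"
    using pq pq' by (simp add: log_ideal_def cong_def sym_carrier.intros)
  moreover have "diff_op ?d (\<lambda>f x. P f x + -1 * Q f x)"
    using diff_op.add[OF P diff_op.mult[OF diff_op.const[of "-1"] Q]] by simp
  ultimately have "(\<lambda>x. P f x + -1 * Q f x) = (\<lambda>x. 0)"
    by (rule differential_solutionsD[OF f])
  then show ?thesis by (simp add: fun_eq_iff)
qed

text \<open>
  A solution \<open>f\<close> comes from the functional \<open>p \<mapsto> (p(D) f)(0)\<close>: along the line through \<open>x\<close>, the function
  \<open>e\<^bsup>-t\<langle>x|\<phi>\<rangle>\<^esup> f(tx)\<close> is a polynomial in \<open>t\<close> because \<open>x - \<langle>x|\<phi>\<rangle>\<close> is nilpotent modulo the ideal.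
\<close>

lemma differential_solution_eq_solution:
  assumes f: "f \<in> differential_solutions log_ideal"
  shows "\<exists>G. functional G \<and> solution G = f"
proof -
  have "\<exists>P. \<exists>p. diff_op p P \<and> log_hom p \<asymp> y" if "y \<in> A" for y
    using log_hom_surj[OF that] sym_carrier_iff_diff_op by blast
  then obtain Op where Op: "\<And>y. y \<in> A \<Longrightarrow> \<exists>p. diff_op p (Op y) \<and> log_hom p \<asymp> y"
    by metis
  \<comment> \<open>The choice of \<open>Op y\<close> is arbitrary; \<open>diff_op_agree\<close>
    allows any operator with a congruent symbol in its place, and linearity follows by choosing sums
    and scalar multiples.\<close>
  define G where "G y = Op y f 0" for y
  have G: "G y = P f 0" if y: "y \<in> A" and P: "diff_op p P" "log_hom p \<asymp> y" for y p P
  proof -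
    obtain q where q: "diff_op q (Op y)" "log_hom q \<asymp> y"
      using Op[OF y] by blast
    then show ?thesis
      using diff_op_agree[OF f q(1) P(1) cong_trans[OF q(2) cong_sym[OF P(2)]]]
      by (simp add: G_def)
  qed
  have "functional G"
    unfolding functional_def
  proof (intro conjI ballI allI)
    fix y z assume y: "y \<in> A" and z: "z \<in> A"
    obtain p P q Q where p: "diff_op p P" "log_hom p \<asymp> y" and q: "diff_op q Q" "log_hom q \<asymp> z"
      using Op y z by blast
    then have pq: "p \<in> sym_carrier" "q \<in> sym_carrier"
      using sym_carrier_iff_diff_op by blast+
    have "G (y + z) = P f 0 + Q f 0"
      using log_hom_add[OF pq] cong_add[OF p(2) q(2)]
      by (intro G[OF A_add[OF y z] diff_op.add[OF p(1) q(1)]]) simp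
    then show "G (y + z) = G y + G z"
      by (simp only: G[OF y p] G[OF z q])
  next
    fix c y assume y: "y \<in> A"
    obtain p P where p: "diff_op p P" "log_hom p \<asymp> y"
      using Op y by blast
    then have "p \<in> sym_carrier"
      using sym_carrier_iff_diff_op by blast
    then have "G (\<kappa> c * y) = c * P f 0"
      using log_hom_mult[OF sym_carrier.const[of c]] cong_scalar[OF p(2), of c]
      by (intro G[OF A_mult[OF scalar_A y] diff_op.mult[OF diff_op.const p(1)]]) (simp add: log_hom_const)
    then show "G (\<kappa> c * y) = c * G y"
      by (simp only: G[OF y p])
  next
    fix y assume y: "y \<in> J"
    have "log_hom (sym_const 0) \<asymp> y"
      using y by (simp add: log_hom_const scalar_0 cong_sym flip: J_cong_0)
    from G[OF J_A[OF y] diff_op.const this] show "G y = 0" by simp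
  qed
  moreover have "solution G x = f x" for x
  proof -
    define c where "c = blinfun_apply \<phi> x"
    let ?l = "\<lambda>\<psi>. sym_vec x \<psi> + sym_const (- c) \<psi>"
    \<comment> \<open>The operator of \<open>x - \<langle>x|\<phi>\<rangle>\<close>, whose image
      under \<open>log_hom\<close> is the nilpotent \<open>T x\<close>.\<close>
    define D where "D = (\<lambda>f y. dir_deriv x f y + (- c) * f y)"
    have D: "diff_op ?l D"
      unfolding D_def by (intro diff_op.intros)
    have l: "?l \<in> sym_carrier"
      by (intro sym_carrier.intros)
    have "log_hom ?l = T x"
      by (simp add: log_hom_add sym_carrier.intros log_hom_sym_vec log_hom_const scalar_minus c_def)
    then have hl: "log_hom (\<lambda>\<psi>. ?l \<psi> ^ j) = T x ^ j" for j
      using log_hom_power[OF l] by simp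
    \<comment> \<open>The factor \<open>exp (- c * of_real t)\<close> absorbs the constant term of
      \<open>D\<close>: differentiating in \<open>t\<close> yields the directional derivative minus
      \<open>c\<close> times the function, that is, the next power of \<open>D\<close>.\<close>
    define u where "u j t = exp (- c * of_real t) * (D ^^ j) f (t *\<^sub>R x)" for j and t :: real
    have smooth: "smooth ((D ^^ j) f)" for j
      using f by (intro smooth_diff_op[OF diff_op_power[OF D]]) (simp add: differential_solutions_def)
    have "(u j has_vector_derivative u (Suc j) t) (at t)" for j t
    proof -
      let ?h = "(D ^^ j) f"
      have h': "(?h has_derivative frechet_derivative ?h (at (t *\<^sub>R x))) (at (t *\<^sub>R x))"
        using smooth_differentiable[OF smooth] by (simp add: frechet_derivative_works)
      then have lin: "linear (frechet_derivative ?h (at (t *\<^sub>R x)))"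
        by (rule has_derivative_linear)
      have "((\<lambda>t. ?h (t *\<^sub>R x)) has_derivative (\<lambda>s. frechet_derivative ?h (at (t *\<^sub>R x)) (s *\<^sub>R x))) (at t)"
        by (rule has_derivative_compose[OF bounded_linear.has_derivative[OF
              bounded_linear_scaleR_left has_derivative_ident] h'])
      then have h: "((\<lambda>t. ?h (t *\<^sub>R x)) has_vector_derivative dir_deriv x ?h (t *\<^sub>R x)) (at t)"
        by (simp add: has_vector_derivative_def dir_deriv_def linear_scale[OF lin])
      have e: "((\<lambda>t. exp (- c * of_real t)) has_vector_derivative - c * exp (- c * of_real t)) (at t)"
        by (auto intro!: derivative_eq_intros has_vector_derivative_real_field)
      have "(u j has_vector_derivative exp (- c * of_real t) * dir_deriv x ?h (t *\<^sub>R x) +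
          (- c * exp (- c * of_real t)) * ?h (t *\<^sub>R x)) (at t)"
        unfolding u_def by (rule has_vector_derivative_mult[OF e h])
      then show ?thesis
        by (simp add: u_def D_def algebra_simps)
    qed
    moreover have "u (Suc nil_bound) t = 0" for t
    proof -
      have "log_hom (\<lambda>\<psi>. ?l \<psi> ^ Suc nil_bound) \<in> J"
        unfolding hl unfolding power_Suc by (intro J_mult nil_bound lift_vec_log_e_A)
      then have "(\<lambda>\<psi>. ?l \<psi> ^ Suc nil_bound) \<in> log_ideal"
        unfolding log_ideal_def by (intro CollectI conjI sym_carrier_power[OF l])
      from differential_solutionsD[OF f this diff_op_power[OF D]]
      have "(D ^^ Suc nil_bound) f = (\<lambda>x. 0)" .
      then show ?thesis by (simp add: u_def)
    qed
    ultimately have "u 0 1 = (\<Sum>j<Suc nil_bound. u j 0 * of_real (1 ^ j / fact j))"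
      by (rule terminating_derivatives_eq_taylor)
    also have "\<dots> = poly_part G x"
      unfolding poly_part_def
    proof (rule sum.cong)
      fix j
      have "G (T x ^ j) = (D ^^ j) f 0"
        using hl by (intro G[OF A_power[OF lift_vec_log_e_A] diff_op_power[OF D]]) simp
      then show "u j 0 * of_real (1 ^ j / fact j) = G (T x ^ j) / fact j"
        by (simp add: u_def)
    qed simp
    finally show ?thesis
      by (simp add: u_def solution_def c_def exp_minus field_simps)
  qed
  ultimately show ?thesis by blast
qed

end

section \<open>Linear isomorphisms of function spaces\<close>

lemma linear_isoI:
  assumes A: "fun_subspace A" and inj: "inj_on F A" and im: "F ` A = B"
    and add: "\<And>f g. f \<in> A \<Longrightarrow> g \<in> A \<Longrightarrow> F (\<lambda>x. f x + g x) = (\<lambda>y. F f y + F g y)"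
    and scale: "\<And>c f. f \<in> A \<Longrightarrow> F (\<lambda>x. c * f x) = (\<lambda>y. c * F f y)"
  shows "linear_iso F A B"
proof -
  have A': "(\<lambda>_. 0) \<in> A" "\<And>f g. f \<in> A \<Longrightarrow> g \<in> A \<Longrightarrow> (\<lambda>x. f x + g x) \<in> A"
    "\<And>c f. f \<in> A \<Longrightarrow> (\<lambda>x. c * f x) \<in> A"
    using A by (auto simp: fun_subspace_def)
  have "fun_subspace B"
    unfolding fun_subspace_def im[symmetric]
  proof (intro conjI ballI allI; (elim imageE, hypsubst)?)
    show "(\<lambda>_. 0) \<in> F ` A"
      using scale[OF A'(1), of 0] A'(1) by (auto intro!: image_eqI[of _ _ "\<lambda>_. 0"])
  next
    fix f g assume "f \<in> A" "g \<in> A"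
    then show "(\<lambda>x. F f x + F g x) \<in> F ` A"
      by (intro image_eqI[of _ _ "\<lambda>x. f x + g x"]) (simp_all add: add A')
  next
    fix c f assume "f \<in> A"
    then show "(\<lambda>x. c * F f x) \<in> F ` A"
      by (intro image_eqI[of _ _ "\<lambda>x. c * f x"]) (simp_all add: scale A')
  qed
  with assms show ?thesis
    unfolding linear_iso_def bij_betw_def by blast
qed

text \<open>On \<open>B\<close> the map \<open>F\<close> is \<open>E\<close> after the inverse of
  \<open>L\<close>. Both the series map \<open>differential_fun\<close> and the final correspondence
  of solution spaces are obtained in this way from \<open>linear_iso_solution\<close>.\<close>

lemma linear_iso_factor:
  assumes E: "linear_iso E A C" and L: "linear_iso L A B" and FL: "\<And>f. f \<in> A \<Longrightarrow> F (L f) = E f"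
  shows "linear_iso F B C"
proof (rule linear_isoI)
  show "fun_subspace B"
    using L by (simp add: linear_iso_def)
  have B: "B = L ` A" and C: "C = E ` A" and inj: "inj_on E A"
    using E L by (auto simp: linear_iso_def bij_betw_def)
  have A: "\<And>f g. f \<in> A \<Longrightarrow> g \<in> A \<Longrightarrow> (\<lambda>x. f x + g x) \<in> A" "\<And>c f. f \<in> A \<Longrightarrow> (\<lambda>x. c * f x) \<in> A"
    using E by (auto simp: linear_iso_def fun_subspace_def)
  show "inj_on F B"
    unfolding B using inj FL by (auto simp: inj_on_def)
  show "F ` B = C"
    unfolding B C using FL by (auto simp: image_image)
  show "F (\<lambda>x. f x + g x) = (\<lambda>y. F f y + F g y)" if "f \<in> B" "g \<in> B" for f g
  proof -
    obtain f' g' where f': "f' \<in> A" "f = L f'" and g': "g' \<in> A" "g = L g'"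
      using \<open>f \<in> B\<close> \<open>g \<in> B\<close> B by blast
    have "(\<lambda>x. f x + g x) = L (\<lambda>x. f' x + g' x)"
      using L f' g' by (simp add: linear_iso_def)
    moreover have "E (\<lambda>x. f' x + g' x) = (\<lambda>y. E f' y + E g' y)"
      using E f' g' by (simp add: linear_iso_def)
    ultimately show ?thesis
      using f' g' A(1) by (simp add: FL)
  qed
  show "F (\<lambda>x. c * f x) = (\<lambda>y. c * F f y)" if "f \<in> B" for c f
  proof -
    obtain f' where f': "f' \<in> A" "f = L f'"
      using \<open>f \<in> B\<close> B by blast
    have "(\<lambda>x. c * f x) = L (\<lambda>x. c * f' x)"
      using L f' by (simp add: linear_iso_def)
    moreover have "E (\<lambda>x. c * f' x) = (\<lambda>y. c * E f' y)"
      using E f' by (simp add: linear_iso_def)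
    ultimately show ?thesis
      using f' A(2) by (simp add: FL)
  qed
qed

lemma fun_subspace_algebra_dual: "fun_subspace (algebra_dual R k)"
  unfolding fun_subspace_def algebra_dual_def by (auto simp: algebra_simps)

text \<open>Transposition along a bijective homomorphism; the default value 0 off the carrier is
  what makes functionals equal as soon as they agree on it.\<close>

lemma linear_iso_algebra_dual:
  assumes R: "ring R" and k: "\<And>c. k c \<in> carrier R" and h: "h \<in> algebra_hom R k S k'"
    and bij: "bij_betw h (carrier R) (carrier S)"
  shows "linear_iso (\<lambda>f x. if x \<in> carrier R then f (h x) else 0) (algebra_dual S k') (algebra_dual R k)"
    (is "linear_iso ?F _ _")
proof (rule linear_isoI[OF fun_subspace_algebra_dual])
  interpret ring R by (rule R)
  have h_add: "h (x \<oplus>\<^bsub>R\<^esub> y) = h x \<oplus>\<^bsub>S\<^esub> h y" and h_mult: "h (x \<otimes>\<^bsub>R\<^esub> y) = h x \<otimes>\<^bsub>S\<^esub> h y"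
    and h_S: "h x \<in> carrier S" if "x \<in> carrier R" "y \<in> carrier R" for x y
    using h that by (auto simp: algebra_hom_def ring_hom_def)
  have h_k: "h (k c) = k' c" for c
    using h by (simp add: algebra_hom_def)
  let ?i = "inv_into (carrier R) h"
  have i: "?i (h x) = x" if "x \<in> carrier R" for x
    using bij that by (simp add: bij_betw_def)
  have onto: "\<exists>x\<in>carrier R. y = h x" if "y \<in> carrier S" for y
    using bij that by (auto simp: bij_betw_def)
  show "inj_on ?F (algebra_dual S k')"
  proof (rule inj_onI, rule ext)
    fix f g y assume fg: "f \<in> algebra_dual S k'" "g \<in> algebra_dual S k'" "?F f = ?F g"
    show "f y = g y"
    proof (cases "y \<in> carrier S")
      case True
      then obtain x where "x \<in> carrier R" "y = h x"
        using onto by blast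
      with fun_cong[OF fg(3), of x] show ?thesis by simp
    next
      case False
      then show ?thesis
        using fg by (simp add: algebra_dual_def)
    qed
  qed
  show "?F ` algebra_dual S k' = algebra_dual R k"
  proof (intro equalityI subsetI)
    fix g assume "g \<in> ?F ` algebra_dual S k'"
    then obtain f where f: "f \<in> algebra_dual S k'" "g = ?F f" by blast
    then show "g \<in> algebra_dual R k"
      using h_S k by (auto simp: algebra_dual_def h_add h_mult h_k)
  next
    fix g assume g: "g \<in> algebra_dual R k"
    define f where "f y = (if y \<in> carrier S then g (?i y) else 0)" for y
    have f_h: "f (h x) = g x" if "x \<in> carrier R" for x
      using that h_S by (simp add: f_def i)
    have f_add: "f (h x \<oplus>\<^bsub>S\<^esub> h y) = f (h x) + f (h y)" if "x \<in> carrier R" "y \<in> carrier R" for x y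
      using that g f_h[of "x \<oplus>\<^bsub>R\<^esub> y"] by (simp add: f_h h_add algebra_dual_def)
    have f_scale: "f (k' c \<otimes>\<^bsub>S\<^esub> h x) = c * f (h x)" if "x \<in> carrier R" for c x
      using that g k f_h[of "k c \<otimes>\<^bsub>R\<^esub> x"] by (simp add: f_h h_mult h_k algebra_dual_def)
    have "f \<in> algebra_dual S k'"
      unfolding algebra_dual_def
    proof (intro CollectI conjI allI ballI impI)
      show "y \<notin> carrier S \<Longrightarrow> f y = 0" for y
        by (simp add: f_def)
      fix y assume "y \<in> carrier S"
      then obtain x where x: "x \<in> carrier R" "y = h x"
        using onto by blast
      then show "f (k' c \<otimes>\<^bsub>S\<^esub> y) = c * f y" for c
        by (simp only: f_scale)
      fix z assume "z \<in> carrier S"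
      then obtain x' where "x' \<in> carrier R" "z = h x'"
        using onto by blast
      with x show "f (y \<oplus>\<^bsub>S\<^esub> z) = f y + f z"
        by (simp only: f_add)
    qed
    moreover have "g = ?F f"
      using g f_h by (auto simp: algebra_dual_def fun_eq_iff)
    ultimately show "g \<in> ?F ` algebra_dual S k'" by blast
  qed
qed (auto simp: fun_eq_iff)

section \<open>The quotient algebras\<close>

lemma sym_algebra_simps [simp]:
  "carrier sym_algebra = sym_carrier" "mult sym_algebra = (\<lambda>p q \<psi>. p \<psi> * q \<psi>)"
  "one sym_algebra = sym_const 1" "zero sym_algebra = sym_const 0"
  "add sym_algebra = (\<lambda>p q \<psi>. p \<psi> + q \<psi>)"
  by (simp_all add: sym_algebra_def)

lemma ring_sym_algebra: "ring (sym_algebra :: (('v::real_normed_vector \<Rightarrow>\<^sub>L complex) \<Rightarrow> complex) ring)"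
proof (intro ringI abelian_groupI monoidI)
  fix p :: "('v \<Rightarrow>\<^sub>L complex) \<Rightarrow> complex" assume "p \<in> carrier sym_algebra"
  then have "(\<lambda>\<psi>. sym_const (-1) \<psi> * p \<psi>) \<in> sym_carrier"
    by (simp add: sym_carrier.intros)
  then show "\<exists>q\<in>carrier sym_algebra. q \<oplus>\<^bsub>sym_algebra\<^esub> p = \<zero>\<^bsub>sym_algebra\<^esub>"
    by (intro bexI[of _ "\<lambda>\<psi>. sym_const (-1) \<psi> * p \<psi>"]) (auto simp: sym_const_def)
qed (simp_all add: sym_carrier.intros, simp_all add: sym_const_def algebra_simps)

lemma sym_algebra_power: "p [^]\<^bsub>sym_algebra\<^esub> (k::nat) = (\<lambda>\<psi>. p \<psi> ^ k)"
proof -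
  interpret ring sym_algebra by (rule ring_sym_algebra)
  show ?thesis
    by (induction k) (simp_all add: sym_const_def mult.commute)
qed

context lattice_ideal
begin

abbreviation Q :: "('v \<Rightarrow>\<^sub>0 complex) set ring" where
  "Q \<equiv> ga_quot \<Lambda> J"

abbreviation cl :: "('v \<Rightarrow>\<^sub>0 complex) \<Rightarrow> ('v \<Rightarrow>\<^sub>0 complex) set" where
  "cl \<equiv> ga_class \<Lambda> J"

lemma cring_group_algebra: "cring (group_algebra \<Lambda>)"
proof -
  interpret ideal J "group_algebra \<Lambda>" by (rule ideal_J)
  show ?thesis
    by (intro cring.intro ring_axioms comm_monoid.intro monoid_axioms comm_monoid_axioms.intro)
      (simp add: mult.commute)
qed

lemma ring_hom_cring_cl: "ring_hom_cring (group_algebra \<Lambda>) Q cl"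
  unfolding ga_class_def[abs_def]
  by (rule ideal.rcos_ring_hom_cring[OF ideal_J cring_group_algebra])

lemma cl_add: "p \<in> A \<Longrightarrow> q \<in> A \<Longrightarrow> cl (p + q) = cl p \<oplus>\<^bsub>Q\<^esub> cl q"
  and cl_mult: "p \<in> A \<Longrightarrow> q \<in> A \<Longrightarrow> cl (p * q) = cl p \<otimes>\<^bsub>Q\<^esub> cl q"
  and cl_1: "cl 1 = \<one>\<^bsub>Q\<^esub>" and cl_0: "cl 0 = \<zero>\<^bsub>Q\<^esub>"
  and cl_Q: "p \<in> A \<Longrightarrow> cl p \<in> carrier Q"
proof -
  interpret ring_hom_cring "group_algebra \<Lambda>" Q cl by (rule ring_hom_cring_cl)
  show "p \<in> A \<Longrightarrow> q \<in> A \<Longrightarrow> cl (p + q) = cl p \<oplus>\<^bsub>Q\<^esub> cl q"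
    and "p \<in> A \<Longrightarrow> q \<in> A \<Longrightarrow> cl (p * q) = cl p \<otimes>\<^bsub>Q\<^esub> cl q"
    and "p \<in> A \<Longrightarrow> cl p \<in> carrier Q"
    using hom_add[of p q] hom_mult[of p q] hom_closed[of p] by simp_all
  show "cl 1 = \<one>\<^bsub>Q\<^esub>" "cl 0 = \<zero>\<^bsub>Q\<^esub>"
    using hom_one hom_zero by simp_all
qed

lemma carrier_Q: "carrier Q = cl ` A"
  by (auto simp: FactRing_def A_RCOSETS_def' ga_class_def)

lemma cl_def: "cl p = (\<lambda>j. j + p) ` J"
  by (auto simp: ga_class_def a_r_coset_def')

lemma cl_eq_iff: "cl p = cl q \<longleftrightarrow> p \<asymp> q"
proof
  assume "cl p = cl q"
  moreover have "p \<in> cl p"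
    unfolding cl_def by (rule image_eqI[of _ _ 0]) (simp_all add: J_0)
  ultimately show "p \<asymp> q"
    by (auto simp: cl_def cong_def)
next
  have "cl p \<subseteq> cl q" if "p \<asymp> q" for p q
  proof
    fix y assume "y \<in> cl p"
    then obtain j where "j \<in> J" "y = j + p" by (auto simp: cl_def)
    with that show "y \<in> cl q"
      unfolding cl_def cong_def by (intro image_eqI[of _ _ "j + (p - q)"]) (auto intro: J_add)
  qed
  then show "p \<asymp> q \<Longrightarrow> cl p = cl q"
    using cong_sym by blast
qed

lemma cl_eq_0_iff: "cl p = \<zero>\<^bsub>Q\<^esub> \<longleftrightarrow> p \<in> J"
  unfolding cl_0[symmetric] cl_eq_iff by (simp add: J_cong_0)

lemma cl_power: "p \<in> A \<Longrightarrow> cl (p ^ n) = cl p [^]\<^bsub>Q\<^esub> n"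
proof -
  interpret ring_hom_cring "group_algebra \<Lambda>" Q cl by (rule ring_hom_cring_cl)
  assume p: "p \<in> A"
  show ?thesis
    by (induction n) (simp_all add: cl_1 cl_mult[OF A_power[OF p] p] power_Suc2 del: power_Suc mem_Collect_eq)
qed

lemma cl_sum: "(\<And>i. i \<in> S \<Longrightarrow> f i \<in> A) \<Longrightarrow> cl (sum f S) = (\<Oplus>\<^bsub>Q\<^esub>i\<in>S. cl (f i))"
proof -
  interpret ring_hom_cring "group_algebra \<Lambda>" Q cl by (rule ring_hom_cring_cl)
  assume "\<And>i. i \<in> S \<Longrightarrow> f i \<in> A"
  then show ?thesis
  proof (induction S rule: infinite_finite_induct)
    case (insert i S)
    have "cl (sum f (insert i S)) = cl (f i + sum f S)"
      using insert.hyps by simp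
    also have "\<dots> = cl (f i) \<oplus>\<^bsub>Q\<^esub> cl (sum f S)"
      using insert.prems by (intro cl_add A_sum) auto
    also have "\<dots> = (\<Oplus>\<^bsub>Q\<^esub>i\<in>insert i S. cl (f i))"
      using insert by (subst S.finsum_insert) (auto intro!: cl_Q)
    finally show ?case .
  qed (simp_all add: cl_0)
qed

lemma ga_scalar_eq: "ga_scalar \<Lambda> J c = cl (\<kappa> c)"
  by (simp add: ga_scalar_def)

lemma is_nilpotent_cl: "p \<in> A \<Longrightarrow> p ^ n \<in> J \<Longrightarrow> is_nilpotent Q (cl p)"
  unfolding is_nilpotent_def using cl_power cl_eq_0_iff by metis

text \<open>The sums in \<open>nil_exp\<close> and \<open>nil_log1p\<close> run over the exponents
  with nonzero power, the truncated series over all \<open>k < M\<close>; they differ by terms in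
  \<open>J\<close>. The set \<open>K\<close> covers the exponential (all \<open>k\<close>) and the
  logarithm (\<open>k\<close> at least 1) at once.\<close>

lemma nil_series_cl:
  assumes x: "x \<in> A" "x ^ M \<in> J" and S: "S = {k. k \<in> K \<and> cl x [^]\<^bsub>Q\<^esub> k \<noteq> \<zero>\<^bsub>Q\<^esub>}"
    and c: "\<And>k. k \<in> K \<Longrightarrow> c k = fps_nth F k" "\<And>k. k \<notin> K \<Longrightarrow> fps_nth F k = 0"
  shows "(\<Oplus>\<^bsub>Q\<^esub>k\<in>S. ga_scalar \<Lambda> J (c k) \<otimes>\<^bsub>Q\<^esub> cl x [^]\<^bsub>Q\<^esub> k) = cl (fps_at M F x)"
proof -
  interpret ring_hom_cring "group_algebra \<Lambda>" Q cl by (rule ring_hom_cring_cl)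
  have S': "S = {k. k \<in> K \<and> x ^ k \<notin> J}"
    unfolding S cl_power[OF x(1), symmetric] cl_eq_0_iff ..
  have sub: "S \<subseteq> {..<M}"
    using J_power_le[OF x(2,1)] by (auto simp: S' not_le[symmetric])
  have tA: "\<kappa> (c k) * x ^ k \<in> A" for k
    by (intro A_mult scalar_A A_power x)
  have "(\<Oplus>\<^bsub>Q\<^esub>k\<in>S. ga_scalar \<Lambda> J (c k) \<otimes>\<^bsub>Q\<^esub> cl x [^]\<^bsub>Q\<^esub> k) = (\<Oplus>\<^bsub>Q\<^esub>k\<in>S. cl (\<kappa> (c k) * x ^ k))"
    by (simp only: ga_scalar_eq cl_power[OF x(1), symmetric] cl_mult[OF scalar_A A_power[OF x(1)]])
  also have "\<dots> = cl (\<Sum>k\<in>S. \<kappa> (c k) * x ^ k)"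
    by (rule cl_sum[OF tA, symmetric])
  also have "(\<Sum>k\<in>S. \<kappa> (c k) * x ^ k) = (\<Sum>k\<in>S. \<kappa> (fps_nth F k) * x ^ k)"
    using c(1) by (intro sum.cong) (auto simp: S')
  also have "cl \<dots> = cl (fps_at M F x)"
    unfolding cl_eq_iff
  proof (rule cong_sym, unfold cong_def)
    have "fps_at M F x - (\<Sum>k\<in>S. \<kappa> (fps_nth F k) * x ^ k) = (\<Sum>k\<in>{..<M} - S. \<kappa> (fps_nth F k) * x ^ k)"
      unfolding fps_at_def using sub by (simp add: sum_diff)
    also have "\<dots> \<in> J"
    proof (rule J_sum)
      fix k assume "k \<in> {..<M} - S"
      then consider "k \<notin> K" | "x ^ k \<in> J"
        by (auto simp: S')
      then show "\<kappa> (fps_nth F k) * x ^ k \<in> J"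
        by cases (simp_all add: c(2) scalar_0 J_0 J_mult scalar_A del: mem_Collect_eq)
    qed
    finally show "fps_at M F x - (\<Sum>k\<in>S. \<kappa> (fps_nth F k) * x ^ k) \<in> J" .
  qed
  finally show ?thesis .
qed

lemma fps_ln_1_nth: "1 \<le> k \<Longrightarrow> fps_nth (fps_ln (1::complex)) k = (- 1) ^ (k + 1) / of_nat k"
  by (cases k) (simp_all add: fps_ln_nth)

lemma log_tilde_eq:
  assumes a: "a \<in> \<Lambda>"
  shows "log_tilde \<Lambda> J \<phi> a = cl (log_e a)"
  unfolding log_tilde_def nil_log1p_def unip_class_def unip_def[symmetric] log_e_def
  by (rule nil_series_cl[OF unip_A[OF a] nil_index(2)[OF a], of _ "{1..}"])
    (auto simp: fps_ln_1_nth Suc_le_eq)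

lemma log_underline_eq:
  assumes a: "a \<in> \<Lambda>"
  shows "log_underline \<Lambda> J \<phi> a = cl (log_e a + \<kappa> (blinfun_apply \<phi> a))"
  unfolding log_underline_def log_tilde_eq[OF a] ga_scalar_eq
  by (rule cl_add[OF log_e_A[OF a] scalar_A, symmetric])

lemma nil_exp_log_tilde:
  assumes a: "a \<in> \<Lambda>" and M: "log_e a ^ M \<in> J"
  shows "nil_exp Q (ga_scalar \<Lambda> J) (log_tilde \<Lambda> J \<phi> a) = cl (exp_at M (log_e a))"
  unfolding log_tilde_eq[OF a] nil_exp_def
  by (rule nil_series_cl[OF log_e_A[OF a] M, of _ UNIV]) auto

section \<open>The logarithm homomorphism into the quotient ring\<close>

definition log_class :: "(('v \<Rightarrow>\<^sub>L complex) \<Rightarrow> complex) \<Rightarrow> ('v \<Rightarrow>\<^sub>0 complex) set" where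
  "log_class p = cl (log_hom p)"

lemma log_class_hom: "log_class \<in> algebra_hom sym_algebra sym_const Q (ga_scalar \<Lambda> J)"
  unfolding algebra_hom_def
proof (intro CollectI conjI ring_hom_memI allI)
  fix p q :: "('v \<Rightarrow>\<^sub>L complex) \<Rightarrow> complex"
  assume pq: "p \<in> carrier sym_algebra" "q \<in> carrier sym_algebra"
  then show "log_class (p \<otimes>\<^bsub>sym_algebra\<^esub> q) = log_class p \<otimes>\<^bsub>Q\<^esub> log_class q"
    "log_class (p \<oplus>\<^bsub>sym_algebra\<^esub> q) = log_class p \<oplus>\<^bsub>Q\<^esub> log_class q"
    by (simp_all add: log_class_def log_hom_mult log_hom_add cl_mult cl_add log_hom_A del: mem_Collect_eq)
next
  fix p :: "('v \<Rightarrow>\<^sub>L complex) \<Rightarrow> complex"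
  assume "p \<in> carrier sym_algebra"
  then show "log_class p \<in> carrier Q"
    by (simp add: log_class_def cl_Q log_hom_A del: mem_Collect_eq)
next
  show "log_class (sym_const c) = ga_scalar \<Lambda> J c" for c
    by (simp add: log_class_def log_hom_const ga_scalar_eq)
  show "log_class \<one>\<^bsub>sym_algebra\<^esub> = \<one>\<^bsub>Q\<^esub>"
    by (simp add: log_class_def log_hom_const scalar_1 cl_1)
qed

lemma is_log_hom_log_class: "is_log_hom \<Lambda> J \<phi> log_class"
  unfolding is_log_hom_def using log_class_hom
  by (auto simp: log_class_def log_underline_eq cl_eq_iff log_hom_lattice)

text \<open>\<open>is_log_hom\<close> prescribes values on the lattice only. A general vector is a
  real combination of basis vectors, which are lattice vectors, and its coefficients are constants,
  where an algebra homomorphism has no freedom.\<close>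

lemma log_hom_unique:
  assumes "is_log_hom \<Lambda> J \<phi> h" and "p \<in> sym_carrier"
  shows "h p = log_class p"
  using assms(2)
proof induction
  have h: "h \<in> ring_hom sym_algebra Q" "\<And>c. h (sym_const c) = ga_scalar \<Lambda> J c"
      "\<And>a. a \<in> \<Lambda> \<Longrightarrow> h (sym_vec a) = log_underline \<Lambda> J \<phi> a"
    using assms(1) by (auto simp: is_log_hom_def algebra_hom_def)
  have l: "log_class \<in> ring_hom sym_algebra Q" "\<And>c. log_class (sym_const c) = ga_scalar \<Lambda> J c"
      "\<And>a. a \<in> \<Lambda> \<Longrightarrow> log_class (sym_vec a) = log_underline \<Lambda> J \<phi> a"
    using is_log_hom_log_class by (auto simp: is_log_hom_def algebra_hom_def)
  have hom_add: "h (\<lambda>\<psi>. p \<psi> + q \<psi>) = log_class (\<lambda>\<psi>. p \<psi> + q \<psi>)"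
    and hom_mult: "h (\<lambda>\<psi>. p \<psi> * q \<psi>) = log_class (\<lambda>\<psi>. p \<psi> * q \<psi>)"
    if "p \<in> sym_carrier" "q \<in> sym_carrier" "h p = log_class p" "h q = log_class q" for p q
    using that ring_hom_add[OF h(1), of p q] ring_hom_add[OF l(1), of p q]
      ring_hom_mult[OF h(1), of p q] ring_hom_mult[OF l(1), of p q] by simp_all
  {
    case (const c)
    then show ?case by (simp add: h l)
  next
    case (vec v)
    let ?s = "\<lambda>F \<psi>. \<Sum>b\<in>F. sym_const (of_real (coord b v)) \<psi> * sym_vec b \<psi>"
    have sums: "?s F \<in> sym_carrier \<and> h (?s F) = log_class (?s F)" if "F \<subseteq> B" for F
      using finite_subset[OF that finite_B] that
    proof (induction F)
      case empty
      have "?s {} = sym_const 0"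
        by (simp add: sym_const_def)
      then show ?case
        by (simp only: sym_carrier.const h l simp_thms)
    next
      case (insert b F)
      let ?t = "\<lambda>\<psi>. sym_const (of_real (coord b v)) \<psi> * sym_vec b \<psi>"
      have t: "?t \<in> sym_carrier"
        by (intro sym_carrier.intros)
      have ht: "h ?t = log_class ?t"
        using insert.prems
        by (intro hom_mult sym_carrier.const sym_carrier.vec) (simp_all add: h l basis_lattice)
      have "?s (insert b F) = (\<lambda>\<psi>. ?t \<psi> + ?s F \<psi>)"
        using insert.hyps by simp
      with insert t ht hom_add[of ?t "?s F"] show ?case
        by (simp add: sym_carrier.add)
    qed
    have "?s B = sym_vec v"
      by (simp add: fun_eq_iff sym_const_def sym_vec_def blinfun_eq_coord[of _ v] scaleR_conv_of_real)
    then show ?case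
      using sums[OF order_refl] by (simp only: simp_thms)
  next
    case (add p q)
    then show ?case using hom_add by blast
  next
    case (mult p q)
    then show ?case using hom_mult by blast
  }
qed

lemma log_class_surj: "log_class ` carrier sym_algebra = carrier Q"
proof (intro equalityI subsetI)
  fix X assume "X \<in> carrier Q"
  then obtain p where "p \<in> A" "X = cl p"
    unfolding carrier_Q by blast
  moreover from log_hom_surj[OF this(1)] obtain q where "q \<in> sym_carrier" "log_hom q \<asymp> p" by blast
  ultimately have "X = log_class q" "q \<in> carrier sym_algebra"
    by (simp_all add: log_class_def cl_eq_iff cong_sym)
  then show "X \<in> log_class ` carrier sym_algebra"
    by blast
qed (auto simp: log_class_def intro!: cl_Q log_hom_A)

lemma log_kernel_eq: "log_kernel \<Lambda> J log_class = log_ideal"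
  by (auto simp: log_kernel_def a_kernel_def' log_class_def cl_eq_0_iff log_ideal_def)

lemma ring_hom_ring_log_class: "ring_hom_ring sym_algebra Q log_class"
proof -
  interpret cl: ring_hom_cring "group_algebra \<Lambda>" Q cl by (rule ring_hom_cring_cl)
  show ?thesis
    using log_class_hom ring_sym_algebra cl.S.ring_axioms
    by (intro ring_hom_ringI2) (auto simp: algebra_hom_def)
qed

lemma ideal_log_ideal: "ideal log_ideal sym_algebra"
  using ring_hom_ring.kernel_is_ideal[OF ring_hom_ring_log_class]
  by (simp add: log_kernel_eq[symmetric] log_kernel_def)

lemma log_iso_ring_iso: "log_iso log_class \<in> ring_iso (sym_quot log_ideal) Q"
proof -
  have "log_iso log_class = (\<lambda>X. the_elem (log_class ` X))"
    by (simp add: log_iso_def fun_eq_iff)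
  then show ?thesis
    using ring_hom_ring.FactRing_iso_set[OF ring_hom_ring_log_class log_class_surj]
    by (simp add: log_kernel_eq[symmetric] log_kernel_def)
qed

lemma sym_class_eq: "sym_class log_ideal p = (\<lambda>i \<psi>. i \<psi> + p \<psi>) ` log_ideal"
  by (auto simp: sym_class_def a_r_coset_def')

text \<open>\<open>log_class\<close> is constant on each coset of its kernel, so
  \<open>the_elem\<close> in \<open>log_iso\<close> is applied to a singleton.\<close>

lemma log_iso_sym_class:
  assumes p: "p \<in> sym_carrier"
  shows "log_iso log_class (sym_class log_ideal p) = log_class p"
proof -
  have "log_class (\<lambda>\<psi>. i \<psi> + p \<psi>) = log_class p" if "i \<in> log_ideal" for i
  proof -
    have "log_hom (\<lambda>\<psi>. i \<psi> + p \<psi>) = log_hom i + log_hom p" and "log_hom i \<in> J"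
      using that p by (auto simp: log_ideal_def log_hom_add)
    then show ?thesis
      by (simp add: log_class_def cl_eq_iff cong_def)
  qed
  moreover have "log_ideal \<noteq> {}"
    using sym_carrier.const[of 0] log_hom_const[of 0] by (force simp: log_ideal_def scalar_0 J_0)
  ultimately have "log_class ` sym_class log_ideal p = {log_class p}"
    unfolding sym_class_eq by (auto simp: image_image)
  then show ?thesis
    by (simp add: log_iso_def)
qed

lemma log_iso_algebra_hom:
  "log_iso log_class \<in> algebra_hom (sym_quot log_ideal) (sym_scalar log_ideal) Q (ga_scalar \<Lambda> J)"
  using log_iso_ring_iso log_iso_sym_class[OF sym_carrier.const]
  by (simp add: algebra_hom_def ring_iso_def sym_scalar_def log_class_def log_hom_const ga_scalar_eq)

lemma carrier_sym_quot: "carrier (sym_quot log_ideal) = sym_class log_ideal ` sym_carrier"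
  by (auto simp: FactRing_def A_RCOSETS_def' sym_class_def)

section \<open>Dual spaces and their solution spaces\<close>

abbreviation dual_Q :: "(('v \<Rightarrow>\<^sub>0 complex) set \<Rightarrow> complex) set" where
  "dual_Q \<equiv> algebra_dual Q (ga_scalar \<Lambda> J)"

abbreviation dual_sym :: "((('v \<Rightarrow>\<^sub>L complex) \<Rightarrow> complex) set \<Rightarrow> complex) set" where
  "dual_sym \<equiv> algebra_dual (sym_quot log_ideal) (sym_scalar log_ideal)"

lemma functional_dual:
  assumes f: "f \<in> dual_Q"
  shows "functional (\<lambda>p. f (cl p))"
proof -
  have add: "f (cl (p + q)) = f (cl p) + f (cl q)" if "p \<in> A" "q \<in> A" for p q
    using f that cl_Q by (simp add: cl_add[OF that] algebra_dual_def)
  have scale: "f (cl (\<kappa> c * p)) = c * f (cl p)" if "p \<in> A" for c p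
    using f that cl_Q by (simp add: cl_mult[OF scalar_A that] algebra_dual_def ga_scalar_eq)
  have "f (cl p) = 0" if "p \<in> J" for p
  proof -
    have "cl p = cl (\<kappa> 0 * 0)"
      using that by (simp add: cl_eq_iff J_cong_0)
    then show ?thesis
      using scale[OF A_0, of 0] by simp
  qed
  with add scale show ?thesis
    unfolding functional_def by blast
qed

text \<open>Converse of \<open>functional_dual\<close>: the representative picked by
  \<open>SOME\<close> is irrelevant because a functional respects congruence.\<close>

lemma functional_from_dual:
  assumes G: "functional G"
  obtains f where "f \<in> dual_Q" "\<And>p. p \<in> A \<Longrightarrow> f (cl p) = G p"
proof
  define f where "f X = (if X \<in> carrier Q then G (SOME p. p \<in> A \<and> cl p = X) else 0)" for X
  show f: "f (cl p) = G p" if p: "p \<in> A" for p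
  proof -
    have "\<exists>q. q \<in> A \<and> cl q = cl p"
      using p by blast
    from someI_ex[OF this] have "G (SOME q. q \<in> A \<and> cl q = cl p) = G p"
      using p by (intro functional_cong[OF G]) (simp_all add: cl_eq_iff[symmetric] del: mem_Collect_eq)
    then show ?thesis
      using cl_Q[OF p] by (simp add: f_def)
  qed
  have "f (cl p \<oplus>\<^bsub>Q\<^esub> cl q) = f (cl p) + f (cl q)" if "p \<in> A" "q \<in> A" for p q
    using that unfolding cl_add[OF that, symmetric] by (simp only: f A_add functional_add[OF G])
  moreover have "f (ga_scalar \<Lambda> J c \<otimes>\<^bsub>Q\<^esub> cl p) = c * f (cl p)" if "p \<in> A" for c p
    using that unfolding ga_scalar_eq cl_mult[OF scalar_A that, symmetric]
    by (simp only: f A_mult scalar_A functional_scale[OF G])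
  ultimately show "f \<in> dual_Q"
    unfolding algebra_dual_def carrier_Q by (auto simp: f_def carrier_Q)
qed

lemma dual_ext:
  assumes "f \<in> dual_Q" "g \<in> dual_Q" "\<And>p. p \<in> A \<Longrightarrow> f (cl p) = g (cl p)"
  shows "f = g"
proof
  fix X
  show "f X = g X"
    using assms by (cases "X \<in> carrier Q") (auto simp: carrier_Q algebra_dual_def)
qed

lemma functional_eq_pairing:
  assumes G: "functional G" and p: "p \<in> A" and g: "\<And>a. a \<in> \<Lambda> \<Longrightarrow> g a = G (e a)"
  shows "G p = pairing g p"
proof -
  have "G p = G (\<Sum>a\<in>Poly_Mapping.keys p. \<kappa> (Poly_Mapping.lookup p a) * e a)"
    by (subst poly_mapping_expand[of p]) (simp add: mult_single)
  also have "\<dots> = (\<Sum>a\<in>Poly_Mapping.keys p. G (\<kappa> (Poly_Mapping.lookup p a) * e a))"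
    using p by (intro functional_sum[OF G] A_mult scalar_A e_A) auto
  also have "\<dots> = pairing g p"
    unfolding pairing_def
  proof (intro sum.cong refl)
    fix a assume "a \<in> Poly_Mapping.keys p"
    with p have "a \<in> \<Lambda>" by auto
    then show "G (\<kappa> (Poly_Mapping.lookup p a) * e a) = Poly_Mapping.lookup p a * g a"
      using functional_scale[OF G e_A] g by simp
  qed
  finally show ?thesis .
qed

lemma linear_iso_difference_fun:
  "linear_iso (difference_fun \<Lambda> J) dual_Q (difference_solutions \<Lambda> J)"
proof (rule linear_isoI[OF fun_subspace_algebra_dual])
  have pair: "f (cl p) = pairing (difference_fun \<Lambda> J f) p" if "f \<in> dual_Q" "p \<in> A" for f p
    by (rule functional_eq_pairing[OF functional_dual[OF that(1)] that(2)]) (simp add: difference_fun_def)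
  show "inj_on (difference_fun \<Lambda> J) dual_Q"
    by (rule inj_onI, rule dual_ext) (simp_all only: pair)
  show "difference_fun \<Lambda> J ` dual_Q = difference_solutions \<Lambda> J"
  proof (intro equalityI subsetI)
    fix g assume "g \<in> difference_fun \<Lambda> J ` dual_Q"
    then obtain f where f: "f \<in> dual_Q" "g = difference_fun \<Lambda> J f" by blast
    have "pairing g p = 0" if "p \<in> J" for p
      using pair[OF f(1) J_A[OF that]] functional_J[OF functional_dual[OF f(1)] that] f(2) by simp
    then show "g \<in> difference_solutions \<Lambda> J"
      using f(2) by (simp add: difference_solutions_def difference_fun_def)
  next
    fix g assume g: "g \<in> difference_solutions \<Lambda> J"
    then have "functional (pairing g)"
      by (simp add: functional_def pairing_add pairing_scale difference_solutions_def)
    then obtain f where f: "f \<in> dual_Q" "\<And>p. p \<in> A \<Longrightarrow> f (cl p) = pairing g p"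
      using functional_from_dual by blast
    have "g = difference_fun \<Lambda> J f"
    proof
      fix a
      show "g a = difference_fun \<Lambda> J f a"
        using g f(2)[OF e_A, of a] by (simp add: difference_fun_def difference_solutions_def pairing_single)
    qed
    with f(1) show "g \<in> difference_fun \<Lambda> J ` dual_Q" by blast
  qed
qed (auto simp: difference_fun_def)

text \<open>Stated on the dual of the group algebra quotient, where \<open>solution\<close> lives;
  the passage to the dual of the symmetric quotient is left to
  \<open>linear_iso_factor\<close>.\<close>

lemma linear_iso_solution: "linear_iso (\<lambda>f. solution (\<lambda>p. f (cl p))) dual_Q (differential_solutions log_ideal)"
proof (rule linear_isoI[OF fun_subspace_algebra_dual])
  show "inj_on (\<lambda>f. solution (\<lambda>p. f (cl p))) dual_Q"
    by (rule inj_onI, rule dual_ext, assumption, assumption)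
      (rule solution_inject[OF functional_dual functional_dual])
  show "(\<lambda>f. solution (\<lambda>p. f (cl p))) ` dual_Q = differential_solutions log_ideal"
  proof (intro equalityI subsetI)
    fix u assume "u \<in> differential_solutions log_ideal"
    then obtain G where G: "functional G" "solution G = u"
      using differential_solution_eq_solution by blast
    obtain f where f: "f \<in> dual_Q" "\<And>p. p \<in> A \<Longrightarrow> f (cl p) = G p"
      using functional_from_dual[OF G(1)] by blast
    with G(2) have "u = solution (\<lambda>p. f (cl p))"
      using solution_cong[of G "\<lambda>p. f (cl p)"] by simp
    with f(1) show "u \<in> (\<lambda>f. solution (\<lambda>p. f (cl p))) ` dual_Q" by blast
  qed (auto intro: solution_differential functional_dual)
qed (simp_all add: solution_add solution_scale)

lemma linear_iso_dual_log_iso: "linear_iso (dual_log_iso \<Lambda> J log_class) dual_Q dual_sym"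
proof -
  have "dual_log_iso \<Lambda> J log_class =
      (\<lambda>f X. if X \<in> carrier (sym_quot log_ideal) then f (log_iso log_class X) else 0)"
    by (simp add: dual_log_iso_def log_kernel_eq fun_eq_iff)
  moreover have "sym_scalar log_ideal c \<in> carrier (sym_quot log_ideal)" for c
    unfolding carrier_sym_quot sym_scalar_def by (intro imageI sym_carrier.const)
  ultimately show ?thesis
    using linear_iso_algebra_dual[OF ideal.quotient_is_ring[OF ideal_log_ideal] _ log_iso_algebra_hom]
      log_iso_ring_iso by (simp add: ring_iso_def)
qed

lemma differential_term_sums:
  assumes f: "f \<in> dual_Q"
  shows "differential_term log_ideal (dual_log_iso \<Lambda> J log_class f) x sums solution (\<lambda>p. f (cl p)) x"
proof -
  have "differential_term log_ideal (dual_log_iso \<Lambda> J log_class f) x k =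
      f (cl (log_hom (sym_vec x) ^ k)) / fact k" for k
  proof -
    have "(\<lambda>\<psi>. sym_vec x \<psi> ^ k) \<in> sym_carrier"
      by (intro sym_carrier_power sym_carrier.vec)
    then show ?thesis
      by (simp add: differential_term_def sym_algebra_power dual_log_iso_def log_kernel_eq
          carrier_sym_quot log_iso_sym_class log_class_def log_hom_power[OF sym_carrier.vec])
  qed
  then have "differential_term log_ideal (dual_log_iso \<Lambda> J log_class f) x =
      (\<lambda>k. f (cl (log_hom (sym_vec x) ^ k)) / fact k)"
    by (rule ext)
  then show ?thesis
    using solution_sums[OF functional_dual[OF f], of x] by simp
qed

lemma summable_differential_term:
  "f \<in> dual_Q \<Longrightarrow> summable (differential_term log_ideal (dual_log_iso \<Lambda> J log_class f) x)"
  by (rule sums_summable[OF differential_term_sums])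

lemma differential_fun_eq:
  "f \<in> dual_Q \<Longrightarrow> differential_fun log_ideal (dual_log_iso \<Lambda> J log_class f) = solution (\<lambda>p. f (cl p))"
  unfolding differential_fun_def by (rule ext, rule sums_unique[OF differential_term_sums, symmetric])

lemma log_e_nilpotent_bound: "a \<in> \<Lambda> \<Longrightarrow> log_e a ^ Suc nil_bound \<in> J"
proof -
  assume a: "a \<in> \<Lambda>"
  have "T a ^ Suc nil_bound \<in> J"
    unfolding power_Suc by (intro J_mult nil_bound lift_vec_log_e_A)
  then show ?thesis
    using cong_J[OF cong_power[OF log_e_linear[OF a] log_e_A[OF a] lift_vec_log_e_A]] by blast
qed

lemma difference_fun_eq_exp:
  assumes f: "f \<in> dual_Q" and a: "a \<in> \<Lambda>"
  shows "difference_fun \<Lambda> J f a =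
    exp (blinfun_apply \<phi> a) * f (nil_exp Q (ga_scalar \<Lambda> J) (log_tilde \<Lambda> J \<phi> a))"
proof -
  let ?M = "nil_index a"
  have "f (cl (e a)) = f (cl (\<kappa> (exp (blinfun_apply \<phi> a)) * exp_at ?M (log_e a)))"
    using exp_log_e[OF a nil_index[OF a]] by (simp add: cl_eq_iff[symmetric])
  also have "\<dots> = exp (blinfun_apply \<phi> a) * f (cl (exp_at ?M (log_e a)))"
    by (intro functional_scale[OF functional_dual[OF f]] fps_at_A log_e_A a)
  finally show ?thesis
    using a by (simp add: difference_fun_def nil_exp_log_tilde[OF a log_e_nilpotent[OF a]])
qed

text \<open>For polynomiality the truncation order must not vary with \<open>a\<close>, so
  \<open>Suc nil_bound\<close> takes the place of \<open>nil_index a\<close>; then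
  \<open>log_e a\<close> is replaced by its linear extension \<open>T a\<close>.\<close>

lemma nil_exp_eq_poly_part:
  assumes f: "f \<in> dual_Q" and a: "a \<in> \<Lambda>"
  shows "f (nil_exp Q (ga_scalar \<Lambda> J) (log_tilde \<Lambda> J \<phi> a)) = poly_part (\<lambda>p. f (cl p)) a"
proof -
  let ?M = "Suc nil_bound"
  have "exp_at ?M (log_e a) \<asymp> exp_at ?M (T a)"
    by (intro fps_at_cong log_e_linear a log_e_A lift_vec_log_e_A)
  then have "f (nil_exp Q (ga_scalar \<Lambda> J) (log_tilde \<Lambda> J \<phi> a)) = f (cl (exp_at ?M (T a)))"
    unfolding nil_exp_log_tilde[OF a log_e_nilpotent_bound[OF a]] by (simp only: cl_eq_iff[symmetric])
  also have "\<dots> = (\<Sum>k<?M. f (cl (\<kappa> (fps_nth (fps_exp 1) k) * T a ^ k)))"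
    unfolding fps_at_def
    by (intro functional_sum[OF functional_dual[OF f]] A_mult scalar_A A_power lift_vec_log_e_A)
  also have "\<dots> = (\<Sum>k<?M. fps_nth (fps_exp 1) k * f (cl (T a ^ k)))"
    by (intro sum.cong refl functional_scale[OF functional_dual[OF f]] A_power lift_vec_log_e_A)
  also have "\<dots> = poly_part (\<lambda>p. f (cl p)) a"
    by (simp add: poly_part_def)
  finally show ?thesis .
qed

lemma logarithm_isomorphism:
  "(\<forall>a\<in>\<Lambda>. is_nilpotent Q (unip_class \<Lambda> J \<phi> a)) \<and>
    (\<forall>a\<in>\<Lambda>. is_nilpotent Q (log_tilde \<Lambda> J \<phi> a)) \<and>
    (\<exists>h. is_log_hom \<Lambda> J \<phi> h \<and>
      (\<forall>h'. is_log_hom \<Lambda> J \<phi> h' \<longrightarrow> (\<forall>p\<in>carrier sym_algebra. h' p = h p)) \<and>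
      h ` carrier sym_algebra = carrier Q \<and>
      (let I = log_kernel \<Lambda> J h in
        ideal I sym_algebra \<and>
        log_iso h \<in> ring_iso (sym_quot I) Q \<and>
        log_iso h \<in> algebra_hom (sym_quot I) (sym_scalar I) Q (ga_scalar \<Lambda> J) \<and>
        sym_zeros I = {\<phi>} \<and>
        linear_iso (difference_fun \<Lambda> J) dual_Q (difference_solutions \<Lambda> J) \<and>
        linear_iso (dual_log_iso \<Lambda> J h) dual_Q (algebra_dual (sym_quot I) (sym_scalar I)) \<and>
        (\<forall>g\<in>algebra_dual (sym_quot I) (sym_scalar I). \<forall>x. summable (differential_term I g x)) \<and>
        linear_iso (differential_fun I)
          (algebra_dual (sym_quot I) (sym_scalar I)) (differential_solutions I) \<and>
        (\<exists>\<Theta>. linear_iso \<Theta> (difference_solutions \<Lambda> J) (differential_solutions I) \<and>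
          (\<forall>f\<in>dual_Q. \<Theta> (difference_fun \<Lambda> J f) = differential_fun I (dual_log_iso \<Lambda> J h f))))) \<and>
    (\<forall>f\<in>dual_Q.
      (\<forall>a\<in>\<Lambda>. difference_fun \<Lambda> J f a =
        exp (blinfun_apply \<phi> a) * f (nil_exp Q (ga_scalar \<Lambda> J) (log_tilde \<Lambda> J \<phi> a))) \<and>
      (\<exists>P :: 'v \<Rightarrow> complex. polynomial_function P \<and>
        (\<forall>a\<in>\<Lambda>. f (nil_exp Q (ga_scalar \<Lambda> J) (log_tilde \<Lambda> J \<phi> a)) = P a)))"
proof -
  have nil: "\<forall>a\<in>\<Lambda>. is_nilpotent Q (unip_class \<Lambda> J \<phi> a)"
    unfolding unip_class_def unip_def[symmetric]
    by (intro ballI is_nilpotent_cl[OF unip_A nil_index(2)])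
  have nil_log: "\<forall>a\<in>\<Lambda>. is_nilpotent Q (log_tilde \<Lambda> J \<phi> a)"
    using is_nilpotent_cl[OF log_e_A log_e_nilpotent] by (simp add: log_tilde_eq)
  have unique: "\<forall>h'. is_log_hom \<Lambda> J \<phi> h' \<longrightarrow> (\<forall>p\<in>carrier sym_algebra. h' p = log_class p)"
    using log_hom_unique by simp
  have summable: "\<forall>g\<in>dual_sym. \<forall>x. summable (differential_term log_ideal g x)"
  proof (intro ballI allI)
    fix g x assume g: "g \<in> dual_sym"
    have "dual_log_iso \<Lambda> J log_class ` dual_Q = dual_sym"
      using linear_iso_dual_log_iso by (simp add: linear_iso_def bij_betw_def)
    from g[folded this] show "summable (differential_term log_ideal g x)"
      by (elim imageE) (simp only: summable_differential_term)
  qed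
  have diff: "linear_iso (differential_fun log_ideal) dual_sym (differential_solutions log_ideal)"
    by (rule linear_iso_factor[OF linear_iso_solution linear_iso_dual_log_iso differential_fun_eq])
  \<comment> \<open>Recover the functional from its function on the lattice, then form the solution
    on the whole space.\<close>
  define \<Theta> where "\<Theta> u = solution (\<lambda>p. inv_into dual_Q (difference_fun \<Lambda> J) u (cl p))" for u
  have \<Theta>: "\<Theta> (difference_fun \<Lambda> J f) = solution (\<lambda>p. f (cl p))" if "f \<in> dual_Q" for f
    using that linear_iso_difference_fun by (simp add: \<Theta>_def linear_iso_def bij_betw_def)
  have "linear_iso \<Theta> (difference_solutions \<Lambda> J) (differential_solutions log_ideal)"
    by (rule linear_iso_factor[OF linear_iso_solution linear_iso_difference_fun \<Theta>])
  with \<Theta> have iso: "\<exists>\<Theta>. linear_iso \<Theta> (difference_solutions \<Lambda> J) (differential_solutions log_ideal) \<and>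
      (\<forall>f\<in>dual_Q. \<Theta> (difference_fun \<Lambda> J f) = differential_fun log_ideal (dual_log_iso \<Lambda> J log_class f))"
    by (intro exI[of _ \<Theta>]) (simp add: differential_fun_eq)
  have poly: "\<exists>P :: 'v \<Rightarrow> complex. polynomial_function P \<and>
      (\<forall>a\<in>\<Lambda>. f (nil_exp Q (ga_scalar \<Lambda> J) (log_tilde \<Lambda> J \<phi> a)) = P a)" if "f \<in> dual_Q" for f
    by (intro exI[of _ "poly_part (\<lambda>p. f (cl p))"] conjI ballI nil_exp_eq_poly_part that
        polynomial_function_poly_part functional_dual)
  have zeros: "sym_zeros log_ideal = {\<phi>}"
    unfolding log_ideal_def by (rule sym_zeros_log_hom)
  have "\<forall>f\<in>dual_Q. \<forall>a\<in>\<Lambda>. difference_fun \<Lambda> J f a =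
        exp (blinfun_apply \<phi> a) * f (nil_exp Q (ga_scalar \<Lambda> J) (log_tilde \<Lambda> J \<phi> a))"
    by (intro ballI difference_fun_eq_exp)
  with nil nil_log poly show ?thesis
    by (intro conjI exI[of _ log_class] ballI; (unfold Let_def log_kernel_eq)?;
        (intro conjI is_log_hom_log_class unique log_class_surj ideal_log_ideal log_iso_ring_iso
          log_iso_algebra_hom zeros linear_iso_difference_fun linear_iso_dual_log_iso summable diff iso)?; blast?)
qed

end

theorem proposition9p4:
  fixes \<Lambda> :: "'v::real_normed_vector set"
    and J :: "('v \<Rightarrow>\<^sub>0 complex) set"
    and \<phi> :: "'v \<Rightarrow>\<^sub>L complex"
  assumes "is_lattice \<Lambda>"
    and "span \<Lambda> = UNIV"
    and "ideal J (group_algebra \<Lambda>)"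
    and "torus_zeros \<Lambda> J = {exp_point \<Lambda> \<phi>}"
  shows "(\<forall>a\<in>\<Lambda>. is_nilpotent (ga_quot \<Lambda> J) (unip_class \<Lambda> J \<phi> a)) \<and>
    (\<forall>a\<in>\<Lambda>. is_nilpotent (ga_quot \<Lambda> J) (log_tilde \<Lambda> J \<phi> a)) \<and>
    (\<exists>h. is_log_hom \<Lambda> J \<phi> h \<and>
      (\<forall>h'. is_log_hom \<Lambda> J \<phi> h' \<longrightarrow> (\<forall>p\<in>carrier sym_algebra. h' p = h p)) \<and>
      h ` carrier sym_algebra = carrier (ga_quot \<Lambda> J) \<and>
      (let I = log_kernel \<Lambda> J h in
        ideal I sym_algebra \<and>
        log_iso h \<in> ring_iso (sym_quot I) (ga_quot \<Lambda> J) \<and>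
        log_iso h \<in> algebra_hom (sym_quot I) (sym_scalar I) (ga_quot \<Lambda> J) (ga_scalar \<Lambda> J) \<and>
        sym_zeros I = {\<phi>} \<and>
        linear_iso (difference_fun \<Lambda> J)
          (algebra_dual (ga_quot \<Lambda> J) (ga_scalar \<Lambda> J)) (difference_solutions \<Lambda> J) \<and>
        linear_iso (dual_log_iso \<Lambda> J h)
          (algebra_dual (ga_quot \<Lambda> J) (ga_scalar \<Lambda> J)) (algebra_dual (sym_quot I) (sym_scalar I)) \<and>
        (\<forall>g\<in>algebra_dual (sym_quot I) (sym_scalar I). \<forall>x. summable (differential_term I g x)) \<and>
        linear_iso (differential_fun I)
          (algebra_dual (sym_quot I) (sym_scalar I)) (differential_solutions I) \<and>
        (\<exists>\<Theta>. linear_iso \<Theta> (difference_solutions \<Lambda> J) (differential_solutions I) \<and>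
          (\<forall>f\<in>algebra_dual (ga_quot \<Lambda> J) (ga_scalar \<Lambda> J).
            \<Theta> (difference_fun \<Lambda> J f) = differential_fun I (dual_log_iso \<Lambda> J h f))))) \<and>
    (\<forall>f\<in>algebra_dual (ga_quot \<Lambda> J) (ga_scalar \<Lambda> J).
      (\<forall>a\<in>\<Lambda>. difference_fun \<Lambda> J f a =
        exp (blinfun_apply \<phi> a) * f (nil_exp (ga_quot \<Lambda> J) (ga_scalar \<Lambda> J) (log_tilde \<Lambda> J \<phi> a))) \<and>
      (\<exists>P :: 'v \<Rightarrow> complex. polynomial_function P \<and>
        (\<forall>a\<in>\<Lambda>. f (nil_exp (ga_quot \<Lambda> J) (ga_scalar \<Lambda> J) (log_tilde \<Lambda> J \<phi> a)) = P a)))"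
proof -
  obtain B where B: "finite B" "independent B"
    and \<Lambda>: "\<Lambda> = range (\<lambda>k :: 'v \<Rightarrow> int. \<Sum>b\<in>B. of_int (k b) *\<^sub>R b)"
    using assms(1) unfolding is_lattice_def by blast
  have "\<Lambda> \<subseteq> span B"
    unfolding \<Lambda> by (auto intro!: span_sum span_scale intro: span_base)
  then have "span B = UNIV"
    using span_minimal[of \<Lambda> "span B"] assms(2) by auto
  then have "lattice_basis B \<Lambda>"
    using B \<Lambda> by (intro lattice_basis.intro finite_basis.intro lattice_basis_axioms.intro)
  then interpret lattice_ideal B \<Lambda> J \<phi>
    by (intro lattice_ideal.intro lattice_ideal_axioms.intro assms)
  show ?thesis by (rule logarithm_isomorphism)
qed

end
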